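(* Let $G$ be a countable discrete group acting on a second countable, locally compact, Hausdorff topological space $X$, let $Y\subset X$ be a clopen subset with $GY=X$, and let $N\colon G\to(0,+\infty)$ be a homomorphism, with associated dynamics $\sigma$ on $C^*_r(G\boxtimes Y)$. Suppose there exist a sequence $\{Y_n\}_{n=1}^\infty$ of Borel subsets of $Y$ and a sequence $\{g_n\}_{n=1}^\infty$ of elements of $G$ such that (i) $\bigcup_{n=1}^\infty Y_n$ contains the set of points in $Y$ with nontrivial isotropy; (ii) $N(g_n)\ne1$ for all $n\ge1$; (iii) $g_nY_n=Y_n$ for all $n\ge1$. Then for each $\beta\ne0$ the map $\mu\mapsto\varphi=(\mu_*\circ E)|_{C^*_r(G\boxtimes Y)}$ is an affine isomorphism between Radon measures $\mu$ on $X$ satisfying $\mu(Y)=1$ and the scaling condition $$\mu(gZ)=N(g)^{-\beta}\mu(Z)\quad\text{for all } g\in G \text{ and Borel } Z\subset X,$$ and $\sigma$-KMS$_\beta$-states $\varphi$ on $C^*_r(G\boxtimes Y)$.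
   Context: $G\boxtimes Y=\{(g,x)\mid x\in Y,\ gx\in Y\}$ is a subgroupoid of the transformation groupoid $G\times X$, and $C^*_r(G\boxtimes Y)=\mathbf 1_Y(C_0(X)\rtimes_rG)\mathbf 1_Y$ is its reduced C$^*$-algebra, where $\mathbf 1_Y$ is the characteristic function of $Y$. The dynamics is $\sigma_t(f)(g,x)=N(g)^{it}f(g,x)$ for $t\in\mathbb R$ and $f\in C_c(G\boxtimes Y)\subset C^*_r(G\boxtimes Y)$. For $\beta\in\mathbb R$, a $\sigma$-KMS$_\beta$-state is a $\sigma$-invariant state $\varphi$ such that $\varphi(ab)=\varphi(b\sigma_{i\beta}(a))$ for $a$ and $b$ in a set of $\sigma$-analytic elements with dense linear span. $E\colon C_0(X)\rtimes_rG\to C_0(X)$ is the canonical conditional expectation: with $u_g$ the unitary in the multiplier algebra corresponding to $g\in G$, $E(fu_g)=f$ if $g=e$ and $0$ otherwise; it maps $C^*_r(G\boxtimes Y)$ onto $C_0(Y)$. For a Radon measure $\mu$, $\mu_*$ denotes the functional $f\mapsto\int f\,d\mu$; on $C_0(Y)$ it is a state when $\mu(Y)=1$. A point $x$ has nontrivial isotropy if $gx=x$ for some $g\ne e$ in $G$. *)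

theory Defs
  imports "HOL-Analysis.Analysis"
begin

section \<open>The Hilbert space of square summable functions\<close>

typedef 'i ell2 = "{f :: 'i \<Rightarrow> complex. (\<lambda>i. (cmod (f i))\<^sup>2) summable_on UNIV}"
  morphisms coord Abs_ell2
  by (rule exI[of _ "\<lambda>_. 0"]) simp

setup_lifting type_definition_ell2

lemma summable_coord: "(\<lambda>i. (cmod (coord \<xi> i))\<^sup>2) summable_on UNIV"
  using coord[of \<xi>] by simp

lemma summable_ell2_add:
  fixes f g :: "'i \<Rightarrow> complex"
  assumes "(\<lambda>i. (cmod (f i))\<^sup>2) summable_on UNIV" "(\<lambda>i. (cmod (g i))\<^sup>2) summable_on UNIV"
  shows "(\<lambda>i. (cmod (f i + g i))\<^sup>2) summable_on UNIV"
proof (rule summable_on_comparison_test)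
  show "(\<lambda>i. 2 * (cmod (f i))\<^sup>2 + 2 * (cmod (g i))\<^sup>2) summable_on UNIV"
    by (intro summable_on_add summable_on_cmult_right assms)
  fix i
  have "(cmod (f i + g i))\<^sup>2 \<le> (cmod (f i) + cmod (g i))\<^sup>2"
    by (intro power_mono norm_triangle_ineq) simp
  also have "\<dots> \<le> 2 * (cmod (f i))\<^sup>2 + 2 * (cmod (g i))\<^sup>2"
    using sum_squares_bound[of "cmod (f i)" "cmod (g i)"] by (simp add: power2_sum)
  finally show "(cmod (f i + g i))\<^sup>2 \<le> 2 * (cmod (f i))\<^sup>2 + 2 * (cmod (g i))\<^sup>2" .
qed simp

lemma summable_ell2_mult:
  fixes f m :: "'i \<Rightarrow> complex"
  assumes "(\<lambda>i. (cmod (f i))\<^sup>2) summable_on UNIV" "\<And>i. cmod (m i) \<le> C"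
  shows "(\<lambda>i. (cmod (m i * f i))\<^sup>2) summable_on UNIV"
proof (rule summable_on_comparison_test)
  show "(\<lambda>i. C\<^sup>2 * (cmod (f i))\<^sup>2) summable_on UNIV"
    by (intro summable_on_cmult_right assms)
  show "(cmod (m i * f i))\<^sup>2 \<le> C\<^sup>2 * (cmod (f i))\<^sup>2" for i
    unfolding norm_mult power_mult_distrib
    by (intro mult_right_mono power_mono assms) auto
qed simp

lemma abs_summable_cinner:
  "(\<lambda>i. norm (cnj (coord \<xi> i) * coord \<eta> i)) summable_on UNIV"
proof (rule summable_on_comparison_test)
  show "(\<lambda>i. (cmod (coord \<xi> i))\<^sup>2 + (cmod (coord \<eta> i))\<^sup>2) summable_on UNIV"
    by (intro summable_on_add summable_coord)
  show "norm (cnj (coord \<xi> i) * coord \<eta> i) \<le> (cmod (coord \<xi> i))\<^sup>2 + (cmod (coord \<eta> i))\<^sup>2" for i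
  proof -
    have "0 \<le> cmod (coord \<xi> i) * cmod (coord \<eta> i)" by simp
    then show ?thesis
      using sum_squares_bound[of "cmod (coord \<xi> i)" "cmod (coord \<eta> i)"]
      unfolding norm_mult complex_mod_cnj mult.assoc by linarith
  qed
qed simp

lemma summable_inner:
  "(\<lambda>i. coord \<xi> i \<bullet> coord \<eta> i) summable_on UNIV"
proof -
  have "(\<lambda>i. Re (cnj (coord \<xi> i) * coord \<eta> i)) summable_on UNIV"
    by (rule summable_on_Re[OF abs_summable_summable[OF abs_summable_cinner]])
  then show ?thesis by (simp add: inner_complex_def)
qed

instantiation ell2 :: (type) real_vector
begin

lift_definition zero_ell2 :: "'a ell2" is "\<lambda>_. 0" by simp
lift_definition plus_ell2 :: "'a ell2 \<Rightarrow> 'a ell2 \<Rightarrow> 'a ell2" is "\<lambda>f g i. f i + g i"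
  by (simp add: summable_ell2_add)
lift_definition uminus_ell2 :: "'a ell2 \<Rightarrow> 'a ell2" is "\<lambda>f i. - f i" by simp
lift_definition minus_ell2 :: "'a ell2 \<Rightarrow> 'a ell2 \<Rightarrow> 'a ell2" is "\<lambda>f g i. f i - g i"
  subgoal for f g using summable_ell2_add[of f "\<lambda>i. - g i"] by simp
  done
lift_definition scaleR_ell2 :: "real \<Rightarrow> 'a ell2 \<Rightarrow> 'a ell2" is "\<lambda>r f i. r *\<^sub>R f i"
  subgoal for r f
    using summable_ell2_mult[of f "\<lambda>_. of_real r" "\<bar>r\<bar>"] by (simp add: scaleR_conv_of_real)
  done

instance
  by standard (transfer; simp add: fun_eq_iff algebra_simps)+

end

instantiation ell2 :: (type) real_inner
begin

definition inner_ell2 :: "'a ell2 \<Rightarrow> 'a ell2 \<Rightarrow> real"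
  where "inner_ell2 \<xi> \<eta> = (\<Sum>\<^sub>\<infinity>i. coord \<xi> i \<bullet> coord \<eta> i)"
definition norm_ell2 :: "'a ell2 \<Rightarrow> real"
  where "norm_ell2 \<xi> = sqrt (\<xi> \<bullet> \<xi>)"
definition dist_ell2 :: "'a ell2 \<Rightarrow> 'a ell2 \<Rightarrow> real"
  where "dist_ell2 \<xi> \<eta> = norm (\<xi> - \<eta>)"
definition sgn_ell2 :: "'a ell2 \<Rightarrow> 'a ell2"
  where "sgn_ell2 \<xi> = scaleR (inverse (norm \<xi>)) \<xi>"
definition uniformity_ell2 :: "('a ell2 \<times> 'a ell2) filter"
  where "uniformity_ell2 = (INF e\<in>{0<..}. principal {(x, y). dist x y < e})"
definition open_ell2 :: "'a ell2 set \<Rightarrow> bool"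
  where "open_ell2 U \<longleftrightarrow> (\<forall>x\<in>U. \<forall>\<^sub>F (x', y) in uniformity. x' = x \<longrightarrow> y \<in> U)"

instance
proof
  fix x y z :: "'a ell2" and r :: real
  show "dist x y = norm (x - y)" "sgn x = x /\<^sub>R norm x" "norm x = sqrt (x \<bullet> x)"
    "(uniformity :: ('a ell2 \<times> 'a ell2) filter) = (INF e\<in>{0<..}. principal {(x, y). dist x y < e})"
    by (simp_all add: dist_ell2_def sgn_ell2_def norm_ell2_def uniformity_ell2_def)
  show "open U \<longleftrightarrow> (\<forall>x\<in>U. \<forall>\<^sub>F (x', y) in uniformity. x' = x \<longrightarrow> y \<in> U)" for U :: "'a ell2 set"
    by (simp add: open_ell2_def)
  show "x \<bullet> y = y \<bullet> x"
    by (simp add: inner_ell2_def inner_commute)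
  show "(x + y) \<bullet> z = x \<bullet> z + y \<bullet> z"
    unfolding inner_ell2_def
    by (subst infsum_add[symmetric]) (auto simp: summable_inner plus_ell2.rep_eq inner_add_left)
  show "r *\<^sub>R x \<bullet> y = r * (x \<bullet> y)"
    unfolding inner_ell2_def
    by (subst infsum_cmult_right[symmetric]) (auto simp: summable_inner scaleR_ell2.rep_eq)
  show "0 \<le> x \<bullet> x"
    unfolding inner_ell2_def by (rule infsum_nonneg) simp
  show "x \<bullet> x = 0 \<longleftrightarrow> x = 0"
  proof
    assume *: "x \<bullet> x = 0"
    have "coord x i \<bullet> coord x i = 0" for i
      using * unfolding inner_ell2_def
      by (intro nonneg_infsum_le_0D[OF _ summable_inner[of x x]]) auto
    then show "x = 0"
      by (simp add: coord_inject[symmetric] zero_ell2.rep_eq fun_eq_iff)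
  qed (simp add: inner_ell2_def zero_ell2.rep_eq)
qed

end

definition cinner :: "'i ell2 \<Rightarrow> 'i ell2 \<Rightarrow> complex"
  where "cinner \<xi> \<eta> = (\<Sum>\<^sub>\<infinity>i. cnj (coord \<xi> i) * coord \<eta> i)"

lift_definition delta :: "'i \<Rightarrow> 'i ell2" is "\<lambda>i j. if j = i then 1 else 0"
  subgoal for i
    by (rule finite_nonzero_values_imp_summable_on, rule finite_subset[of _ "{i}"]) auto
  done

lemma cinner_delta: "cinner (delta i) \<xi> = coord \<xi> i"
proof -
  have "cinner (delta i) \<xi> = (\<Sum>\<^sub>\<infinity>j\<in>{i}. coord \<xi> j)"
    unfolding cinner_def
    by (rule infsum_cong_neutral) (auto simp: delta.rep_eq)
  then show ?thesis by simp
qed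

lemma norm_ell2_sq: "(norm \<xi>)\<^sup>2 = (\<Sum>\<^sub>\<infinity>i. (cmod (coord \<xi> i))\<^sup>2)"
  by (simp add: power2_norm_eq_inner inner_ell2_def)

lemma coord_le_norm: "cmod (coord \<xi> i) \<le> norm \<xi>"
proof -
  have "(\<Sum>i\<in>{i}. (cmod (coord \<xi> i))\<^sup>2) \<le> (norm \<xi>)\<^sup>2"
    unfolding norm_ell2_sq by (rule finite_sum_le_infsum) (auto simp: summable_coord)
  then have "(cmod (coord \<xi> i))\<^sup>2 \<le> (norm \<xi>)\<^sup>2" by simp
  then show ?thesis by (rule power2_le_imp_le) simp
qed

lemma norm_delta [simp]: "norm (delta i) = 1"
proof -
  have "(norm (delta i))\<^sup>2 = (\<Sum>\<^sub>\<infinity>j\<in>{i}. 1)"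
    unfolding norm_ell2_sq by (rule infsum_cong_neutral) (auto simp: delta.rep_eq)
  then have "(norm (delta i))\<^sup>2 = 1\<^sup>2" by simp
  then show ?thesis by (rule power2_eq_imp_eq) auto
qed


section \<open>Operators\<close>

type_synonym 'i op = "'i ell2 \<Rightarrow>\<^sub>L 'i ell2"

text \<open>Multiplication by a bounded function on the index set, and composition with a
  bijection of the index set. (Both are unspecified for other arguments.)\<close>

definition diag_op :: "('i \<Rightarrow> complex) \<Rightarrow> 'i op"
  where "diag_op m = Blinfun (\<lambda>\<xi>. Abs_ell2 (\<lambda>i. m i * coord \<xi> i))"

definition perm_op :: "('i \<Rightarrow> 'i) \<Rightarrow> 'i op"
  where "perm_op p = Blinfun (\<lambda>\<xi>. Abs_ell2 (\<lambda>i. coord \<xi> (p i)))"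

text \<open>Bounded linear functions of the library are real linear. Composition with a constant
  multiplication operator gives the multiples of an operator by complex scalars.\<close>

definition scaleC_op :: "complex \<Rightarrow> 'i op \<Rightarrow> 'i op"
  where "scaleC_op c a = diag_op (\<lambda>_. c) o\<^sub>L a"

definition adj :: "'i op \<Rightarrow> 'i op"
  where "adj a = (THE b :: 'i op. \<forall>\<xi> \<eta>. cinner (a \<xi>) \<eta> = cinner \<xi> (b \<eta>))"

lemma coord_diag_op:
  assumes "\<And>i. cmod (m i) \<le> C"
  shows "coord (diag_op m \<xi>) i = m i * coord \<xi> i"
proof -
  have *: "coord (Abs_ell2 (\<lambda>i. m i * coord \<xi> i)) = (\<lambda>i. m i * coord \<xi> i)" for \<xi>
    using summable_ell2_mult[OF summable_coord assms] by (intro Abs_ell2_inverse) simp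
  have "bounded_linear (\<lambda>\<xi>. Abs_ell2 (\<lambda>i. m i * coord \<xi> i))"
  proof (rule bounded_linear_intro[where K = "\<bar>C\<bar>"])
    fix \<xi> \<eta> :: "'a ell2" and r :: real
    show "Abs_ell2 (\<lambda>i. m i * coord (\<xi> + \<eta>) i) =
        Abs_ell2 (\<lambda>i. m i * coord \<xi> i) + Abs_ell2 (\<lambda>i. m i * coord \<eta> i)"
      unfolding coord_inject[symmetric] *[of "\<xi> + \<eta>"] by (simp add: * plus_ell2.rep_eq distrib_left)
    show "Abs_ell2 (\<lambda>i. m i * coord (r *\<^sub>R \<xi>) i) = r *\<^sub>R Abs_ell2 (\<lambda>i. m i * coord \<xi> i)"
      unfolding coord_inject[symmetric] *[of "r *\<^sub>R \<xi>"] by (simp add: * scaleR_ell2.rep_eq)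
    have "(norm (Abs_ell2 (\<lambda>i. m i * coord \<xi> i)))\<^sup>2 \<le> (\<Sum>\<^sub>\<infinity>i. C\<^sup>2 * (cmod (coord \<xi> i))\<^sup>2)"
      unfolding norm_ell2_sq *
    proof (rule infsum_mono)
      show "(\<lambda>i. (cmod (m i * coord \<xi> i))\<^sup>2) summable_on UNIV"
        by (rule summable_ell2_mult[OF summable_coord assms])
      show "(\<lambda>i. C\<^sup>2 * (cmod (coord \<xi> i))\<^sup>2) summable_on UNIV"
        by (intro summable_on_cmult_right summable_coord)
      show "(cmod (m i * coord \<xi> i))\<^sup>2 \<le> C\<^sup>2 * (cmod (coord \<xi> i))\<^sup>2" for i
        unfolding norm_mult power_mult_distrib by (intro mult_right_mono power_mono assms) auto
    qed
    also have "\<dots> = (norm \<xi> * \<bar>C\<bar>)\<^sup>2"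
      by (simp add: infsum_cmult_right' norm_ell2_sq power_mult_distrib mult.commute)
    finally show "norm (Abs_ell2 (\<lambda>i. m i * coord \<xi> i)) \<le> norm \<xi> * \<bar>C\<bar>"
      by (rule power2_le_imp_le) simp
  qed
  then show ?thesis
    unfolding diag_op_def by (simp add: bounded_linear_Blinfun_apply *)
qed

lemma coord_perm_op:
  assumes "bij p"
  shows "coord (perm_op p \<xi>) i = coord \<xi> (p i)"
proof -
  have *: "coord (Abs_ell2 (\<lambda>i. coord \<xi> (p i))) = (\<lambda>i. coord \<xi> (p i))" for \<xi>
    using summable_coord[of \<xi>] summable_on_reindex_bij_betw[OF assms, of "\<lambda>i. (cmod (coord \<xi> i))\<^sup>2"]
    by (intro Abs_ell2_inverse) simp
  have "bounded_linear (\<lambda>\<xi>. Abs_ell2 (\<lambda>i. coord \<xi> (p i)))"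
  proof (rule bounded_linear_intro[where K = 1])
    fix \<xi> \<eta> :: "'a ell2" and r :: real
    show "Abs_ell2 (\<lambda>i. coord (\<xi> + \<eta>) (p i)) =
        Abs_ell2 (\<lambda>i. coord \<xi> (p i)) + Abs_ell2 (\<lambda>i. coord \<eta> (p i))"
      unfolding coord_inject[symmetric] *[of "\<xi> + \<eta>"] by (simp add: * plus_ell2.rep_eq)
    show "Abs_ell2 (\<lambda>i. coord (r *\<^sub>R \<xi>) (p i)) = r *\<^sub>R Abs_ell2 (\<lambda>i. coord \<xi> (p i))"
      unfolding coord_inject[symmetric] *[of "r *\<^sub>R \<xi>"] by (simp add: * scaleR_ell2.rep_eq)
    have "(norm (Abs_ell2 (\<lambda>i. coord \<xi> (p i))))\<^sup>2 = (norm \<xi>)\<^sup>2"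
      unfolding norm_ell2_sq *
      using infsum_reindex_bij_betw[OF assms, of "\<lambda>i. (cmod (coord \<xi> i))\<^sup>2"] by simp
    then show "norm (Abs_ell2 (\<lambda>i. coord \<xi> (p i))) \<le> norm \<xi> * 1"
      by simp
  qed
  then show ?thesis
    unfolding perm_op_def by (simp add: bounded_linear_Blinfun_apply *)
qed


section \<open>The reduced crossed product and its corner\<close>

definition C0 :: "('x::topological_space \<Rightarrow> complex) set"
  where "C0 = {f. continuous_on UNIV f \<and> (\<forall>\<epsilon>>0. \<exists>K. compact K \<and> (\<forall>x. x \<notin> K \<longrightarrow> cmod (f x) < \<epsilon>))}"

text \<open>The group is written additively, although it is not assumed to be commutative.
  A bounded function \<open>f\<close> on \<open>X\<close> and a group element \<open>g\<close> act on the square summable functions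
  on \<open>G \<times> X\<close> by \<open>(f \<xi>)(h, x) = f(hx) \<xi>(h, x)\<close> and \<open>(u\<^sub>g \<xi>)(h, x) = \<xi>(g\<^sup>-\<^sup>1h, x)\<close>. This is the
  regular representation induced from the faithful representation of \<open>C0\<close> by multiplication
  operators on the square summable functions on \<open>X\<close>; it satisfies \<open>u\<^sub>g f u\<^sub>g\<^sup>* = f(g\<^sup>-\<^sup>1\<cdot>)\<close>.\<close>

definition fun_op :: "('g \<Rightarrow> 'x \<Rightarrow> 'x) \<Rightarrow> ('x \<Rightarrow> complex) \<Rightarrow> ('g \<times> 'x) op"
  where "fun_op act f = diag_op (\<lambda>(h, x). f (act h x))"

definition group_op :: "'g::group_add \<Rightarrow> ('g \<times> 'x) op"
  where "group_op g = perm_op (\<lambda>(h, x). (- g + h, x))"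

text \<open>The real span is already a complex subspace, since \<open>C0\<close> is closed under complex multiples.\<close>

definition crossed_product :: "('g::group_add \<Rightarrow> 'x::topological_space \<Rightarrow> 'x) \<Rightarrow> ('g \<times> 'x) op set"
  where "crossed_product act = closure (span {fun_op act f o\<^sub>L group_op g | f g. f \<in> C0})"

definition corner :: "('g::group_add \<Rightarrow> 'x::topological_space \<Rightarrow> 'x) \<Rightarrow> 'x set \<Rightarrow> ('g \<times> 'x) op set"
  where "corner act Y = (\<lambda>a. fun_op act (indicator Y) o\<^sub>L a o\<^sub>L fun_op act (indicator Y)) ` crossed_product act"

definition groupoid_top ::
    "('g \<Rightarrow> 'x::topological_space \<Rightarrow> 'x) \<Rightarrow> 'x set \<Rightarrow> ('g \<times> 'x) topology"
  where "groupoid_top act Y =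
    subtopology (prod_topology (discrete_topology UNIV) euclidean) {(g, x). x \<in> Y \<and> act g x \<in> Y}"

text \<open>Functions on the groupoid are extended by zero to \<open>G \<times> X\<close>.\<close>

definition Cc :: "('g \<Rightarrow> 'x::topological_space \<Rightarrow> 'x) \<Rightarrow> 'x set \<Rightarrow> ('g \<times> 'x \<Rightarrow> complex) set"
  where "Cc act Y = {F. continuous_map (groupoid_top act Y) euclidean F \<and>
    (\<exists>K. compactin (groupoid_top act Y) K \<and> (\<forall>p. p \<notin> K \<longrightarrow> F p = 0))}"

text \<open>A function \<open>F\<close> on the groupoid is the sum of the \<open>f\<^sub>g u\<^sub>g\<close> with \<open>f\<^sub>g(y) = F(g, g\<^sup>-\<^sup>1y)\<close>,
  because \<open>y\<close> is the range \<open>gx\<close> of \<open>(g, x)\<close>. Only finitely many \<open>f\<^sub>g\<close> are nonzero if \<open>F\<close> has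
  compact support.\<close>

definition Cc_op :: "('g::group_add \<Rightarrow> 'x \<Rightarrow> 'x) \<Rightarrow> ('g \<times> 'x \<Rightarrow> complex) \<Rightarrow> ('g \<times> 'x) op"
  where "Cc_op act F =
    (\<Sum>g | \<exists>x. F (g, x) \<noteq> 0. fun_op act (\<lambda>y. F (g, act (- g) y)) o\<^sub>L group_op g)"

text \<open>Each dynamics \<open>\<sigma>\<^sub>t\<close> is the continuous extension of multiplication by \<open>N(g)\<^sup>i\<^sup>t\<close>
  from the compactly supported functions, and \<open>E\<close> is the contractive linear extension of
  \<open>f u\<^sub>g \<mapsto> \<delta>\<^sub>g\<^sub>,\<^sub>e f\<close>. By density the conditions determine \<open>\<sigma>\<close> on the corner and \<open>E\<close> on the
  crossed product; existence is shown below.\<close>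

definition associated_dynamics ::
    "('g::group_add \<Rightarrow> 'x::topological_space \<Rightarrow> 'x) \<Rightarrow> 'x set \<Rightarrow> ('g \<Rightarrow> real) \<Rightarrow>
      (real \<Rightarrow> ('g \<times> 'x) op \<Rightarrow> ('g \<times> 'x) op) \<Rightarrow> bool"
  where "associated_dynamics act Y N \<sigma> \<longleftrightarrow> (\<forall>t. continuous_on (corner act Y) (\<sigma> t) \<and>
    (\<forall>F\<in>Cc act Y. \<sigma> t (Cc_op act F) =
      Cc_op act (\<lambda>(g, x). complex_of_real (N g) powr (\<i> * complex_of_real t) * F (g, x))))"

definition canonical_expectation ::
    "('g::group_add \<Rightarrow> 'x::topological_space \<Rightarrow> 'x) \<Rightarrow> (('g \<times> 'x) op \<Rightarrow> 'x \<Rightarrow> complex) \<Rightarrow> bool"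
  where "canonical_expectation act E \<longleftrightarrow>
    (\<forall>a\<in>crossed_product act. E a \<in> C0 \<and> (\<forall>x. cmod (E a x) \<le> norm a)) \<and>
    (\<forall>a\<in>crossed_product act. \<forall>b\<in>crossed_product act. \<forall>x. E (a + b) x = E a x + E b x) \<and>
    (\<forall>a\<in>crossed_product act. \<forall>c x. E (scaleC_op c a) x = c * E a x) \<and>
    (\<forall>f\<in>C0. \<forall>g. E (fun_op act f o\<^sub>L group_op g) = (if g = 0 then f else (\<lambda>_. 0)))"

lemma C0_bounded:
  assumes "f \<in> C0"
  obtains C where "\<And>x. cmod (f x) \<le> C"
proof -
  from assms obtain K where K: "compact K" "\<And>x. x \<notin> K \<Longrightarrow> cmod (f x) < 1"
    and f: "continuous_on UNIV f"
    unfolding C0_def by (auto dest: spec[of _ 1])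
  have "bounded (f ` K)"
    using compact_continuous_image[OF continuous_on_subset[OF f] K(1)] by (auto intro: compact_imp_bounded)
  then obtain B where "\<And>x. x \<in> K \<Longrightarrow> cmod (f x) \<le> B"
    by (auto simp: bounded_iff)
  then have "cmod (f x) \<le> max B 1" for x
    using K(2)[of x] \<open>\<And>x. x \<in> K \<Longrightarrow> cmod (f x) \<le> B\<close>[of x] by (cases "x \<in> K") (simp_all add: max.coboundedI1 max.coboundedI2 less_imp_le)
  then show ?thesis by (rule that)
qed

lemma coord_fun_op:
  assumes "\<And>x. cmod (f x) \<le> C"
  shows "coord (fun_op act f \<xi>) (h, x) = f (act h x) * coord \<xi> (h, x)"
  unfolding fun_op_def by (subst coord_diag_op[where C = C]) (auto simp: assms)

lemma coord_group_op: "coord (group_op g \<xi>) (h, x) = coord \<xi> (- g + h, x)"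
proof -
  have "bij (\<lambda>(h, x). (- g + h, x))"
    by (rule bij_betw_byWitness[where f' = "\<lambda>(h, x). (g + h, x)"]) auto
  then show ?thesis unfolding group_op_def by (subst coord_perm_op) simp_all
qed

lemma coord_scaleC_op: "coord (scaleC_op c a \<xi>) i = c * coord (a \<xi>) i"
  unfolding scaleC_op_def by (simp add: coord_diag_op[where C = "cmod c"])

lemma C0_uniform_limit:
  assumes "\<And>\<epsilon>. \<epsilon> > 0 \<Longrightarrow> \<exists>g\<in>C0. \<forall>x. cmod (f x - g x) < \<epsilon>"
  shows "f \<in> C0"
proof -
  have "\<exists>g. \<forall>n. g n \<in> C0 \<and> (\<forall>x. cmod (f x - g n x) < inverse (real (Suc n)))"
    using assms by (intro choice) (meson inverse_positive_iff_positive of_nat_0_less_iff zero_less_Suc)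
  then obtain g where g: "\<And>n. g n \<in> C0" "\<And>n x. cmod (f x - g n x) < inverse (real (Suc n))"
    by blast
  have "uniform_limit UNIV g f sequentially"
  proof (rule uniform_limitI)
    fix e :: real assume "e > 0"
    with LIMSEQ_inverse_real_of_nat have "\<forall>\<^sub>F n in sequentially. inverse (real (Suc n)) < e"
      by (rule order_tendstoD(2))
    then show "\<forall>\<^sub>F n in sequentially. \<forall>x\<in>UNIV. dist (g n x) (f x) < e"
      by eventually_elim (metis dist_commute dist_norm g(2) less_trans)
  qed
  then have "continuous_on UNIV f"
    by (rule uniform_limit_theorem[rotated]) (use g(1) in \<open>auto simp: C0_def\<close>)
  moreover have "\<exists>K. compact K \<and> (\<forall>x. x \<notin> K \<longrightarrow> cmod (f x) < \<epsilon>)" if "\<epsilon> > 0" for \<epsilon>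
  proof -
    have "\<epsilon> / 2 > 0" using that by simp
    obtain k where k: "k \<in> C0" "\<And>x. cmod (f x - k x) < \<epsilon> / 2"
      using assms[OF \<open>\<epsilon> / 2 > 0\<close>] by blast
    obtain K where K: "compact K" "\<And>x. x \<notin> K \<Longrightarrow> cmod (k x) < \<epsilon> / 2"
      using k(1) \<open>\<epsilon> / 2 > 0\<close> unfolding C0_def by blast
    have "cmod (f x) < \<epsilon>" if "x \<notin> K" for x
      using norm_triangle_sub[of "f x" "k x"] k(2)[of x] K(2)[OF that] by linarith
    with K(1) show ?thesis by blast
  qed
  ultimately show ?thesis unfolding C0_def by blast
qed

lemma C0_add: "f \<in> C0 \<Longrightarrow> g \<in> C0 \<Longrightarrow> (\<lambda>x. f x + g x) \<in> C0"
proof -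
  assume fg: "f \<in> C0" "g \<in> C0"
  have "\<exists>K. compact K \<and> (\<forall>x. x \<notin> K \<longrightarrow> cmod (f x + g x) < \<epsilon>)" if "\<epsilon> > 0" for \<epsilon>
  proof -
    have "\<epsilon> / 2 > 0" using that by simp
    with fg obtain K L where K: "compact K" "\<And>x. x \<notin> K \<Longrightarrow> cmod (f x) < \<epsilon> / 2"
      and L: "compact L" "\<And>x. x \<notin> L \<Longrightarrow> cmod (g x) < \<epsilon> / 2"
      unfolding C0_def by blast
    have "cmod (f x + g x) < \<epsilon>" if "x \<notin> K \<union> L" for x
      using norm_triangle_ineq[of "f x" "g x"] K(2)[of x] L(2)[of x] that by auto
    with K(1) L(1) show ?thesis by (intro exI[of _ "K \<union> L"]) auto
  qed
  with fg show ?thesis unfolding C0_def by (auto intro!: continuous_intros)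
qed

lemma C0_mult:
  assumes "f \<in> C0" shows "(\<lambda>x. c * f x) \<in> C0"
proof (cases "c = 0")
  case False
  have "\<exists>K. compact K \<and> (\<forall>x. x \<notin> K \<longrightarrow> cmod (c * f x) < \<epsilon>)" if "\<epsilon> > 0" for \<epsilon>
  proof -
    have "\<epsilon> / cmod c > 0" using that False by simp
    then obtain K where "compact K" "\<And>x. x \<notin> K \<Longrightarrow> cmod (f x) < \<epsilon> / cmod c"
      using assms unfolding C0_def by blast
    with False show ?thesis by (intro exI[of _ K]) (auto simp: norm_mult field_simps)
  qed
  with assms show ?thesis unfolding C0_def by (auto intro!: continuous_intros)
qed (auto simp: C0_def intro!: exI[of _ "{}"])

lemma ex_canonical_expectation:
  fixes act :: "'g::group_add \<Rightarrow> 'x::topological_space \<Rightarrow> 'x"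
  assumes "\<And>x. act 0 x = x"
  shows "canonical_expectation act (\<lambda>(a :: ('g \<times> 'x) op) x. cinner (delta (0, x)) (a (delta (0, x))))"
proof -
  define E where "E = (\<lambda>(a :: ('g \<times> 'x) op) x. cinner (delta (0, x)) (a (delta (0, x))))"
  have E: "E a x = coord (a (delta (0, x))) (0, x)" for a x
    by (simp add: E_def cinner_delta)
  have bound: "cmod (E a x) \<le> norm a" for a x
    unfolding E using norm_blinfun[of a "delta (0, x)"] by (simp add: order_trans[OF coord_le_norm])
  have add: "E (a + b) x = E a x + E b x" for a b x
    by (simp add: E blinfun.add_left plus_ell2.rep_eq)
  have diff: "E (a - b) x = E a x - E b x" for a b x
    by (simp add: E blinfun.diff_left minus_ell2.rep_eq)
  have scaleC: "E (scaleC_op c a) x = c * E a x" for c a x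
    by (simp add: E coord_scaleC_op)
  have scaleR: "E (r *\<^sub>R a) x = of_real r * E a x" for r a x
    by (simp add: E blinfun.scaleR_left scaleR_ell2.rep_eq scaleR_conv_of_real)
  have gen: "E (fun_op act f o\<^sub>L group_op g) = (if g = 0 then f else (\<lambda>_. 0))" if "f \<in> C0" for f g
  proof -
    obtain C where C: "\<And>x. cmod (f x) \<le> C" using C0_bounded[OF \<open>f \<in> C0\<close>] by blast
    show ?thesis
      by (rule ext) (simp add: E coord_fun_op[OF C] coord_group_op delta.rep_eq assms)
  qed
  have zero: "(\<lambda>_. 0) \<in> C0" by (auto simp: C0_def intro!: exI[of _ "{}"])
  have span: "E a \<in> C0" if "a \<in> span {fun_op act f o\<^sub>L group_op g | f g. f \<in> C0}" for a
    using that
  proof (induction rule: span_induct_alt)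
    case base
    then show ?case using zero by (simp add: E zero_ell2.rep_eq)
  next
    case (step c x y)
    then have "E x \<in> C0" using gen zero by auto
    moreover have "E (c *\<^sub>R x + y) = (\<lambda>z. of_real c * E x z + E y z)"
      by (simp add: fun_eq_iff add scaleR)
    ultimately show ?case using step by (simp add: C0_add C0_mult)
  qed
  have "E a \<in> C0" if "a \<in> crossed_product act" for a
  proof (rule C0_uniform_limit)
    fix \<epsilon> :: real assume "\<epsilon> > 0"
    then obtain b where b: "b \<in> span {fun_op act f o\<^sub>L group_op g | f g. f \<in> C0}" "dist b a < \<epsilon>"
      using \<open>a \<in> crossed_product act\<close> unfolding crossed_product_def closure_approachable by blast
    have "cmod (E a x - E b x) < \<epsilon>" for x
      using bound[of "a - b" x] b(2) by (simp add: diff dist_norm norm_minus_commute)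
    with span[OF b(1)] show "\<exists>k\<in>C0. \<forall>x. cmod (E a x - k x) < \<epsilon>" by blast
  qed
  then show ?thesis
    unfolding canonical_expectation_def E_def[symmetric]
    using bound add scaleC gen by simp
qed

lemma Cc_bounded:
  assumes "F \<in> Cc act Y"
  obtains C where "\<And>p. cmod (F p) \<le> C"
proof -
  obtain K where K: "compactin (groupoid_top act Y) K" "\<And>p. p \<notin> K \<Longrightarrow> F p = 0"
    and F: "continuous_map (groupoid_top act Y) euclidean F"
    using assms unfolding Cc_def by blast
  have "bounded (F ` K)"
    using image_compactin[OF K(1) F] by (auto intro: compact_imp_bounded)
  then obtain B where B: "\<And>p. p \<in> K \<Longrightarrow> cmod (F p) \<le> B"
    by (auto simp: bounded_iff)
  have "cmod (F p) \<le> max B 0" for p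
    using B[of p] K(2)[of p] by (cases "p \<in> K") auto
  then show ?thesis by (rule that)
qed

lemma ex_associated_dynamics:
  fixes N :: "'g::group_add \<Rightarrow> real" and act :: "'g \<Rightarrow> 'x::topological_space \<Rightarrow> 'x"
  assumes pos: "\<And>g. N g > 0" and hom: "\<And>g h. N (g + h) = N g * N h"
  shows "\<exists>\<sigma>. associated_dynamics act Y N \<sigma>"
proof -
  define c where "c = (\<lambda>t g. complex_of_real (N g) powr (\<i> * complex_of_real t))"
  define U :: "real \<Rightarrow> ('g \<times> 'x) op" where "U = (\<lambda>t. diag_op (\<lambda>(h, x). c t h))"
  have norm_c: "cmod (c t g) = 1" for t g
    using pos[of g] by (simp add: c_def norm_powr_real_powr)
  have c_add: "c t (g + h) = c t g * c t h" for t g h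
    using pos by (simp add: c_def hom powr_times_real less_imp_le)
  have c_minus: "c t g * c (- t) g = 1" for t g
    using pos[of g] by (simp add: c_def powr_minus less_imp_neq)
  have U: "coord (U t \<xi>) (h, x) = c t h * coord \<xi> (h, x)" for t \<xi> h x
    unfolding U_def by (subst coord_diag_op[where C = 1]) (auto simp: norm_c)
  have *: "U t o\<^sub>L Cc_op act F o\<^sub>L U (- t) = Cc_op act (\<lambda>(g, x). c t g * F (g, x))"
    if "F \<in> Cc act Y" for F t
  proof -
    obtain C where C: "\<And>p. cmod (F p) \<le> C" using Cc_bounded[OF \<open>F \<in> Cc act Y\<close>] by blast
    have 1: "U t o\<^sub>L (fun_op act (\<lambda>y. F (g, act (- g) y)) o\<^sub>L group_op g) o\<^sub>L U (- t) =
      fun_op act (\<lambda>y. c t g * F (g, act (- g) y)) o\<^sub>L group_op g" for g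
    proof (intro blinfun_eqI)
      fix \<xi> :: "('g \<times> 'x) ell2"
      have 2: "c t h * c (- t) (- g + h) = c t g" for h
      proof -
        have "c t h = c t g * c t (- g + h)" using c_add[of t g "- g + h"] by simp
        then show ?thesis by (simp only: mult.assoc c_minus mult_1_right)
      qed
      show "(U t o\<^sub>L (fun_op act (\<lambda>y. F (g, act (- g) y)) o\<^sub>L group_op g) o\<^sub>L U (- t)) \<xi> =
        (fun_op act (\<lambda>y. c t g * F (g, act (- g) y)) o\<^sub>L group_op g) \<xi>"
        unfolding coord_inject[symmetric]
      proof (intro ext, clarify)
        fix h x
        have "coord ((U t o\<^sub>L (fun_op act (\<lambda>y. F (g, act (- g) y)) o\<^sub>L group_op g) o\<^sub>L U (- t)) \<xi>) (h, x)
          = c t h * (F (g, act (- g) (act h x)) * (c (- t) (- g + h) * coord \<xi> (- g + h, x)))"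
          by (simp add: U coord_fun_op[where C = C] coord_group_op C)
        also have "\<dots> = (c t h * c (- t) (- g + h)) * F (g, act (- g) (act h x)) * coord \<xi> (- g + h, x)"
          by (simp only: mult_ac)
        also have "\<dots> = coord ((fun_op act (\<lambda>y. c t g * F (g, act (- g) y)) o\<^sub>L group_op g) \<xi>) (h, x)"
          by (simp add: 2 coord_fun_op[where C = C] coord_group_op norm_mult norm_c C)
        finally show "coord ((U t o\<^sub>L (fun_op act (\<lambda>y. F (g, act (- g) y)) o\<^sub>L group_op g) o\<^sub>L U (- t)) \<xi>) (h, x) =
          coord ((fun_op act (\<lambda>y. c t g * F (g, act (- g) y)) o\<^sub>L group_op g) \<xi>) (h, x)" .
      qed
    qed
    have "c t g \<noteq> 0" for g using norm_c[of t g] by auto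
    then have 3: "{g. \<exists>x. (case (g, x) of (g, x) \<Rightarrow> c t g * F (g, x)) \<noteq> 0} = {g. \<exists>x. F (g, x) \<noteq> 0}"
      by auto
    have "U t o\<^sub>L (\<Sum>g\<in>S. T g) o\<^sub>L U (- t) = (\<Sum>g\<in>S. U t o\<^sub>L T g o\<^sub>L U (- t))" for S and T :: "'g \<Rightarrow> ('g \<times> 'x) op"
      by (intro blinfun_eqI) (simp add: blinfun.sum_left blinfun.sum_right)
    then show ?thesis unfolding Cc_op_def 3 by (simp add: 1)
  qed
  have "continuous_on (corner act Y) (\<lambda>a. U t o\<^sub>L a o\<^sub>L U (- t))" for t
    by (intro continuous_intros)
  with * have "associated_dynamics act Y N (\<lambda>t a. U t o\<^sub>L a o\<^sub>L U (- t))"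
    unfolding associated_dynamics_def c_def by blast
  then show ?thesis by blast
qed


section \<open>KMS states\<close>

text \<open>Functionals on a C*-algebra \<open>A\<close> of operators are functions that are undefined outside \<open>A\<close>.\<close>

definition is_state :: "'i op set \<Rightarrow> ('i op \<Rightarrow> complex) \<Rightarrow> bool"
  where "is_state A \<phi> \<longleftrightarrow> \<phi> \<in> extensional A \<and>
    (\<forall>a\<in>A. \<forall>b\<in>A. \<phi> (a + b) = \<phi> a + \<phi> b) \<and>
    (\<forall>a\<in>A. \<forall>c. \<phi> (scaleC_op c a) = c * \<phi> a) \<and>
    (\<forall>a\<in>A. \<phi> (adj a o\<^sub>L a) \<in> \<real>\<^sub>\<ge>\<^sub>0) \<and>
    bdd_above {cmod (\<phi> a) | a. a \<in> A \<and> norm a \<le> 1} \<and>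
    Sup {cmod (\<phi> a) | a. a \<in> A \<and> norm a \<le> 1} = 1"

text \<open>\<open>F\<close> is an entire \<open>A\<close>-valued function extending the orbit map \<open>t \<mapsto> \<sigma>\<^sub>t(a)\<close>, so that
  \<open>\<sigma>\<^sub>z(a) = F z\<close>.\<close>

definition entire_extension ::
    "'i op set \<Rightarrow> (real \<Rightarrow> 'i op \<Rightarrow> 'i op) \<Rightarrow> 'i op \<Rightarrow> (complex \<Rightarrow> 'i op) \<Rightarrow> bool"
  where "entire_extension A \<sigma> a F \<longleftrightarrow> range F \<subseteq> A \<and> (\<forall>t. F (complex_of_real t) = \<sigma> t a) \<and>
    (\<forall>z. \<exists>D. ((\<lambda>w. scaleC_op (inverse (w - z)) (F w - F z)) \<longlongrightarrow> D) (at z))"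

definition is_kms_state ::
    "'i op set \<Rightarrow> (real \<Rightarrow> 'i op \<Rightarrow> 'i op) \<Rightarrow> real \<Rightarrow> ('i op \<Rightarrow> complex) \<Rightarrow> bool"
  where "is_kms_state A \<sigma> \<beta> \<phi> \<longleftrightarrow> is_state A \<phi> \<and> (\<forall>t. \<forall>a\<in>A. \<phi> (\<sigma> t a) = \<phi> a) \<and>
    (\<exists>S\<subseteq>A. A \<subseteq> closure (span {scaleC_op c a | c a. a \<in> S}) \<and>
      (\<forall>a\<in>S. \<exists>F. entire_extension A \<sigma> a F \<and>
        (\<forall>b\<in>S. \<phi> (a o\<^sub>L b) = \<phi> (b o\<^sub>L F (\<i> * complex_of_real \<beta>)))))"


section \<open>Radon measures\<close>

definition radon_measure :: "'x::topological_space measure \<Rightarrow> bool"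
  where "radon_measure \<mu> \<longleftrightarrow> sets \<mu> = sets borel \<and>
    (\<forall>K. compact K \<longrightarrow> emeasure \<mu> K < \<infinity>) \<and>
    (\<forall>Z\<in>sets borel. emeasure \<mu> Z = (INF U\<in>{U. open U \<and> Z \<subseteq> U}. emeasure \<mu> U)) \<and>
    (\<forall>U. open U \<longrightarrow> emeasure \<mu> U = (SUP K\<in>{K. compact K \<and> K \<subseteq> U}. emeasure \<mu> K))"

definition convex_comb :: "real \<Rightarrow> 'x::topological_space measure \<Rightarrow> 'x measure \<Rightarrow> 'x measure"
  where "convex_comb s \<mu> \<nu> = measure_of UNIV (sets borel)
    (\<lambda>Z. ennreal s * emeasure \<mu> Z + ennreal (1 - s) * emeasure \<nu> Z)"

definition kms_measures ::
    "('g \<Rightarrow> 'x::topological_space \<Rightarrow> 'x) \<Rightarrow> 'x set \<Rightarrow> ('g \<Rightarrow> real) \<Rightarrow> real \<Rightarrow> 'x measure set"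
  where "kms_measures act Y N \<beta> = {\<mu>. radon_measure \<mu> \<and> emeasure \<mu> Y = 1 \<and>
    (\<forall>g. \<forall>Z\<in>sets borel. emeasure \<mu> (act g ` Z) = ennreal (N g powr - \<beta>) * emeasure \<mu> Z)}"

definition state_of_measure ::
    "('g::group_add \<Rightarrow> 'x::topological_space \<Rightarrow> 'x) \<Rightarrow> 'x set \<Rightarrow> (('g \<times> 'x) op \<Rightarrow> 'x \<Rightarrow> complex) \<Rightarrow>
      'x measure \<Rightarrow> ('g \<times> 'x) op \<Rightarrow> complex"
  where "state_of_measure act Y E \<mu> = restrict (\<lambda>a. \<integral>x. E a x \<partial>\<mu>) (corner act Y)"

end

theory Submission
  imports Defs "HOL-Complex_Analysis.Conformal_Mappings"
begin

text \<open>The restriction of a KMS state \<open>\<phi>\<close> to the functions on \<open>Y\<close> is given by a measure obeying the scaling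
  condition inside \<open>Y\<close>. A set of finite measure invariant under some \<open>g\<close> with \<open>N g \<noteq> 1\<close> is null, so
  almost every point of \<open>Y\<close> has trivial isotropy. Since \<open>\<phi>\<close> is tracial against functions on \<open>Y\<close>, it
  kills \<open>f u\<^sub>g\<close> when \<open>f\<close> lives away from the fixed points of \<open>g \<noteq> e\<close>, and the Cauchy-Schwarz
  inequality takes care of a neighbourhood of the fixed points; hence \<open>\<phi> = \<phi> \<circ> E\<close>. The measure
  spreads from \<open>Y\<close> to \<open>X\<close> along the translates of \<open>Y\<close>. As the KMS condition is only assumed on a set
  with dense span, it is first carried over to the elements \<open>f u\<^sub>g\<close> by comparing the boundary values
  of bounded holomorphic functions on the strip between \<open>\<real>\<close> and \<open>\<real> + \<i>\<beta>\<close>. Conversely, for a measure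
  obeying the scaling condition the KMS condition is a change of variables.\<close>

section \<open>Functions vanishing at infinity\<close>

text \<open>Unless \<open>Y\<close> is compact, its indicator lies outside the algebra. So the mass
  of \<open>Y\<close> is not read off from a unit: one inequality comes from an approximate unit,
  the other from the norm of \<phi> once \<phi> = \<phi> o \<open>E\<close> is known. The set given
  with the KMS condition need be neither closed under products nor made of homogeneous elements, so
  \<open>f u_g\<close> can only be approximated by analytic elements \<open>a\<close> with extension
  \<open>F\<close>. What saves the estimate is that \<sigma>_t does not increase norms and
  multiplies \<open>f u_g\<close> by \<open>N(g)^(it)\<close>: the function
  \<open>N(g)^(-iz) \<phi>(b F(z))\<close> stays uniformly close to one constant on the real line
  and to another on the shifted line, and invariance together with the KMS condition identifies the
  second constant. Commutators with functions cannot see the fixed points of \<open>g\<close>; there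
  \<phi> is controlled only through the measure, and this is where the null set of isotropy
  enters.\<close>

lemma C0_dominated:
  assumes "f \<in> C0" "continuous_on UNIV g" "\<And>x. cmod (g x) \<le> c * cmod (f x)"
  shows "g \<in> C0"
  unfolding C0_def
proof (clarsimp simp: assms(2))
  fix \<epsilon> :: real assume "\<epsilon> > 0"
  then have "\<epsilon> / (\<bar>c\<bar> + 1) > 0" by simp
  then obtain K where K: "compact K" "\<And>x. x \<notin> K \<Longrightarrow> cmod (f x) < \<epsilon> / (\<bar>c\<bar> + 1)"
    using assms(1) unfolding C0_def by blast
  have "cmod (g x) < \<epsilon>" if "x \<notin> K" for x
  proof -
    have "cmod (g x) \<le> (\<bar>c\<bar> + 1) * cmod (f x)"
      by (rule order_trans[OF assms(3)]) (simp add: mult_right_mono)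
    also have "\<dots> < \<epsilon>" using K(2)[OF that] by (simp add: field_simps)
    finally show ?thesis .
  qed
  with K(1) show "\<exists>K. compact K \<and> (\<forall>x. x \<notin> K \<longrightarrow> cmod (g x) < \<epsilon>)" by blast
qed

definition C0_real :: "('x::topological_space \<Rightarrow> real) set"
  where "C0_real = {f. (\<lambda>x. complex_of_real (f x)) \<in> C0}"

lemma C0_real_cont: "f \<in> C0_real \<Longrightarrow> continuous_on UNIV f"
  unfolding C0_real_def C0_def using continuous_on_Re[of UNIV "\<lambda>x. complex_of_real (f x)"] by simp

lemma C0_real_small:
  assumes "f \<in> C0_real" "\<epsilon> > 0"
  obtains K where "compact K" "\<And>x. x \<notin> K \<Longrightarrow> \<bar>f x\<bar> < \<epsilon>"
  using assms unfolding C0_real_def C0_def by auto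

lemma C0_real_bounded:
  assumes "f \<in> C0_real" obtains C where "\<And>x. \<bar>f x\<bar> \<le> C"
  using assms C0_bounded[of "\<lambda>x. complex_of_real (f x)"] unfolding C0_real_def by auto

lemma C0_real_dominated:
  "f \<in> C0_real \<Longrightarrow> continuous_on UNIV g \<Longrightarrow> (\<And>x. \<bar>g x\<bar> \<le> c * \<bar>f x\<bar>) \<Longrightarrow> g \<in> C0_real"
  unfolding C0_real_def by simp (rule C0_dominated[where c = c], auto intro: continuous_intros)

lemma C0_real_compact_support:
  assumes "continuous_on UNIV f" "compact K" "\<And>x. x \<notin> K \<Longrightarrow> f x = 0"
  shows "f \<in> C0_real"
  using assms unfolding C0_real_def C0_def by (auto intro!: continuous_intros)

lemma C0_real_zero: "(\<lambda>_. 0) \<in> C0_real"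
  by (rule C0_real_compact_support[where K = "{}"]) auto

lemma C0_real_add: "f \<in> C0_real \<Longrightarrow> g \<in> C0_real \<Longrightarrow> (\<lambda>x. f x + g x) \<in> C0_real"
  unfolding C0_real_def using C0_add by fastforce

lemma C0_real_scale: "f \<in> C0_real \<Longrightarrow> (\<lambda>x. c * f x) \<in> C0_real"
  unfolding C0_real_def using C0_mult by fastforce

lemma C0_real_abs: "f \<in> C0_real \<Longrightarrow> (\<lambda>x. \<bar>f x\<bar>) \<in> C0_real"
  by (rule C0_real_dominated[where c = 1]) (auto intro: C0_real_cont continuous_intros)

lemma C0_real_diff: "f \<in> C0_real \<Longrightarrow> g \<in> C0_real \<Longrightarrow> (\<lambda>x. f x - g x) \<in> C0_real"
  using C0_real_add[of f "\<lambda>x. -1 * g x"] C0_real_scale[of g "-1"] by simp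

lemma C0_real_max:
  assumes "f \<in> C0_real" "g \<in> C0_real" shows "(\<lambda>x. max (f x) (g x)) \<in> C0_real"
  by (rule C0_real_dominated[OF C0_real_add[OF C0_real_abs[OF assms(1)] C0_real_abs[OF assms(2)]], where c = 1])
     (use assms in \<open>auto intro: C0_real_cont continuous_on_max\<close>)

lemma C0_real_sum: "(\<And>i. i \<in> I \<Longrightarrow> f i \<in> C0_real) \<Longrightarrow> (\<lambda>x. \<Sum>i\<in>I. f i x) \<in> C0_real"
  by (induction I rule: infinite_finite_induct) (auto intro: C0_real_zero C0_real_add)

lemma C0_real_mult_bounded:
  assumes "f \<in> C0_real" "continuous_on UNIV g" "\<And>x. \<bar>g x\<bar> \<le> c"
  shows "(\<lambda>x. g x * f x) \<in> C0_real"
  by (rule C0_real_dominated[OF assms(1), where c = c])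
     (use assms in \<open>auto intro: C0_real_cont continuous_intros simp: abs_mult mult_right_mono\<close>)

text \<open>Dini's theorem on a space that need not be compact: off a compact set already
  \<open>f 0\<close> is below the bound, and the sequence decreases.\<close>

lemma C0_real_Dini:
  fixes f :: "nat \<Rightarrow> 'x::t2_space \<Rightarrow> real"
  assumes f: "\<And>n. f n \<in> C0_real" and dec: "\<And>n x. f (Suc n) x \<le> f n x"
    and lim: "\<And>x. (\<lambda>n. f n x) \<longlonglongrightarrow> 0" and "\<epsilon> > 0"
  obtains n where "\<And>x. f n x < \<epsilon>"
proof -
  have mono: "f n x \<le> f m x" if "m \<le> n" for m n x
    using lift_Suc_antimono_le[of "\<lambda>n. f n x", OF dec that] .
  obtain K where K: "compact K" "\<And>x. x \<notin> K \<Longrightarrow> \<bar>f 0 x\<bar> < \<epsilon>"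
    using C0_real_small[OF f \<open>\<epsilon> > 0\<close>] by blast
  define U where "U n = {x. f n x < \<epsilon>}" for n
  have "open (U n)" for n
    unfolding U_def using C0_real_cont[OF f] by (intro open_Collect_less) auto
  moreover have "K \<subseteq> (\<Union>n\<in>UNIV. U n)"
  proof
    fix x
    have "\<forall>\<^sub>F n in sequentially. f n x < \<epsilon>" using lim \<open>\<epsilon> > 0\<close> by (rule order_tendstoD)
    then show "x \<in> (\<Union>n\<in>UNIV. U n)" unfolding U_def eventually_sequentially by auto
  qed
  ultimately obtain I where I: "finite I" "K \<subseteq> (\<Union>n\<in>I. U n)"
    using compactE_image[OF K(1), of UNIV U] by metis
  \<comment> \<open>Inserting 0 keeps the maximum defined when \<open>I\<close> is empty.\<close>
  have "f (Max (insert 0 I)) x < \<epsilon>" for x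
  proof (cases "x \<in> K")
    case True
    then obtain n where "n \<in> I" "f n x < \<epsilon>" using I(2) by (auto simp: U_def)
    moreover have "n \<le> Max (insert 0 I)" using \<open>n \<in> I\<close> I(1) by simp
    ultimately show ?thesis using mono[of n "Max (insert 0 I)" x] by linarith
  next
    case False
    then show ?thesis using K(2)[OF False] mono[of 0 "Max (insert 0 I)" x] by simp
  qed
  then show ?thesis by (rule that)
qed

text \<open>Urysohn's lemma with \<open>U\<close> cut down to an open set inside a compact
  \<open>K\<close>; outside it the complementary function vanishes, which gives compact
  support.\<close>

lemma C0_real_Urysohn:
  fixes U :: "'x::t2_space set"
  assumes "locally_compact_space (euclidean :: 'x topology)" "open U" "x \<in> U"
  obtains h where "h \<in> C0_real" "\<And>y. 0 \<le> h y" "\<And>y. h y \<le> 1" "h x = 1" "\<And>y. y \<notin> U \<Longrightarrow> h y = 0"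
proof -
  obtain V K where VK: "open V" "compact K" "x \<in> V" "V \<subseteq> K"
    using assms(1) unfolding locally_compact_space_def by (simp, metis)
  have "completely_regular_space (euclidean :: 'x topology)"
    using assms(1) by (intro locally_compact_regular_imp_completely_regular_space disjI1)
      (simp_all add: Hausdorff_space_def disjnt_def, metis hausdorff)
  moreover have "closed (- (U \<inter> V))" using assms(2) VK(1) by auto
  ultimately obtain f where f: "continuous_on UNIV f" "\<And>y. f y \<in> {0..1::real}" "f x = 0"
      "\<And>y. y \<in> - (U \<inter> V) \<Longrightarrow> f y = 1"
    using assms(3) VK(3) unfolding completely_regular_space_def
    by (force simp: continuous_map_in_subtopology image_subset_iff Pi_iff)
  show ?thesis
  proof (rule that[of "\<lambda>y. 1 - f y"])
    show "(\<lambda>y. 1 - f y) \<in> C0_real"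
      using f VK by (intro C0_real_compact_support[OF _ VK(2)] continuous_intros) auto
  qed (use f in auto)
qed

text \<open>By the Lindelof property countably many bump functions suffice to have a positive one at
  each point of \<open>U\<close>. Growing multiples of their partial sums, capped at 1, form the
  sequence.\<close>

lemma C0_real_approx_open:
  fixes U :: "'x::{second_countable_topology, t2_space} set"
  assumes lc: "locally_compact_space (euclidean :: 'x topology)" and "open U"
  obtains f :: "nat \<Rightarrow> 'x \<Rightarrow> real" where "\<And>n. f n \<in> C0_real" "\<And>n x. 0 \<le> f n x" "\<And>n x. f n x \<le> 1"
    "\<And>n x. f n x \<le> f (Suc n) x" "\<And>n x. x \<notin> U \<Longrightarrow> f n x = 0"
    "\<And>x. (\<lambda>n. f n x) \<longlonglongrightarrow> indicator U x"
proof -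
  define H where "H = {h \<in> C0_real. (\<forall>y. 0 \<le> h y \<and> h y \<le> (1::real)) \<and> (\<forall>y. y \<notin> U \<longrightarrow> h y = 0)}"
  define F where "F = (\<lambda>h. {y. 0 < h y}) ` H"
  have "open S" if "S \<in> F" for S
    using that C0_real_cont unfolding F_def H_def by (auto intro!: open_Collect_less)
  then obtain F' where F': "F' \<subseteq> F" "countable F'" "\<Union>F' = \<Union>F" by (rule Lindelof)
  obtain H' where H': "H' \<subseteq> H" "countable H'" "F' = (\<lambda>h. {y. 0 < h y}) ` H'"
    using F'(1,2) unfolding F_def by (metis countable_image_eq_inj countable_subset_image)
  have zero: "(\<lambda>_. 0) \<in> H" by (auto simp: H_def C0_real_zero)
  \<comment> \<open>The zero function keeps the enumerated set nonempty.\<close>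
  define h where "h = from_nat_into (insert (\<lambda>_. 0) H')"
  have range_h: "range h = insert (\<lambda>_. 0) H'"
    unfolding h_def by (rule range_from_nat_into) (use H'(2) in auto)
  have h: "h i \<in> H" for i
  proof -
    have "h i \<in> insert (\<lambda>_. 0) H'" unfolding range_h[symmetric] by (rule rangeI)
    then show ?thesis using zero H'(1) by (elim insertE) auto
  qed
  \<comment> \<open>The factor \<open>n\<close> drives the sum beyond 1 wherever some
    \<open>h i\<close> is positive, so capping at 1 yields the indicator in the limit.\<close>
  define s where "s n x = real n * (\<Sum>i<n. h i x)" for n x
  have s_C0: "s n \<in> C0_real" for n
    unfolding s_def using h by (intro C0_real_scale C0_real_sum) (auto simp: H_def)
  have s_nonneg: "0 \<le> s n x" for n x
    unfolding s_def using h by (intro mult_nonneg_nonneg sum_nonneg) (auto simp: H_def)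
  have s_mono: "s n x \<le> s (Suc n) x" for n x
    unfolding s_def using h by (intro mult_mono sum_mono2 sum_nonneg) (auto simp: H_def)
  have s_zero: "s n x = 0" if "x \<notin> U" for n x
    unfolding s_def using h that by (simp add: H_def)
  have s_lim: "\<forall>\<^sub>F n in sequentially. min 1 (s n x) = 1" if xU: "x \<in> U" for x
  proof -
    obtain k where "k \<in> C0_real" "\<And>y. 0 \<le> k y" "\<And>y. k y \<le> 1" "k x = 1" "\<And>y. y \<notin> U \<Longrightarrow> k y = 0"
      using C0_real_Urysohn[OF lc \<open>open U\<close> xU] by blast
    then have "k \<in> H" "0 < k x" by (auto simp: H_def)
    then have "x \<in> \<Union>F" unfolding F_def by blast
    then obtain h' where "h' \<in> H'" "0 < h' x" using F'(3) H'(3) by auto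
    then obtain i where i: "0 < h i x" using range_h by (metis UnCI insert_is_Un rangeE)
    obtain m where m: "real m * h i x > 1" using reals_Archimedean3[OF i] by blast
    have "1 \<le> s n x" if "n \<ge> max m (Suc i)" for n
    proof -
      have "1 \<le> real m * h i x" using m by simp
      also have "\<dots> \<le> real n * (\<Sum>j\<in>{i}. h j x)" using i that by (auto intro: mult_right_mono)
      also have "\<dots> \<le> s n x"
        unfolding s_def using h that by (intro mult_left_mono sum_mono2) (auto simp: H_def)
      finally show ?thesis .
    qed
    then show ?thesis unfolding eventually_sequentially by (metis min.absorb1)
  qed
  show ?thesis
  proof (rule that[of "\<lambda>n x. min 1 (s n x)"])
    show "(\<lambda>x. min 1 (s n x)) \<in> C0_real" for n
      by (rule C0_real_dominated[OF s_C0[of n], where c = 1])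
         (use s_nonneg C0_real_cont[OF s_C0] in \<open>auto intro!: continuous_on_min continuous_intros\<close>)
    show "(\<lambda>n. min 1 (s n x)) \<longlonglongrightarrow> indicator U x" for x
    proof (cases "x \<in> U")
      case True
      then show ?thesis using tendsto_eventually[OF s_lim[OF True]] by simp
    next
      case False
      then show ?thesis by (simp add: s_zero)
    qed
  qed (use s_nonneg s_mono s_zero in \<open>auto intro: min.coboundedI2\<close>)
qed

section \<open>The Riesz representation theorem for bounded functionals\<close>

text \<open>The laws are required on \<open>C0_real\<close> only, since \<open>L\<close> is a total
  function. The constant \<open>B\<close> becomes a bound for the total mass.\<close>

locale bounded_positive_functional =
  fixes L :: "('x::{second_countable_topology, t2_space} \<Rightarrow> real) \<Rightarrow> real" and B :: real
  assumes lc: "locally_compact_space (euclidean :: 'x topology)"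
    and L_add: "\<And>f g. f \<in> C0_real \<Longrightarrow> g \<in> C0_real \<Longrightarrow> L (\<lambda>x. f x + g x) = L f + L g"
    and L_scale: "\<And>c f. f \<in> C0_real \<Longrightarrow> L (\<lambda>x. c * f x) = c * L f"
    and L_nonneg: "\<And>f. f \<in> C0_real \<Longrightarrow> (\<And>x. 0 \<le> f x) \<Longrightarrow> 0 \<le> L f"
    and L_bound: "\<And>f. f \<in> C0_real \<Longrightarrow> (\<And>x. 0 \<le> f x) \<Longrightarrow> (\<And>x. f x \<le> 1) \<Longrightarrow> L f \<le> B"
begin

lemma L_zero: "L (\<lambda>_. 0) = 0"
  using L_scale[OF C0_real_zero, of 0] by simp

lemma L_diff: "f \<in> C0_real \<Longrightarrow> g \<in> C0_real \<Longrightarrow> L (\<lambda>x. f x - g x) = L f - L g"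
  using L_add[of f "\<lambda>x. -1 * g x"] L_scale[of g "-1"] C0_real_scale[of g "-1"] by simp

lemma L_mono: "f \<in> C0_real \<Longrightarrow> g \<in> C0_real \<Longrightarrow> (\<And>x. f x \<le> g x) \<Longrightarrow> L f \<le> L g"
  using L_nonneg[of "\<lambda>x. g x - f x"] L_diff[of g f] C0_real_diff[of g f] by simp

lemma L_sum: "finite I \<Longrightarrow> (\<And>i. i \<in> I \<Longrightarrow> f i \<in> C0_real) \<Longrightarrow> L (\<lambda>x. \<Sum>i\<in>I. f i x) = (\<Sum>i\<in>I. L (f i))"
  by (induction I rule: finite_induct) (auto simp: L_zero L_add C0_real_sum)

lemma B_nonneg: "0 \<le> B"
  using L_bound[OF C0_real_zero] by (simp add: L_zero)

lemma L_le_scaled_B: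
  assumes "f \<in> C0_real" "\<And>x. 0 \<le> f x" "\<And>x. f x \<le> c" "0 < c"
  shows "L f \<le> c * B"
proof -
  have "L (\<lambda>x. inverse c * f x) \<le> B"
    using assms(2,3,4) by (intro L_bound C0_real_scale assms(1)) (simp_all add: field_simps)
  moreover have "L (\<lambda>x. inverse c * f x) = inverse c * L f" by (rule L_scale[OF assms(1)])
  ultimately have "inverse c * L f \<le> B" by simp
  then have "L f / c \<le> B" by (simp add: divide_inverse mult.commute)
  then show ?thesis using pos_divide_le_eq[OF \<open>0 < c\<close>] by (simp add: mult.commute)
qed

section \<open>The content of open sets and its outer measure\<close>

definition below :: "'x set \<Rightarrow> ('x \<Rightarrow> real) set"
  where "below U = {f \<in> C0_real. (\<forall>x. 0 \<le> f x) \<and> (\<forall>x. f x \<le> indicator U x)}"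

text \<open>The value of the future measure on open sets. Functions in \<open>below U\<close> only
  have to vanish off \<open>U\<close>, so the approximants of \<open>C0_real_approx_open\<close> are
  among them.\<close>

definition vol :: "'x set \<Rightarrow> real"
  where "vol U = (SUP f\<in>below U. L f)"

lemma zero_below: "(\<lambda>_. 0) \<in> below U"
  by (simp add: below_def C0_real_zero)

lemma belowD:
  assumes "f \<in> below U"
  shows "f \<in> C0_real" "0 \<le> f x" "f x \<le> 1" "x \<notin> U \<Longrightarrow> f x = 0" "f x \<le> indicator U x"
proof -
  have *: "0 \<le> f x" "f x \<le> indicator U x" for x using assms by (auto simp: below_def)
  show "f \<in> C0_real" using assms by (simp add: below_def)
  show "0 \<le> f x" "f x \<le> indicator U x" by (fact *)+
  show "f x \<le> 1" using *(2)[of x] by (cases "x \<in> U") auto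
  show "f x = 0" if "x \<notin> U" using *[of x] that by simp
qed

lemma belowI:
  "f \<in> C0_real \<Longrightarrow> (\<And>x. 0 \<le> f x) \<Longrightarrow> (\<And>x. f x \<le> 1) \<Longrightarrow> (\<And>x. x \<notin> U \<Longrightarrow> f x = 0) \<Longrightarrow> f \<in> below U"
  by (auto simp: below_def indicator_def)

lemma L_le_vol: "f \<in> below U \<Longrightarrow> L f \<le> vol U"
  unfolding vol_def by (rule cSUP_upper) (auto intro!: bdd_aboveI2[of _ _ B] L_bound belowD)

lemma vol_least: "(\<And>f. f \<in> below U \<Longrightarrow> L f \<le> c) \<Longrightarrow> vol U \<le> c"
  unfolding vol_def by (rule cSUP_least) (use zero_below in auto)

lemma vol_nonneg: "0 \<le> vol U"
  using L_le_vol[OF zero_below] by (simp add: L_zero)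

lemma vol_empty: "vol {} = 0"
proof -
  have "vol {} \<le> 0"
  proof (rule vol_least)
    fix f assume "f \<in> below {}"
    then have "f = (\<lambda>_. 0)" using belowD(4)[of f "{}"] by auto
    then show "L f \<le> 0" by (simp add: L_zero)
  qed
  with vol_nonneg[of "{}"] show ?thesis by simp
qed

lemma vol_mono: "U \<subseteq> V \<Longrightarrow> vol U \<le> vol V"
  by (rule vol_least, rule L_le_vol, rule belowI) (auto intro: belowD)

text \<open>The excess of \<open>g\<close> over \<open>f n\<close> decreases to 0 pointwise, hence
  uniformly by Dini's theorem, and \<open>L\<close> is small on uniformly small functions.\<close>

lemma L_approx:
  assumes f: "\<And>n. f n \<in> C0_real" "\<And>n x. f n x \<le> f (Suc n) x" "\<And>x. (\<lambda>n. f n x) \<longlonglongrightarrow> F x"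
    and g: "g \<in> C0_real" "\<And>x. 0 \<le> g x" "\<And>x. g x \<le> F x" and "\<And>n x. 0 \<le> f n x" and "\<epsilon> > 0"
  obtains n where "L g \<le> L (f n) + \<epsilon>"
proof -
  define d where "d n x = max 0 (g x - f n x)" for n x
  have d: "d n \<in> C0_real" for n
    unfolding d_def by (intro C0_real_max C0_real_zero C0_real_diff f g)
  \<comment> \<open>Adding 1 covers \<open>B = 0\<close> and still gives
    \<open>\<delta> * B \<le> \<epsilon>\<close>.\<close>
  define \<delta> where "\<delta> = \<epsilon> / (B + 1)"
  have "\<delta> > 0" unfolding \<delta>_def using B_nonneg \<open>\<epsilon> > 0\<close> by simp
  moreover have "(\<lambda>n. d n x) \<longlonglongrightarrow> 0" for x
  proof -
    have "(\<lambda>n. d n x) \<longlonglongrightarrow> max 0 (g x - F x)"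
      unfolding d_def by (intro tendsto_intros f)
    then show ?thesis using g(3)[of x] by simp
  qed
  moreover have "d (Suc n) x \<le> d n x" for n x
    using f(2)[of n x] by (auto simp: d_def)
  ultimately obtain n where n: "\<And>x. d n x < \<delta>"
    using C0_real_Dini[of d \<delta>] d by blast
  have "L g \<le> L (\<lambda>x. f n x + d n x)"
    by (rule L_mono[OF g(1) C0_real_add[OF f(1) d]]) (simp add: d_def)
  also have "\<dots> = L (f n) + L (d n)" by (rule L_add) (use f d in auto)
  also have "L (d n) \<le> \<delta> * B"
    by (rule L_le_scaled_B) (use d n \<open>\<delta> > 0\<close> in \<open>auto simp: d_def less_imp_le\<close>)
  also have "\<delta> * B \<le> \<epsilon>" using B_nonneg \<open>\<epsilon> > 0\<close> by (simp add: \<delta>_def field_simps)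
  finally show ?thesis using that by simp
qed

text \<open>A function below the union is dominated by the limit of diagonal sums, made of the
  \<open>n\<close>-th approximants of the first \<open>n\<close> sets; \<open>L\<close> of such a
  sum is at most the sum of the volumes.\<close>

lemma vol_countably_subadditive:
  assumes "\<And>i::nat. open (U i)" "summable (\<lambda>i. vol (U i))"
  shows "vol (\<Union>i. U i) \<le> (\<Sum>i. vol (U i))"
proof (rule vol_least, rule field_le_epsilon)
  fix g and e :: real assume g: "g \<in> below (\<Union>i. U i)" and "e > 0"
  have "\<forall>i. \<exists>f :: nat \<Rightarrow> 'x \<Rightarrow> real. (\<forall>n. f n \<in> below (U i)) \<and> (\<forall>n x. f n x \<le> f (Suc n) x) \<and>
      (\<forall>x. (\<lambda>n. f n x) \<longlonglongrightarrow> indicator (U i) x)"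
  proof
    fix i
    obtain f :: "nat \<Rightarrow> 'x \<Rightarrow> real" where "\<And>n. f n \<in> C0_real" "\<And>n x. 0 \<le> f n x" "\<And>n x. f n x \<le> 1"
      "\<And>n x. f n x \<le> f (Suc n) x" "\<And>n x. x \<notin> U i \<Longrightarrow> f n x = 0"
      "\<And>x. (\<lambda>n. f n x) \<longlonglongrightarrow> indicator (U i) x"
      using C0_real_approx_open[OF lc assms(1)] by metis
    then show "\<exists>f :: nat \<Rightarrow> 'x \<Rightarrow> real. (\<forall>n. f n \<in> below (U i)) \<and> (\<forall>n x. f n x \<le> f (Suc n) x) \<and>
      (\<forall>x. (\<lambda>n. f n x) \<longlonglongrightarrow> indicator (U i) x)" by (intro exI[of _ f]) (auto intro: belowI)
  qed
  then obtain f :: "nat \<Rightarrow> nat \<Rightarrow> 'x \<Rightarrow> real" where f: "\<And>i n. f i n \<in> below (U i)"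
    "\<And>i n x. f i n x \<le> f i (Suc n) x" "\<And>i x. (\<lambda>n. f i n x) \<longlonglongrightarrow> indicator (U i) x"
    by metis
  define s where "s n x = (\<Sum>i<n. f i n x)" for n x
  \<comment> \<open>The cap makes the increasing sequence converge, and its limit is still at least
    1 on the union.\<close>
  define m where "m n x = min 1 (s n x)" for n x
  note fD = belowD[OF f(1)]
  have s: "s n \<in> C0_real" for n unfolding s_def by (intro C0_real_sum fD)
  have s_nonneg: "0 \<le> s n x" for n x unfolding s_def by (intro sum_nonneg fD)
  have m: "m n \<in> C0_real" for n
    by (rule C0_real_dominated[OF s[of n], where c = 1])
       (use s_nonneg C0_real_cont[OF s] in \<open>auto simp: m_def intro!: continuous_on_min continuous_intros\<close>)
  have "s n x \<le> s (Suc n) x" for n x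
  proof -
    have "s n x \<le> (\<Sum>i<n. f i (Suc n) x)" unfolding s_def by (intro sum_mono f)
    also have "\<dots> \<le> s (Suc n) x" unfolding s_def by (simp add: fD)
    finally show ?thesis .
  qed
  then have m_mono: "m n x \<le> m (Suc n) x" for n x by (auto simp: m_def intro: min.coboundedI2)
  have m_bound: "0 \<le> m n x" "m n x \<le> 1" for n x using s_nonneg by (auto simp: m_def)
  have "\<exists>l. (\<lambda>n. m n x) \<longlonglongrightarrow> l \<and> (\<forall>n. m n x \<le> l)" for x
  proof -
    have "incseq (\<lambda>n. m n x)" using m_mono by (intro incseq_SucI)
    from incseq_convergent[OF this, of 1] m_bound show ?thesis by metis
  qed
  then obtain F where F: "\<And>x. (\<lambda>n. m n x) \<longlonglongrightarrow> F x" "\<And>n x. m n x \<le> F x" by metis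
  have "g x \<le> F x" for x
  proof (cases "x \<in> (\<Union>i. U i)")
    case True
    then obtain i where "x \<in> U i" by blast
    have "(\<lambda>n. min 1 (f i n x)) \<longlonglongrightarrow> min 1 (indicator (U i) x)" by (intro tendsto_intros f)
    moreover have "\<forall>\<^sub>F n in sequentially. min 1 (f i n x) \<le> F x"
      unfolding eventually_sequentially
    proof (intro exI allI impI)
      fix n assume "Suc i \<le> n"
      then have "(\<Sum>j\<in>{i}. f j n x) \<le> s n x" unfolding s_def by (intro sum_mono2 fD) auto
      then have "min 1 (f i n x) \<le> m n x" by (auto simp: m_def)
      also have "\<dots> \<le> F x" by (rule F)
      finally show "min 1 (f i n x) \<le> F x" .
    qed
    ultimately have "min 1 (indicator (U i) x) \<le> F x"
      by (intro tendsto_upperbound) auto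
    with \<open>x \<in> U i\<close> belowD(3)[OF g, of x] show ?thesis by simp
  next
    case False
    then have "g x = 0" using belowD(4)[OF g] by simp
    then show ?thesis using F(2)[of 0 x] m_bound(1)[of 0 x] by simp
  qed
  then obtain n where n: "L g \<le> L (m n) + e"
    using L_approx[of m F g e] m m_mono F g belowD[OF g] m_bound \<open>e > 0\<close> by metis
  have "L (m n) \<le> L (s n)" by (rule L_mono) (use m s in \<open>auto simp: m_def\<close>)
  also have "\<dots> = (\<Sum>i<n. L (f i n))" unfolding s_def by (rule L_sum) (use fD in auto)
  also have "\<dots> \<le> (\<Sum>i<n. vol (U i))" by (intro sum_mono L_le_vol f)
  also have "\<dots> \<le> (\<Sum>i. vol (U i))"
    using assms(2) vol_nonneg by (intro sum_le_suminf) auto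
  finally show "L g \<le> (\<Sum>i. vol (U i)) + e" using n by simp
qed

definition outer :: "'x set \<Rightarrow> ennreal"
  where "outer A = (INF U\<in>{U. open U \<and> A \<subseteq> U}. ennreal (vol U))"

lemma outer_open: "open U \<Longrightarrow> outer U = ennreal (vol U)"
  unfolding outer_def
  by (intro antisym INF_lower INF_greatest) (auto intro!: ennreal_leI vol_mono)

lemma outer_mono: "A \<subseteq> A' \<Longrightarrow> outer A \<le> outer A'"
  unfolding outer_def by (intro INF_superset_mono) auto

lemma outer_finite: "outer A \<le> ennreal B"
proof -
  have "outer A \<le> ennreal (vol UNIV)" unfolding outer_def by (rule INF_lower) auto
  also have "vol UNIV \<le> B" by (rule vol_least) (auto intro: L_bound belowD)
  finally show ?thesis by (simp add: ennreal_leI)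
qed

lemma outer_approx:
  assumes "e > 0"
  obtains U where "open U" "A \<subseteq> U" "ennreal (vol U) \<le> outer A + ennreal e"
proof -
  obtain r where r: "0 \<le> r" "outer A = ennreal r"
    using outer_finite[of A] by (cases "outer A") (auto simp: top_unique)
  then have "outer A < outer A + ennreal e"
    using assms by (simp add: ennreal_plus[symmetric] ennreal_lessI del: ennreal_plus)
  then obtain U where "open U" "A \<subseteq> U" "ennreal (vol U) < outer A + ennreal e"
    unfolding outer_def[of A] INF_less_iff by auto
  then show ?thesis using that by (simp add: less_imp_le)
qed

lemma outer_countably_subadditive:
  "outer (\<Union>i. A i) \<le> (\<Sum>i. outer (A (i::nat)))"
proof (cases "(\<Sum>i. outer (A i)) = \<infinity>")
  case False
  show ?thesis
  proof (rule ennreal_le_epsilon)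
    fix e :: real assume "e > 0"
    define d where "d i = e * (1/2)^Suc i" for i
    have d: "d i > 0" for i using \<open>e > 0\<close> by (simp add: d_def)
    have "\<forall>i. \<exists>U. open U \<and> A i \<subseteq> U \<and> ennreal (vol U) \<le> outer (A i) + ennreal (d i)"
      using outer_approx[OF d] by metis
    then obtain U where U: "\<And>i. open (U i)" "\<And>i. A i \<subseteq> U i"
      "\<And>i. ennreal (vol (U i)) \<le> outer (A i) + ennreal (d i)" by metis
    have d_sum: "(\<Sum>i. ennreal (d i)) = ennreal e"
    proof -
      have "d sums (e * 1)" unfolding d_def by (intro sums_mult power_half_series)
      then have "d sums e" by simp
      then show ?thesis by (rule suminf_ennreal_eq[rotated]) (use d in \<open>simp add: less_imp_le\<close>)
    qed
    have le: "(\<Sum>i. ennreal (vol (U i))) \<le> (\<Sum>i. outer (A i)) + ennreal e"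
      unfolding d_sum[symmetric] by (subst suminf_add) (auto intro!: suminf_le U)
    then have "(\<Sum>i. ennreal (vol (U i))) \<noteq> \<infinity>" using False by (auto simp: top_unique)
    then have sm: "summable (\<lambda>i. vol (U i))"
      by (intro summable_suminf_not_top vol_nonneg) auto
    have "outer (\<Union>i. A i) \<le> outer (\<Union>i. U i)" by (rule outer_mono) (use U in blast)
    also have "\<dots> = ennreal (vol (\<Union>i. U i))" by (rule outer_open) (use U in auto)
    also have "\<dots> \<le> ennreal (\<Sum>i. vol (U i))"
      by (rule ennreal_leI, rule vol_countably_subadditive[OF U(1) sm])
    also have "\<dots> = (\<Sum>i. ennreal (vol (U i)))" using suminf_ennreal2[OF vol_nonneg sm] by simp
    also note le
    finally show "outer (\<Union>i. A i) \<le> (\<Sum>i. outer (A i)) + ennreal e" .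
  qed
qed simp

lemma outer_subadditive: "outer (A \<union> A') \<le> outer A + outer A'"
proof -
  define D where "D i = (if i = 0 then A else if i = 1 then A' else {})" for i :: nat
  have "outer (\<Union>i. D i) \<le> (\<Sum>i. outer (D i))"
    by (rule outer_countably_subadditive)
  also have "(\<Union>i. D i) = A \<union> A'"
    by (auto simp: D_def split: if_splits)
  also have "(\<Sum>i. outer (D i)) = (\<Sum>i\<in>{0, 1}. outer (D i))"
    by (rule suminf_finite) (auto simp: D_def outer_open vol_empty)
  also have "\<dots> = outer A + outer A'" by (simp add: D_def)
  finally show ?thesis .
qed

text \<open>The set where an approximant of \<open>indicator (V \<inter> U)\<close> is small takes the role of the
  complement of its support: adding functions below both exceeds 1 by at most \<open>\<delta>\<close>.\<close>

lemma outer_split_open: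
  assumes "open V" "open U"
  shows "outer (V \<inter> U) + outer (V - U) \<le> outer V"
proof -
  have "vol (V \<inter> U) + enn2real (outer (V - U)) \<le> vol V"
  proof (rule field_le_epsilon)
    fix e :: real assume "e > 0"
    \<comment> \<open>Chosen so that the excess \<open>\<delta> * vol V\<close> is at most
      \<open>e\<close>, also when the volume is 0.\<close>
    define \<delta> where "\<delta> = e / (vol V + 1)"
    have \<delta>: "\<delta> > 0" "\<delta> * vol V \<le> e"
      using \<open>e > 0\<close> vol_nonneg[of V] by (auto simp: \<delta>_def field_simps)
    have "vol (V \<inter> U) \<le> (1 + \<delta>) * vol V - enn2real (outer (V - U))"
    proof (rule vol_least)
      fix f assume f: "f \<in> below (V \<inter> U)"
      define W where "W = V \<inter> {x. f x < \<delta>}"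
      have "open {x. f x < \<delta>}"
        using C0_real_cont[OF belowD(1)[OF f]] by (intro open_Collect_less) auto
      then have "open W" unfolding W_def using \<open>open V\<close> by auto
      have "V - U \<subseteq> W" using belowD(4)[OF f] \<delta>(1) by (auto simp: W_def)
      have "vol W \<le> (1 + \<delta>) * vol V - L f"
      proof (rule vol_least)
        fix g assume g: "g \<in> below W"
        \<comment> \<open>Normalised to lie below \<open>V\<close>: on \<open>W\<close> the sum is
          at most \<open>1 + \<delta>\<close>, and off \<open>W\<close> only \<open>f\<close>
          remains.\<close>
        define k where "k x = inverse (1 + \<delta>) * (g x + f x)" for x
        have gf: "(\<lambda>x. g x + f x) \<in> C0_real" by (intro C0_real_add belowD[OF f] belowD[OF g])
        have "k \<in> below V"
        proof (rule belowI)
          show "k \<in> C0_real" unfolding k_def by (intro C0_real_scale gf)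
          show "0 \<le> k x" for x using belowD(2)[OF f, of x] belowD(2)[OF g, of x] \<delta>(1) by (simp add: k_def)
          have "g x + f x \<le> 1 + \<delta>" for x
            using belowD(3)[OF f, of x] belowD(3,4)[OF g, of x] \<delta>(1) belowD(4)[OF f, of x]
            by (cases "x \<in> W") (auto simp: W_def)
          then show "k x \<le> 1" for x using \<delta>(1) by (simp add: k_def field_simps)
          show "k x = 0" if "x \<notin> V" for x
            using belowD(4)[OF f, of x] belowD(4)[OF g, of x] that by (simp add: k_def W_def)
        qed
        then have "L k \<le> vol V" by (rule L_le_vol)
        moreover have "L k = inverse (1 + \<delta>) * (L g + L f)"
          unfolding k_def by (subst L_scale[OF gf], subst L_add) (auto intro: belowD[OF f] belowD[OF g])
        ultimately show "L g \<le> (1 + \<delta>) * vol V - L f" using \<delta>(1) by (simp add: field_simps)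
      qed
      moreover have "outer (V - U) \<le> ennreal (vol W)"
        unfolding outer_def by (rule INF_lower) (use \<open>open W\<close> \<open>V - U \<subseteq> W\<close> in auto)
      then have "enn2real (outer (V - U)) \<le> vol W"
        by (intro enn2real_leI vol_nonneg)
      ultimately show "L f \<le> (1 + \<delta>) * vol V - enn2real (outer (V - U))" by simp
    qed
    then show "vol (V \<inter> U) + enn2real (outer (V - U)) \<le> vol V + e"
      using \<delta>(2) by (simp add: algebra_simps)
  qed
  then have "ennreal (vol (V \<inter> U)) + ennreal (enn2real (outer (V - U))) \<le> ennreal (vol V)"
    using ennreal_leI[of "vol (V \<inter> U) + enn2real (outer (V - U))" "vol V"]
    by (simp add: ennreal_plus vol_nonneg)
  moreover have "ennreal (enn2real (outer (V - U))) = outer (V - U)"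
    using outer_finite[of "V - U"] by (intro ennreal_enn2real) (auto simp: less_top[symmetric] top_unique)
  ultimately show ?thesis using outer_open[OF assms(1)] outer_open[OF open_Int[OF assms]] by simp
qed

lemma outer_split:
  assumes "open U" shows "outer (T \<inter> U) + outer (T - U) \<le> outer T"
  unfolding outer_def[of T]
proof (rule INF_greatest)
  fix V assume "V \<in> {V. open V \<and> T \<subseteq> V}"
  then have V: "open V" "T \<subseteq> V" by auto
  have "outer (T \<inter> U) + outer (T - U) \<le> outer (V \<inter> U) + outer (V - U)"
    by (intro add_mono outer_mono) (use V in auto)
  also have "\<dots> \<le> ennreal (vol V)" using outer_split_open[OF V(1) assms] outer_open[OF V(1)] by simp
  finally show "outer (T \<inter> U) + outer (T - U) \<le> ennreal (vol V)" .
qed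

definition riesz_measure :: "'x measure"
  where "riesz_measure = measure_of UNIV (sets borel) outer"

lemma sets_riesz_measure: "sets riesz_measure = sets borel"
  and space_riesz_measure: "space riesz_measure = UNIV"
  unfolding riesz_measure_def using sets.sigma_sets_eq[of "borel :: 'x measure"] by auto

text \<open>By \<open>outer_split\<close> open sets are measurable in the sense of Caratheodory. The
  measurable sets form a sigma-algebra on which \<open>outer\<close> is a measure, so all Borel sets
  are covered.\<close>

lemma emeasure_riesz_measure:
  assumes "A \<in> sets borel" shows "emeasure riesz_measure A = outer A"
proof -
  interpret P: sigma_algebra UNIV "Pow (UNIV :: 'x set)" by (rule sigma_algebra_Pow)
  have "outer_measure_space (Pow UNIV) outer"
    unfolding outer_measure_space_def
    using outer_countably_subadditive
    by (auto simp: positive_def increasing_def countably_subadditive_def outer_open vol_empty outer_mono)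
  from P.caratheodory_lemma[OF this]
  have ms: "measure_space UNIV (lambda_system UNIV (Pow UNIV) outer) outer" .
  then interpret LS: sigma_algebra UNIV "lambda_system UNIV (Pow UNIV) outer"
    by (simp add: measure_space_def)
  have "U \<in> lambda_system UNIV (Pow UNIV) outer" if "open U" for U
    unfolding lambda_system_def
  proof (clarsimp, intro antisym)
    fix T
    show "outer (U \<inter> T) + outer ((UNIV - U) \<inter> T) \<le> outer T"
      using outer_split[OF that, of T] by (simp add: Int_commute Diff_eq)
    have "T = (U \<inter> T) \<union> ((UNIV - U) \<inter> T)" by auto
    then show "outer T \<le> outer (U \<inter> T) + outer ((UNIV - U) \<inter> T)" using outer_subadditive by metis
  qed
  then have "sigma_sets UNIV {U. open U} \<subseteq> lambda_system UNIV (Pow UNIV) outer"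
    by (intro LS.sigma_sets_subset) auto
  then have sub: "sets borel \<subseteq> lambda_system UNIV (Pow UNIV) outer"
    by (simp add: borel_def)
  show ?thesis
    unfolding riesz_measure_def
  proof (rule emeasure_measure_of_sigma)
    show "sigma_algebra UNIV (sets borel :: 'x set set)"
      using sets.sigma_algebra_axioms[of "borel :: 'x measure"] by simp
    show "positive (sets borel) outer" by (simp add: positive_def outer_open vol_empty)
    show "countably_additive (sets borel) outer"
      using ms sub unfolding measure_space_def countably_additive_def by (meson subset_trans subsetD)
  qed fact
qed

lemma emeasure_riesz_measure_open: "open U \<Longrightarrow> emeasure riesz_measure U = ennreal (vol U)"
  by (simp add: emeasure_riesz_measure outer_open)

lemma finite_riesz_measure: "finite_measure riesz_measure"
proof
  show "emeasure riesz_measure (space riesz_measure) \<noteq> \<infinity>"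
    by (simp add: space_riesz_measure emeasure_riesz_measure_open)
qed

lemma measure_riesz_measure_open: "open U \<Longrightarrow> measure riesz_measure U = vol U"
  by (simp add: measure_def emeasure_riesz_measure_open vol_nonneg)

end

text \<open>For cutting a function into horizontal slices: summand \<open>k\<close> is the part of
  \<open>t\<close> between the heights \<open>k\<close> and \<open>k + 1\<close>.\<close>

lemma sum_clamp: "(\<Sum>k<n. max 0 (min 1 (t - real k))) = max 0 (min (real n) t)"
  by (induction n) (auto simp: min_def max_def)

lemma C0_real_integrable:
  assumes "finite_measure M" "sets M = sets borel" "f \<in> C0_real"
  shows "integrable M f"
proof -
  interpret finite_measure M by fact
  obtain C where "\<And>x. \<bar>f x\<bar> \<le> C" using C0_real_bounded[OF assms(3)] by blast
  moreover have "f \<in> borel_measurable M"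
    using borel_measurable_continuous_onI[OF C0_real_cont[OF assms(3)]]
    by (simp add: measurable_cong_sets[OF assms(2) refl])
  ultimately show ?thesis by (intro integrable_const_bound[where B = C]) auto
qed

context bounded_positive_functional
begin

text \<open>Slicing \<open>f\<close> horizontally at height \<open>1 / n\<close>; both the integral and \<open>L\<close> of a slice lie
  between the volumes of consecutive superlevel sets.\<close>

lemma integral_riesz_measure_unit:
  assumes f: "f \<in> C0_real" "\<And>x. 0 \<le> f x" "\<And>x. f x \<le> 1"
  shows "integral\<^sup>L riesz_measure f = L f"
proof -
  interpret R: finite_measure riesz_measure by (rule finite_riesz_measure)
  have *: "\<bar>integral\<^sup>L riesz_measure f - L f\<bar> \<le> B / real n" if n: "n > 0" for n :: nat
  proof -
    define s where "s k x = max 0 (min 1 (real n * f x - real k))" for k x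
    define U where "U k = {x. real k < real n * f x}" for k
    have U_open: "open (U k)" for k
      unfolding U_def by (intro open_Collect_less continuous_intros C0_real_cont f)
    have s: "s k \<in> C0_real" for k
    proof (rule C0_real_dominated[OF f(1), where c = n])
      show "continuous_on UNIV (s k)"
        unfolding s_def
        by (intro continuous_on_max continuous_on_min continuous_intros C0_real_cont f)
      show "\<bar>s k x\<bar> \<le> real n * \<bar>f x\<bar>" for x
        using f(2)[of x] by (auto simp: s_def abs_if)
    qed
    have s_below: "s k \<in> below (U k)" for k
      by (rule belowI[OF s]) (auto simp: s_def U_def)
    have U_le_s: "indicator (U (Suc k)) x \<le> s k x" for k x
      by (auto simp: U_def s_def indicator_def)
    have f_eq: "real n * f x = (\<Sum>k<n. s k x)" for x
      using f(2,3)[of x] n by (simp add: s_def sum_clamp)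
    have L_eq: "real n * L f = (\<Sum>k<n. L (s k))"
      using L_scale[OF f(1), of "real n"] L_sum[of "{..<n}" s] s by (simp add: f_eq)
    note int = C0_real_integrable[OF finite_riesz_measure sets_riesz_measure]
    have I_eq: "real n * integral\<^sup>L riesz_measure f = (\<Sum>k<n. integral\<^sup>L riesz_measure (s k))"
      using integral_mult_right_zero[of riesz_measure "real n" f] Bochner_Integration.integral_sum[of "{..<n}" riesz_measure s] int[OF s]
      by (simp add: f_eq)
    have bounds: "vol (U (Suc k)) \<le> L (s k)" "L (s k) \<le> vol (U k)" for k
    proof -
      show "L (s k) \<le> vol (U k)" by (rule L_le_vol[OF s_below])
      show "vol (U (Suc k)) \<le> L (s k)"
      proof (rule vol_least)
        fix g assume g: "g \<in> below (U (Suc k))"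
        show "L g \<le> L (s k)"
          by (rule L_mono[OF belowD(1)[OF g] s]) (rule order_trans[OF belowD(5)[OF g] U_le_s])
      qed
    qed
    have ind: "integral\<^sup>L riesz_measure (indicator (U k)) = vol (U k)" 
      and ind_int: "integrable riesz_measure (indicator (U k) :: 'x \<Rightarrow> real)" for k
      using measure_riesz_measure_open[OF U_open, of k] U_open[of k] R.emeasure_finite[of "U k"]
      by (auto simp: space_riesz_measure sets_riesz_measure less_top[symmetric])
    have bounds': "vol (U (Suc k)) \<le> integral\<^sup>L riesz_measure (s k)"
      "integral\<^sup>L riesz_measure (s k) \<le> vol (U k)" for k
      unfolding ind[symmetric]
      by (rule integral_mono; use ind_int int[OF s] U_le_s belowD(5)[OF s_below] in simp)+
    have "\<bar>real n * integral\<^sup>L riesz_measure f - real n * L f\<bar> =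
        \<bar>\<Sum>k<n. integral\<^sup>L riesz_measure (s k) - L (s k)\<bar>"
      by (simp add: L_eq I_eq sum_subtractf)
    also have "\<dots> \<le> (\<Sum>k<n. \<bar>integral\<^sup>L riesz_measure (s k) - L (s k)\<bar>)" by (rule sum_abs)
    \<comment> \<open>Both values lie between the same two volumes; the differences of these
      telescope to at most \<open>B\<close>.\<close>
    also have "\<dots> \<le> (\<Sum>k<n. vol (U k) - vol (U (Suc k)))"
    proof (rule sum_mono)
      fix k show "\<bar>integral\<^sup>L riesz_measure (s k) - L (s k)\<bar> \<le> vol (U k) - vol (U (Suc k))"
        using bounds[of k] bounds'[of k] by linarith
    qed
    also have "\<dots> = vol (U 0) - vol (U n)" by (rule sum_lessThan_telescope')
    also have "\<dots> \<le> vol (U 0)" using vol_nonneg by simp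
    also have "\<dots> \<le> B" by (rule vol_least) (auto intro: L_bound belowD)
    finally have "real n * \<bar>integral\<^sup>L riesz_measure f - L f\<bar> \<le> B"
      by (simp add: right_diff_distrib[symmetric] abs_mult)
    then show ?thesis using n by (simp add: field_simps)
  qed
  have "\<bar>integral\<^sup>L riesz_measure f - L f\<bar> \<le> 0"
  proof (rule tendsto_lowerbound)
    show "(\<lambda>n. B / real n) \<longlonglongrightarrow> 0" by (rule lim_const_over_n)
    show "\<forall>\<^sub>F n in sequentially. \<bar>integral\<^sup>L riesz_measure f - L f\<bar> \<le> B / real n"
      using * by (intro eventually_sequentiallyI[of 1]) auto
  qed simp
  then show ?thesis by simp
qed

lemma integral_riesz_measure:
  assumes f: "f \<in> C0_real"
  shows "integral\<^sup>L riesz_measure f = L f"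
proof -
  obtain C where C: "\<And>x. \<bar>f x\<bar> \<le> C" using C0_real_bounded[OF f] by blast
  \<comment> \<open>Positive even for \<open>f = 0\<close>, so that both parts of \<open>f\<close>
    can be scaled into the unit interval.\<close>
  define c where "c = \<bar>C\<bar> + 1"
  have c: "c > 0" "\<And>x. \<bar>f x\<bar> \<le> c" using C[THEN order_trans, of "\<bar>C\<bar> + 1"] by (auto simp: c_def)
  note int = C0_real_integrable[OF finite_riesz_measure sets_riesz_measure]
  have *: "integral\<^sup>L riesz_measure (\<lambda>x. c * max 0 (inverse c * g x)) = L (\<lambda>x. c * max 0 (inverse c * g x))"
    if "g \<in> C0_real" "\<And>x. \<bar>g x\<bar> \<le> c" for g
  proof -
    have g: "(\<lambda>x. max 0 (inverse c * g x)) \<in> C0_real"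
      by (intro C0_real_max C0_real_zero C0_real_scale that)
    have "g x \<le> c" for x using that(2)[of x] by simp
    then have "integral\<^sup>L riesz_measure (\<lambda>x. max 0 (inverse c * g x)) = L (\<lambda>x. max 0 (inverse c * g x))"
      using c(1) by (intro integral_riesz_measure_unit g) (auto simp: field_simps)
    then show ?thesis by (simp add: L_scale[OF g])
  qed
  define f1 where "f1 = (\<lambda>x. c * max 0 (inverse c * f x))"
  define f2 where "f2 = (\<lambda>x. c * max 0 (inverse c * (- 1 * f x)))"
  have f12: "f1 \<in> C0_real" "f2 \<in> C0_real"
    unfolding f1_def f2_def by (intro C0_real_max C0_real_zero C0_real_scale f)+
  have f_eq: "f = (\<lambda>x. f1 x - f2 x)"
    using c(1) by (auto simp: f1_def f2_def fun_eq_iff max_def field_simps)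
  have "integral\<^sup>L riesz_measure f1 = L f1" "integral\<^sup>L riesz_measure f2 = L f2"
    unfolding f1_def f2_def by (rule *; use f c(2) C0_real_scale[OF f, of "- 1"] in simp)+
  then show ?thesis
    by (subst (1 2) f_eq) (simp add: L_diff f12 int)
qed

lemma riesz_measure_outer_regular:
  assumes "A \<in> sets borel"
  shows "emeasure riesz_measure A = (INF U\<in>{U. open U \<and> A \<subseteq> U}. emeasure riesz_measure U)"
  unfolding emeasure_riesz_measure[OF assms] outer_def
  by (intro INF_cong) (auto simp: emeasure_riesz_measure_open)

end

text \<open>Open sets are stable under intersection and generate the Borel sets, and their
  indicators are bounded pointwise limits of the test functions.\<close>

lemma finite_borel_measure_eqI:
  fixes \<mu> \<nu> :: "'x::{second_countable_topology, t2_space} measure"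
  assumes lc: "locally_compact_space (euclidean :: 'x topology)"
    and \<mu>: "finite_measure \<mu>" "sets \<mu> = sets borel" and \<nu>: "finite_measure \<nu>" "sets \<nu> = sets borel"
    and eq: "\<And>f. f \<in> C0_real \<Longrightarrow> (\<And>x. 0 \<le> f x) \<Longrightarrow> (\<And>x. f x \<le> 1) \<Longrightarrow> integral\<^sup>L \<mu> f = integral\<^sup>L \<nu> f"
  shows "\<mu> = \<nu>"
proof (rule measure_eqI_generator_eq[where E = "{U. open U}" and \<Omega> = UNIV and A = "\<lambda>_. UNIV"])
  fix U :: "'x set" assume "U \<in> {U. open U}"
  then have "open U" by simp
  obtain f :: "nat \<Rightarrow> 'x \<Rightarrow> real" where f: "\<And>n. f n \<in> C0_real" "\<And>n x. 0 \<le> f n x" "\<And>n x. f n x \<le> 1"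
      "\<And>x. (\<lambda>n. f n x) \<longlonglongrightarrow> indicator U x"
    using C0_real_approx_open[OF lc \<open>open U\<close>] by metis
  have lim: "(\<lambda>n. integral\<^sup>L M (f n)) \<longlonglongrightarrow> measure M U"
    if M: "finite_measure M" "sets M = sets borel" for M :: "'x measure"
  proof -
    interpret finite_measure M by fact
    note int = C0_real_integrable[OF M]
    have "(\<lambda>n. integral\<^sup>L M (f n)) \<longlonglongrightarrow> integral\<^sup>L M (indicator U)"
    proof (rule integral_dominated_convergence[where w = "\<lambda>_. 1"])
      show "indicator U \<in> borel_measurable M" using \<open>open U\<close> M(2) by (intro borel_measurable_indicator) auto
    qed (use int f in auto)
    then show ?thesis using sets_eq_imp_space_eq[OF M(2)] by simp
  qed
  have "measure \<mu> U = measure \<nu> U"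
    using lim[OF \<mu>] lim[OF \<nu>] eq f by (simp add: LIMSEQ_unique)
  then show "emeasure \<mu> U = emeasure \<nu> U"
    using \<mu>(1) \<nu>(1) by (simp add: finite_measure.emeasure_eq_measure)
qed (use \<mu> finite_measure.emeasure_finite[OF \<mu>(1)] \<nu> in \<open>auto simp: Int_stable_def borel_def\<close>)

text \<open>A finite Borel measure is the Riesz measure of its own integral, which is outer regular
  by construction.\<close>

lemma finite_borel_measure_outer_regular:
  fixes \<mu> :: "'x::{second_countable_topology, t2_space} measure"
  assumes lc: "locally_compact_space (euclidean :: 'x topology)"
    and \<mu>: "finite_measure \<mu>" "sets \<mu> = sets borel" and "A \<in> sets borel"
  shows "emeasure \<mu> A = (INF U\<in>{U. open U \<and> A \<subseteq> U}. emeasure \<mu> U)"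
proof -
  interpret finite_measure \<mu> by fact
  note int = C0_real_integrable[OF \<mu>]
  interpret bounded_positive_functional "integral\<^sup>L \<mu>" "measure \<mu> (space \<mu>)"
  proof
    fix f :: "'x \<Rightarrow> real" assume f: "f \<in> C0_real" "\<And>x. 0 \<le> f x" "\<And>x. f x \<le> 1"
    have "integral\<^sup>L \<mu> f \<le> integral\<^sup>L \<mu> (\<lambda>_. 1)"
      by (rule integral_mono[OF int[OF f(1)]]) (use f(3) in auto)
    then show "integral\<^sup>L \<mu> f \<le> measure \<mu> (space \<mu>)" by simp
  qed (auto simp: lc int)
  have "\<mu> = riesz_measure"
    using finite_borel_measure_eqI[OF lc \<mu> finite_riesz_measure sets_riesz_measure]
    by (simp add: integral_riesz_measure)
  then show ?thesis using riesz_measure_outer_regular[OF \<open>A \<in> sets borel\<close>] by simp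
qed

text \<open>The compact sets are superlevel sets, at height 1/2, of functions increasing to the
  indicator of \<open>U\<close>.\<close>

lemma open_eq_Union_compact:
  fixes U :: "'x::{second_countable_topology, t2_space} set"
  assumes "locally_compact_space (euclidean :: 'x topology)" "open U"
  obtains K :: "nat \<Rightarrow> 'x set" where "\<And>n. compact (K n)" "incseq K" "(\<Union>n. K n) = U"
proof -
  obtain f :: "nat \<Rightarrow> 'x \<Rightarrow> real" where f: "\<And>n. f n \<in> C0_real" "\<And>n x. f n x \<le> f (Suc n) x"
      "\<And>n x. x \<notin> U \<Longrightarrow> f n x = 0" "\<And>x. (\<lambda>n. f n x) \<longlonglongrightarrow> indicator U x"
    using C0_real_approx_open[OF assms] by metis
  define K where "K n = {x. 1/2 \<le> f n x}" for n
  have "compact (K n)" for n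
  proof -
    obtain C where C: "compact C" "\<And>x. x \<notin> C \<Longrightarrow> \<bar>f n x\<bar> < 1/2"
      using C0_real_small[OF f(1), of "1/2"] by auto
    have "closed (K n)"
      unfolding K_def by (intro closed_Collect_le continuous_intros C0_real_cont f)
    moreover have "K n = C \<inter> K n" using C(2) by (force simp: K_def)
    ultimately show ?thesis using compact_Int_closed[OF C(1)] by metis
  qed
  moreover have "incseq K"
    using f(2) by (intro incseq_SucI) (auto simp: K_def intro: order_trans)
  moreover have "(\<Union>n. K n) = U"
  proof (intro equalityI subsetI)
    fix x assume "x \<in> U"
    then have "(\<lambda>n. f n x) \<longlonglongrightarrow> 1" using f(4)[of x] by simp
    then have "\<forall>\<^sub>F n in sequentially. 1/2 < f n x" by (rule order_tendstoD) simp
    then obtain n where "1/2 < f n x" by (auto simp: eventually_sequentially)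
    then show "x \<in> (\<Union>n. K n)" by (auto simp: K_def intro: less_imp_le)
  qed (use f(3) in \<open>force simp: K_def\<close>)
  ultimately show ?thesis by (rule that)
qed

text \<open>On these spaces regularity is automatic. Inner regularity holds because open sets are
  sigma-compact; outer regularity is reduced to finite measures by restricting to countably many
  open sets of finite measure that cover the space.\<close>

lemma radon_measureI:
  fixes \<mu> :: "'x::{second_countable_topology, t2_space} measure"
  assumes lc: "locally_compact_space (euclidean :: 'x topology)"
    and sets: "sets \<mu> = sets borel" and fin: "\<And>K. compact K \<Longrightarrow> emeasure \<mu> K < \<infinity>"
  shows "radon_measure \<mu>"
  unfolding radon_measure_def
proof (intro conjI allI impI ballI)
  fix U :: "'x set" assume "open U"
  obtain K :: "nat \<Rightarrow> 'x set" where K: "\<And>n. compact (K n)" "incseq K" "(\<Union>n. K n) = U"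
    using open_eq_Union_compact[OF lc \<open>open U\<close>] by metis
  have "range K \<subseteq> sets \<mu>" using K(1) sets by (auto intro: borel_compact)
  then have "emeasure \<mu> U = (SUP n. emeasure \<mu> (K n))"
    using SUP_emeasure_incseq[OF _ K(2)] K(3) by simp
  also have "\<dots> \<le> (SUP K\<in>{K. compact K \<and> K \<subseteq> U}. emeasure \<mu> K)"
    using K by (intro SUP_mono) blast
  finally show "emeasure \<mu> U = (SUP K\<in>{K. compact K \<and> K \<subseteq> U}. emeasure \<mu> K)"
    using \<open>open U\<close> sets by (intro antisym SUP_least emeasure_mono) auto
next
  fix Z :: "'x set" assume Z: "Z \<in> sets borel"
  show "emeasure \<mu> Z = (INF U\<in>{U. open U \<and> Z \<subseteq> U}. emeasure \<mu> U)"
  proof (rule antisym)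
    show "emeasure \<mu> Z \<le> (INF U\<in>{U. open U \<and> Z \<subseteq> U}. emeasure \<mu> U)"
      using sets by (intro INF_greatest emeasure_mono) auto
    show "(INF U\<in>{U. open U \<and> Z \<subseteq> U}. emeasure \<mu> U) \<le> emeasure \<mu> Z"
    proof (rule ennreal_le_epsilon)
      fix e :: real assume "e > 0"
      define F where "F = {U :: 'x set. open U \<and> (\<exists>K. compact K \<and> U \<subseteq> K)}"
      obtain F' where F': "F' \<subseteq> F" "countable F'" "\<Union>F' = \<Union>F"
        using Lindelof[of F] unfolding F_def by blast
      have "\<Union>F = UNIV" using lc unfolding locally_compact_space_def F_def by simp blast
      have "{} \<in> F" by (auto simp: F_def)
      define U where "U = from_nat_into (insert {} F')"
      have range_U: "range U = insert {} F'"
        unfolding U_def by (rule range_from_nat_into) (use F' in auto)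
      have U: "open (U n)" "emeasure \<mu> (U n) < \<infinity>" for n
      proof -
        have "U n \<in> insert {} F'" using range_U by (metis rangeI)
        then have "U n \<in> F" using F'(1) \<open>{} \<in> F\<close> by auto
        then obtain K where K: "open (U n)" "compact K" "U n \<subseteq> K" by (auto simp: F_def)
        then show "open (U n)" by simp
        have "emeasure \<mu> (U n) \<le> emeasure \<mu> K"
          using K sets by (intro emeasure_mono) (auto intro: borel_compact)
        then show "emeasure \<mu> (U n) < \<infinity>" using fin[OF K(2)] by (rule le_less_trans)
      qed
      have cover: "(\<Union>n. U n) = UNIV" using range_U F'(3) \<open>\<Union>F = UNIV\<close> by simp
      \<comment> \<open>The restriction \<nu> of \<mu> to \<open>U n\<close> is finite, hence outer
        regular. The errors are geometric and add up to \<open>e\<close>.\<close>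
      have "\<exists>V. open V \<and> Z \<subseteq> V \<and> emeasure \<mu> (U n \<inter> V - Z) \<le> ennreal (e * (1/2)^Suc n)" for n
      proof -
        define \<nu> where "\<nu> = density \<mu> (indicator (U n))"
        have \<nu>: "emeasure \<nu> A = emeasure \<mu> (U n \<inter> A)" if "A \<in> sets borel" for A
          unfolding \<nu>_def using U(1)[of n] that sets by (intro emeasure_restricted) auto
        have \<nu>_sets: "sets \<nu> = sets borel" by (simp add: \<nu>_def sets)
        have \<nu>_fin: "finite_measure \<nu>"
        proof
          have "space \<nu> = UNIV" using sets_eq_imp_space_eq[OF \<nu>_sets] by simp
          then show "emeasure \<nu> (space \<nu>) \<noteq> \<infinity>" using \<nu>[of UNIV] U(2)[of n] by simp
        qed
        then have "emeasure \<nu> Z \<noteq> \<infinity>" using finite_measure.emeasure_finite by auto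
        define d where "d = e * (1/2)^Suc n"
        have "d > 0" using \<open>e > 0\<close> by (simp add: d_def)
        obtain r where r: "0 \<le> r" "emeasure \<nu> Z = ennreal r"
          using \<open>emeasure \<nu> Z \<noteq> \<infinity>\<close> by (cases "emeasure \<nu> Z") auto
        then have "emeasure \<nu> Z < emeasure \<nu> Z + ennreal (e * (1/2)^Suc n)"
          unfolding d_def[symmetric] using \<open>d > 0\<close>
          by (simp add: ennreal_plus[symmetric] ennreal_lessI del: ennreal_plus)
        then obtain V where V: "open V" "Z \<subseteq> V" "emeasure \<nu> V < emeasure \<nu> Z + ennreal (e * (1/2)^Suc n)"
          unfolding finite_borel_measure_outer_regular[OF lc \<nu>_fin \<nu>_sets Z] INF_less_iff by auto
        have "emeasure \<mu> (U n \<inter> V - Z) = emeasure \<nu> (V - Z)"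
          using \<nu>[of "V - Z"] V Z by (simp add: Int_Diff)
        also have "\<dots> = emeasure \<nu> V - emeasure \<nu> Z"
          using V Z \<nu>_sets \<open>emeasure \<nu> Z \<noteq> \<infinity>\<close> by (intro emeasure_Diff) auto
        also have "\<dots> \<le> ennreal (e * (1/2)^Suc n)"
          using V(3) by (intro ennreal_minus_le_iff[THEN iffD2]) (auto simp: less_imp_le)
        finally show ?thesis using V by blast
      qed
      then obtain V where V: "\<And>n. open (V n)" "\<And>n. Z \<subseteq> V n"
        "\<And>n. emeasure \<mu> (U n \<inter> V n - Z) \<le> ennreal (e * (1/2)^Suc n)" by metis
      define W where "W = (\<Union>n. U n \<inter> V n)"
      have "open W" unfolding W_def by (intro open_UN ballI open_Int U V)
      have "Z \<subseteq> W"
      proof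
        fix x assume "x \<in> Z"
        moreover have "x \<in> (\<Union>n. U n)" using cover by simp
        ultimately show "x \<in> W" using V(2) by (auto simp: W_def)
      qed
      then have "(INF U\<in>{U. open U \<and> Z \<subseteq> U}. emeasure \<mu> U) \<le> emeasure \<mu> W"
        using \<open>open W\<close> by (intro INF_lower) auto
      also have "\<dots> = emeasure \<mu> (Z \<union> (\<Union>n. U n \<inter> V n - Z))"
        using \<open>Z \<subseteq> W\<close> by (intro arg_cong[where f = "emeasure \<mu>"]) (auto simp: W_def)
      also have "\<dots> \<le> emeasure \<mu> Z + emeasure \<mu> (\<Union>n. U n \<inter> V n - Z)"
        using Z U V sets by (intro emeasure_subadditive) auto
      also have "emeasure \<mu> (\<Union>n. U n \<inter> V n - Z) \<le> (\<Sum>n. emeasure \<mu> (U n \<inter> V n - Z))"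
        using Z U V sets by (intro emeasure_subadditive_countably) auto
      also have "\<dots> \<le> (\<Sum>n. ennreal (e * (1/2)^Suc n))"
        by (intro suminf_le V) auto
      also have "\<dots> = ennreal e"
      proof (rule suminf_ennreal_eq)
        show "(\<lambda>n. e * (1/2)^Suc n) sums e"
          using sums_mult[OF power_half_series, of e] by simp
      qed (use \<open>e > 0\<close> in simp)
      finally show "(INF U\<in>{U. open U \<and> Z \<subseteq> U}. emeasure \<mu> U) \<le> emeasure \<mu> Z + ennreal e"
        by (simp add: add_left_mono)
    qed
  qed
qed (use sets fin in auto)

section \<open>Operators on square summable functions\<close>

lemmas coord_simps [simp] =
  plus_ell2.rep_eq minus_ell2.rep_eq uminus_ell2.rep_eq zero_ell2.rep_eq scaleR_ell2.rep_eq

lemma ell2_eqI: "(\<And>i. coord \<xi> i = coord \<eta> i) \<Longrightarrow> \<xi> = \<eta>"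
  by (simp add: coord_inject[symmetric] fun_eq_iff)

lemma sum_coord_le_norm: "finite F \<Longrightarrow> (\<Sum>i\<in>F. (cmod (coord \<xi> i))\<^sup>2) \<le> (norm \<xi>)\<^sup>2"
  unfolding norm_ell2_sq by (rule finite_sum_le_infsum) (auto simp: summable_coord)

lemma norm_ell2_le:
  assumes "\<And>F. finite F \<Longrightarrow> (\<Sum>i\<in>F. (cmod (coord \<xi> i))\<^sup>2) \<le> c\<^sup>2" "0 \<le> c"
  shows "norm \<xi> \<le> c"
proof -
  have "(norm \<xi>)\<^sup>2 \<le> c\<^sup>2"
    unfolding norm_ell2_sq by (rule infsum_le_finite_sums[OF summable_coord]) (use assms in auto)
  then show ?thesis using assms(2) by (rule power2_le_imp_le)
qed

lemma tendsto_coord: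
  assumes "(X \<longlongrightarrow> \<xi>) F" shows "((\<lambda>n. coord (X n) i) \<longlongrightarrow> coord \<xi> i) F"
proof -
  have "((\<lambda>n. coord (X n) i - coord \<xi> i) \<longlongrightarrow> 0) F"
  proof (rule Lim_null_comparison)
    show "((\<lambda>n. norm (X n - \<xi>)) \<longlongrightarrow> 0) F" using assms by (simp add: LIM_zero_iff tendsto_norm_zero)
    show "\<forall>\<^sub>F n in F. norm (coord (X n) i - coord \<xi> i) \<le> norm (X n - \<xi>)"
      using coord_le_norm[of "X _ - \<xi>" i] by simp
  qed
  then show ?thesis by (rule LIM_zero_cancel)
qed

text \<open>Completeness passes to the space of operators, where the adjoints of a convergent
  sequence have to converge.\<close>

instance ell2 :: (type) banach
proof
  fix X :: "nat \<Rightarrow> 'a ell2" assume X: "Cauchy X"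
  have "Cauchy (\<lambda>n. coord (X n) i)" for i
  proof (rule metric_CauchyI)
    fix e :: real assume "e > 0"
    then obtain M where M: "\<And>m n. m \<ge> M \<Longrightarrow> n \<ge> M \<Longrightarrow> dist (X m) (X n) < e"
      using X unfolding Cauchy_def by blast
    have "dist (coord (X m) i) (coord (X n) i) \<le> dist (X m) (X n)" for m n
      using coord_le_norm[of "X m - X n" i] by (simp add: dist_norm)
    then show "\<exists>M. \<forall>m\<ge>M. \<forall>n\<ge>M. dist (coord (X m) i) (coord (X n) i) < e"
      using M by (meson le_less_trans)
  qed
  then have "\<forall>i. \<exists>l. (\<lambda>n. coord (X n) i) \<longlonglongrightarrow> l"
    by (simp add: Cauchy_convergent_iff convergent_def)
  then obtain f where f: "\<And>i. (\<lambda>n. coord (X n) i) \<longlonglongrightarrow> f i" by metis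
  \<comment> \<open>Only finite sums are taken to the limit in the second index, so no limit has to
    be exchanged with an infinite sum.\<close>
  have bound: "(\<Sum>i\<in>F. (cmod (coord (X m) i - f i))\<^sup>2) \<le> e\<^sup>2"
    if "finite F" "\<And>n. n \<ge> M \<Longrightarrow> norm (X m - X n) < e" for F m M e
  proof (rule tendsto_upperbound)
    show "(\<lambda>n. \<Sum>i\<in>F. (cmod (coord (X m) i - coord (X n) i))\<^sup>2) \<longlonglongrightarrow> (\<Sum>i\<in>F. (cmod (coord (X m) i - f i))\<^sup>2)"
      by (intro tendsto_intros f)
    show "\<forall>\<^sub>F n in sequentially. (\<Sum>i\<in>F. (cmod (coord (X m) i - coord (X n) i))\<^sup>2) \<le> e\<^sup>2"
    proof (rule eventually_sequentiallyI)
      fix n assume "M \<le> n"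
      have "(\<Sum>i\<in>F. (cmod (coord (X m) i - coord (X n) i))\<^sup>2) \<le> (norm (X m - X n))\<^sup>2"
        using sum_coord_le_norm[OF that(1), of "X m - X n"] by simp
      also have "\<dots> \<le> e\<^sup>2" using that(2)[OF \<open>M \<le> n\<close>] by (intro power_mono) auto
      finally show "(\<Sum>i\<in>F. (cmod (coord (X m) i - coord (X n) i))\<^sup>2) \<le> e\<^sup>2" .
    qed
  qed simp
  obtain M where M: "\<And>m n. m \<ge> M \<Longrightarrow> n \<ge> M \<Longrightarrow> dist (X m) (X n) < 1"
    using X unfolding Cauchy_def by (meson zero_less_one)
  have "(\<lambda>i. (cmod (coord (X M) i - f i))\<^sup>2) summable_on UNIV"
  proof (rule nonneg_bdd_above_summable_on)
    show "bdd_above (sum (\<lambda>i. (cmod (coord (X M) i - f i))\<^sup>2) ` {F. F \<subseteq> UNIV \<and> finite F})"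
    proof (rule bdd_aboveI2[where M = 1], clarify)
      fix F :: "'a set" assume "finite F"
      then show "(\<Sum>i\<in>F. (cmod (coord (X M) i - f i))\<^sup>2) \<le> 1"
        using bound[of F M M 1] M[of M] by (simp add: dist_norm)
    qed
  qed simp
  then have "(\<lambda>i. (cmod (f i - coord (X M) i))\<^sup>2) summable_on UNIV"
    by (simp add: norm_minus_commute)
  from summable_ell2_add[OF summable_coord[of "X M"] this]
  have "(\<lambda>i. (cmod (f i))\<^sup>2) summable_on UNIV" by simp
  then have coord_f: "coord (Abs_ell2 f) = f" by (intro Abs_ell2_inverse) simp
  have "X \<longlonglongrightarrow> Abs_ell2 f"
  proof (rule metric_LIMSEQ_I)
    fix e :: real assume "e > 0"
    then obtain M where M: "\<And>m n. m \<ge> M \<Longrightarrow> n \<ge> M \<Longrightarrow> dist (X m) (X n) < e / 2"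
      using X unfolding Cauchy_def by (meson half_gt_zero)
    have "dist (X m) (Abs_ell2 f) < e" if "m \<ge> M" for m
    proof -
      have "norm (X m - Abs_ell2 f) \<le> e / 2"
      proof (rule norm_ell2_le)
        fix F :: "'a set" assume "finite F"
        then show "(\<Sum>i\<in>F. (cmod (coord (X m - Abs_ell2 f) i))\<^sup>2) \<le> (e / 2)\<^sup>2"
          using bound[of F M m "e / 2"] M[OF that] by (simp add: dist_norm coord_f)
      qed (use \<open>e > 0\<close> in simp)
      then show ?thesis using \<open>e > 0\<close> by (simp add: dist_norm)
    qed
    then show "\<exists>M. \<forall>m\<ge>M. dist (X m) (Abs_ell2 f) < e" by blast
  qed
  then show "convergent X" by (rule convergentI)
qed

abbreviation imul :: "'i ell2 \<Rightarrow> 'i ell2" where "imul \<equiv> blinfun_apply (diag_op (\<lambda>_. \<i>))"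

lemma coord_diag_const: "coord (diag_op (\<lambda>_. c) \<xi>) i = c * coord \<xi> i"
  by (rule coord_diag_op[where C = "cmod c"]) simp

lemma cinner_summable: "(\<lambda>i. cnj (coord \<xi> i) * coord \<eta> i) summable_on UNIV"
  by (rule abs_summable_summable[OF abs_summable_cinner])

lemma cinner_imul: "cinner \<xi> (imul \<eta>) = \<i> * cinner \<xi> \<eta>"
  unfolding cinner_def coord_diag_const
  by (subst infsum_cmult_right'[symmetric]) (simp add: mult_ac)

lemma Re_cinner: "Re (cinner \<xi> \<eta>) = \<xi> \<bullet> \<eta>"
  unfolding cinner_def inner_ell2_def infsum_Re[OF cinner_summable, symmetric]
  by (simp add: inner_complex_def)

text \<open>Lets \<open>cinner\<close> inherit additivity and continuity from the real inner product
  of the type class.\<close>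

lemma cinner_conv_inner: "cinner \<xi> \<eta> = of_real (\<xi> \<bullet> \<eta>) - \<i> * of_real (\<xi> \<bullet> imul \<eta>)"
  by (rule complex_eqI) (simp_all add: Re_cinner[symmetric] cinner_imul)

lemma cinner_self: "cinner \<xi> \<xi> = of_real ((norm \<xi>)\<^sup>2)"
proof -
  have "cinner \<xi> \<xi> = (\<Sum>\<^sub>\<infinity>i. of_real ((cmod (coord \<xi> i))\<^sup>2))"
    unfolding cinner_def by (simp only: complex_norm_square mult.commute)
  also have "\<dots> = of_real ((norm \<xi>)\<^sup>2)"
    unfolding norm_ell2_sq
    using has_sum_of_real[OF has_sum_infsum[OF summable_coord[of \<xi>]], where 'a = complex]
    by (rule infsumI)
  finally show ?thesis .
qed

lemma cinner_add_left: "cinner (\<xi> + \<xi>') \<eta> = cinner \<xi> \<eta> + cinner \<xi>' \<eta>"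
  and cinner_add_right: "cinner \<xi> (\<eta> + \<eta>') = cinner \<xi> \<eta> + cinner \<xi> \<eta>'"
  and cinner_scaleR_left: "cinner (r *\<^sub>R \<xi>) \<eta> = of_real r * cinner \<xi> \<eta>"
  and cinner_scaleR_right: "cinner \<xi> (r *\<^sub>R \<eta>) = of_real r * cinner \<xi> \<eta>"
  by (simp_all add: cinner_conv_inner inner_add_left inner_add_right blinfun.add_right
      blinfun.scaleR_right algebra_simps)

lemma tendsto_cinner:
  assumes "(X \<longlongrightarrow> \<xi>) F" "(Z \<longlongrightarrow> \<eta>) F"
  shows "((\<lambda>n. cinner (X n) (Z n)) \<longlongrightarrow> cinner \<xi> \<eta>) F"
  unfolding cinner_conv_inner by (intro tendsto_intros assms)

text \<open>As a definite description, \<open>adj\<close> says something only after an adjoint has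
  been exhibited. The relation can be carried through sums, products and limits first.\<close>

definition is_adj :: "'i op \<Rightarrow> 'i op \<Rightarrow> bool"
  where "is_adj a b \<longleftrightarrow> (\<forall>\<xi> \<eta>. cinner (a \<xi>) \<eta> = cinner \<xi> (b \<eta>))"

lemma adj_eqI:
  fixes a b :: "'i op"
  assumes "is_adj a b" shows "adj a = b"
  unfolding adj_def
proof (rule the_equality)
  show "\<forall>\<xi> \<eta>. cinner (a \<xi>) \<eta> = cinner \<xi> (b \<eta>)" using assms by (simp add: is_adj_def)
  fix b' :: "'i op" assume b': "\<forall>\<xi> \<eta>. cinner (a \<xi>) \<eta> = cinner \<xi> (b' \<eta>)"
  show "b' = b"
  proof (rule blinfun_eqI, rule ell2_eqI)
    fix \<eta> i
    show "coord (b' \<eta>) i = coord (b \<eta>) i"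
      using assms b' cinner_delta[of i "b \<eta>"] cinner_delta[of i "b' \<eta>"] by (simp add: is_adj_def)
  qed
qed

lemma is_adj_add: "is_adj a b \<Longrightarrow> is_adj a' b' \<Longrightarrow> is_adj (a + a') (b + b')"
  by (simp add: is_adj_def blinfun.add_left cinner_add_left cinner_add_right)

lemma is_adj_scaleR: "is_adj a b \<Longrightarrow> is_adj (r *\<^sub>R a) (r *\<^sub>R b)"
  by (simp add: is_adj_def blinfun.scaleR_left cinner_scaleR_left cinner_scaleR_right)

lemma is_adj_diff: "is_adj a b \<Longrightarrow> is_adj a' b' \<Longrightarrow> is_adj (a - a') (b - b')"
  using is_adj_add[of a b "- 1 *\<^sub>R a'" "- 1 *\<^sub>R b'"] is_adj_scaleR[of a' b' "-1"] by simp

lemma is_adj_compose: "is_adj a b \<Longrightarrow> is_adj a' b' \<Longrightarrow> is_adj (a o\<^sub>L a') (b' o\<^sub>L b)"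
  by (simp add: is_adj_def)

lemma is_adj_diag:
  assumes "\<And>i. cmod (m i) \<le> C"
  shows "is_adj (diag_op m) (diag_op (\<lambda>i. cnj (m i)))"
  unfolding is_adj_def cinner_def
  using coord_diag_op[of m C] coord_diag_op[of "\<lambda>i. cnj (m i)" C] assms by (simp add: mult_ac)

lemma is_adj_perm:
  assumes "bij p" "bij q" "\<And>i. p (q i) = i"
  shows "is_adj (perm_op p) (perm_op q)"
  unfolding is_adj_def
proof (intro allI)
  fix \<xi> \<eta> :: "'a ell2"
  show "cinner (perm_op p \<xi>) \<eta> = cinner \<xi> (perm_op q \<eta>)"
    unfolding cinner_def coord_perm_op[OF assms(1)] coord_perm_op[OF assms(2)]
    using infsum_reindex_bij_betw[OF assms(2), of "\<lambda>i. cnj (coord \<xi> (p i)) * coord \<eta> i"]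
    by (simp add: assms(3))
qed

text \<open>The square of \<open>norm (b \<eta>)\<close> is
  \<open>cinner (a (b \<eta>)) \<eta>\<close>; apply Cauchy-Schwarz and cancel one factor
  \<open>norm (b \<eta>)\<close>.\<close>

lemma norm_adj_le:
  assumes "is_adj a b" shows "norm b \<le> norm a"
proof (rule norm_blinfun_bound)
  fix \<eta>
  have "of_real ((norm (b \<eta>))\<^sup>2) = cinner (a (b \<eta>)) \<eta>"
    using assms by (simp add: is_adj_def cinner_self)
  then have "(norm (b \<eta>))\<^sup>2 = Re (cinner (a (b \<eta>)) \<eta>)" by (metis Re_complex_of_real)
  also have "\<dots> = a (b \<eta>) \<bullet> \<eta>" by (simp add: cinner_conv_inner)
  also have "\<dots> \<le> norm (a (b \<eta>)) * norm \<eta>" by (rule norm_cauchy_schwarz)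
  also have "\<dots> \<le> (norm a * norm (b \<eta>)) * norm \<eta>" by (intro mult_right_mono norm_blinfun) simp
  finally have "norm (b \<eta>) * norm (b \<eta>) \<le> norm (b \<eta>) * (norm a * norm \<eta>)"
    by (simp add: power2_eq_square mult_ac)
  then show "norm (b \<eta>) \<le> norm a * norm \<eta>"
    by (cases "norm (b \<eta>) = 0") (simp_all add: mult_le_cancel_left_pos order_less_le del: norm_eq_zero)
qed simp

text \<open>Adjoints of differences are no larger than the differences themselves, so the adjoints
  form a Cauchy sequence.\<close>

lemma is_adj_limit:
  assumes "\<And>n. is_adj (a n) (b n)" "a \<longlonglongrightarrow> a'"
  obtains b' where "b \<longlonglongrightarrow> b'" "is_adj a' b'"
proof -
  have "Cauchy b"
  proof (rule metric_CauchyI)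
    fix e :: real assume "e > 0"
    have "Cauchy a" using assms(2) by (rule LIMSEQ_imp_Cauchy)
    then obtain M where "\<And>m n. m \<ge> M \<Longrightarrow> n \<ge> M \<Longrightarrow> dist (a m) (a n) < e"
      using \<open>e > 0\<close> unfolding Cauchy_def by blast
    moreover have "dist (b m) (b n) \<le> dist (a m) (a n)" for m n
      unfolding dist_norm by (rule norm_adj_le) (intro is_adj_diff assms)
    ultimately show "\<exists>M. \<forall>m\<ge>M. \<forall>n\<ge>M. dist (b m) (b n) < e" by (meson le_less_trans)
  qed
  then obtain b' where b': "b \<longlonglongrightarrow> b'" by (auto simp: Cauchy_convergent_iff convergent_def)
  have "is_adj a' b'"
    unfolding is_adj_def
  proof (intro allI)
    fix \<xi> \<eta>
    have "(\<lambda>n. cinner (a n \<xi>) \<eta>) \<longlonglongrightarrow> cinner (a' \<xi>) \<eta>"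
      by (intro tendsto_cinner blinfun.tendsto assms(2) tendsto_const)
    moreover have "(\<lambda>n. cinner \<xi> (b n \<eta>)) \<longlonglongrightarrow> cinner \<xi> (b' \<eta>)"
      by (intro tendsto_cinner blinfun.tendsto b' tendsto_const)
    ultimately show "cinner (a' \<xi>) \<eta> = cinner \<xi> (b' \<eta>)"
      using assms(1) LIMSEQ_unique unfolding is_adj_def by auto
  qed
  with b' show ?thesis by (rule that)
qed

lemma scaleC_op_add: "scaleC_op c (a + b) = scaleC_op c a + scaleC_op c b"
  by (intro blinfun_eqI ell2_eqI) (simp add: coord_scaleC_op blinfun.add_left algebra_simps)

lemma scaleC_op_diff: "scaleC_op c (a - b) = scaleC_op c a - scaleC_op c b"
  by (intro blinfun_eqI ell2_eqI) (simp add: coord_scaleC_op blinfun.diff_left algebra_simps)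

lemma scaleC_op_diff_left: "scaleC_op (c - d) a = scaleC_op c a - scaleC_op d a"
  by (intro blinfun_eqI ell2_eqI) (simp add: coord_scaleC_op blinfun.diff_left algebra_simps)

lemma scaleC_op_scaleC [simp]: "scaleC_op c (scaleC_op d a) = scaleC_op (c * d) a"
  by (intro blinfun_eqI ell2_eqI) (simp add: coord_scaleC_op)

lemma scaleC_op_one [simp]: "scaleC_op 1 a = a"
  by (intro blinfun_eqI ell2_eqI) (simp add: coord_scaleC_op)

lemma scaleC_op_zero [simp]: "scaleC_op c 0 = 0"
  by (intro blinfun_eqI ell2_eqI) (simp add: coord_scaleC_op)

lemma scaleC_op_of_real: "scaleC_op (of_real r) a = r *\<^sub>R a"
  by (intro blinfun_eqI ell2_eqI) (simp add: coord_scaleC_op blinfun.scaleR_left scaleR_conv_of_real)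

lemma scaleC_op_scaleR: "scaleC_op c (r *\<^sub>R a) = r *\<^sub>R scaleC_op c a"
  by (simp add: scaleC_op_of_real[symmetric] mult.commute)

lemma blinfun_compose_add_left: "(a + b) o\<^sub>L c = (a o\<^sub>L c) + (b o\<^sub>L c)"
  and blinfun_compose_add_right: "c o\<^sub>L (a + b) = (c o\<^sub>L a) + (c o\<^sub>L b)"
  and blinfun_compose_scaleR_left: "((r *\<^sub>R a) o\<^sub>L c) = r *\<^sub>R (a o\<^sub>L c)"
  and blinfun_compose_scaleR_right: "(c o\<^sub>L (r *\<^sub>R a)) = r *\<^sub>R (c o\<^sub>L a)"
  by (rule blinfun_eqI, simp add: blinfun.bilinear_simps)+

lemma blinfun_compose_assoc: "(a o\<^sub>L b) o\<^sub>L c = a o\<^sub>L (b o\<^sub>L c)"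
  by (rule blinfun_eqI) simp

lemma scaleC_op_compose_left: "scaleC_op c a o\<^sub>L b = scaleC_op c (a o\<^sub>L b)"
  by (simp add: scaleC_op_def blinfun_compose_assoc)

lemma norm_diag_op_le:
  assumes "\<And>i. cmod (m i) \<le> C" shows "norm (diag_op m) \<le> C"
proof (rule norm_blinfun_bound)
  show C: "0 \<le> C" using assms[of undefined] norm_ge_zero order_trans by blast
  fix \<xi>
  show "norm (diag_op m \<xi>) \<le> C * norm \<xi>"
  proof (rule norm_ell2_le)
    fix F :: "'a set" assume F: "finite F"
    have "(\<Sum>i\<in>F. (cmod (coord (diag_op m \<xi>) i))\<^sup>2) \<le> (\<Sum>i\<in>F. C\<^sup>2 * (cmod (coord \<xi> i))\<^sup>2)"
      unfolding coord_diag_op[OF assms] norm_mult power_mult_distrib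
      by (intro sum_mono mult_right_mono power_mono assms) auto
    also have "\<dots> \<le> (C * norm \<xi>)\<^sup>2"
      using sum_coord_le_norm[OF F, of \<xi>]
      by (simp add: sum_distrib_left[symmetric] power_mult_distrib mult_left_mono)
    finally show "(\<Sum>i\<in>F. (cmod (coord (diag_op m \<xi>) i))\<^sup>2) \<le> (C * norm \<xi>)\<^sup>2" .
  qed (use C in simp)
qed

lemma norm_perm_op_le:
  assumes "bij p" shows "norm (perm_op p) \<le> 1"
proof (rule norm_blinfun_bound)
  fix \<xi>
  have "(norm (perm_op p \<xi>))\<^sup>2 = (norm \<xi>)\<^sup>2"
    unfolding norm_ell2_sq coord_perm_op[OF assms] by (rule infsum_reindex_bij_betw[OF assms])
  then show "norm (perm_op p \<xi>) \<le> 1 * norm \<xi>" by simp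
qed simp

lemma norm_scaleC_op_le: "norm (scaleC_op c a) \<le> cmod c * norm a"
  unfolding scaleC_op_def
  by (rule order_trans[OF norm_blinfun_compose]) (intro mult_right_mono norm_diag_op_le; simp)

lemma tendsto_scaleC_op:
  assumes "(f \<longlongrightarrow> c) F" "(a \<longlongrightarrow> b) F" shows "((\<lambda>n. scaleC_op (f n) (a n)) \<longlongrightarrow> scaleC_op c b) F"
proof -
  have "((\<lambda>n. scaleC_op (f n) (a n - b)) \<longlongrightarrow> 0) F"
  proof (rule Lim_null_comparison)
    show "\<forall>\<^sub>F n in F. norm (scaleC_op (f n) (a n - b)) \<le> cmod (f n) * norm (a n - b)"
      by (simp add: norm_scaleC_op_le)
    have "((\<lambda>n. cmod (f n) * norm (a n - b)) \<longlongrightarrow> cmod c * norm (b - b)) F"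
      by (intro tendsto_intros assms)
    then show "((\<lambda>n. cmod (f n) * norm (a n - b)) \<longlongrightarrow> 0) F" by simp
  qed
  moreover have "((\<lambda>n. scaleC_op (f n - c) b) \<longlongrightarrow> 0) F"
  proof (rule Lim_null_comparison)
    show "\<forall>\<^sub>F n in F. norm (scaleC_op (f n - c) b) \<le> cmod (f n - c) * norm b"
      by (simp add: norm_scaleC_op_le)
    have "((\<lambda>n. cmod (f n - c) * norm b) \<longlongrightarrow> cmod (c - c) * norm b) F"
      by (intro tendsto_intros assms)
    then show "((\<lambda>n. cmod (f n - c) * norm b) \<longlongrightarrow> 0) F" by simp
  qed
  ultimately have "((\<lambda>n. scaleC_op (f n) (a n - b) + scaleC_op (f n - c) b + scaleC_op c b) \<longlongrightarrow> 0 + 0 + scaleC_op c b) F"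
    by (intro tendsto_intros)
  then show ?thesis by (simp add: scaleC_op_diff scaleC_op_diff_left)
qed

lemma is_adj_scaleC: "is_adj a b \<Longrightarrow> is_adj (scaleC_op c a) (b o\<^sub>L diag_op (\<lambda>_. cnj c))"
  unfolding scaleC_op_def by (intro is_adj_compose is_adj_diag[where C = "cmod c"]) auto

text \<open>Bounded operators of the library are only real linear.\<close>

definition complex_linear :: "'i op \<Rightarrow> bool"
  where "complex_linear a \<longleftrightarrow> (\<forall>c. a o\<^sub>L diag_op (\<lambda>_. c) = diag_op (\<lambda>_. c) o\<^sub>L a)"

lemma compose_scaleC_right:
  assumes "complex_linear a" shows "a o\<^sub>L scaleC_op c b = scaleC_op c (a o\<^sub>L b)"
  using assms unfolding complex_linear_def scaleC_op_def
  by (simp flip: blinfun_compose_assoc)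

lemma complex_linear_adj_scaleC:
  assumes "is_adj a b" "complex_linear b"
  shows "is_adj (scaleC_op c a) (scaleC_op (cnj c) b)"
  using is_adj_scaleC[OF assms(1), of c] assms(2) by (simp add: complex_linear_def scaleC_op_def)

lemma closed_complex_linear: "closed {a. complex_linear a}"
proof -
  have *: "{a. complex_linear a} = (\<Inter>c. {a. a o\<^sub>L diag_op (\<lambda>_. c) = diag_op (\<lambda>_. c) o\<^sub>L a})"
    by (auto simp: complex_linear_def)
  have "closed {a. a o\<^sub>L diag_op (\<lambda>_. c) = diag_op (\<lambda>_. c) o\<^sub>L a}" for c
    by (intro closed_Collect_eq continuous_intros)
  then show ?thesis unfolding * by (intro closed_INT) blast
qed

lemma subspace_complex_linear: "subspace {a :: 'i op. complex_linear a}"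
  unfolding subspace_def complex_linear_def
proof (safe)
  fix a b :: "'i op" and c r
  assume a: "\<forall>c. a o\<^sub>L diag_op (\<lambda>_. c) = diag_op (\<lambda>_. c) o\<^sub>L a"
    and b: "\<forall>c. b o\<^sub>L diag_op (\<lambda>_. c) = diag_op (\<lambda>_. c) o\<^sub>L b"
  show "(a + b) o\<^sub>L diag_op (\<lambda>_. c) = diag_op (\<lambda>_. c) o\<^sub>L (a + b)"
    using a b by (simp add: blinfun_compose_add_left blinfun_compose_add_right)
  show "(r *\<^sub>R a) o\<^sub>L diag_op (\<lambda>_. c) = diag_op (\<lambda>_. c) o\<^sub>L (r *\<^sub>R a)"
    using a by (simp add: blinfun_compose_scaleR_left blinfun_compose_scaleR_right)
next
  fix c show "(0 :: 'i op) o\<^sub>L diag_op (\<lambda>_. c) = diag_op (\<lambda>_. c) o\<^sub>L 0"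
    by simp
qed

lemma subspace_closure:
  fixes S :: "'a::real_normed_vector set"
  assumes "subspace S" shows "subspace (closure S)"
  unfolding subspace_def
proof (intro conjI ballI allI)
  show "0 \<in> closure S" using subspace_0[OF assms] closure_subset by blast
next
  fix x y assume "x \<in> closure S" "y \<in> closure S"
  then obtain f g where "\<And>n. f n \<in> S" "f \<longlonglongrightarrow> x" "\<And>n. g n \<in> S" "g \<longlonglongrightarrow> y"
    unfolding closure_sequential by blast
  then have "\<And>n. f n + g n \<in> S" "(\<lambda>n. f n + g n) \<longlonglongrightarrow> x + y"
    using subspace_add[OF assms] by (auto intro: tendsto_add)
  then show "x + y \<in> closure S"
    unfolding closure_sequential by (intro exI[of _ "\<lambda>n. f n + g n"]) simp
next
  fix c x assume "x \<in> closure S"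
  then obtain f where "\<And>n. f n \<in> S" "f \<longlonglongrightarrow> x"
    unfolding closure_sequential by blast
  then have "\<And>n. c *\<^sub>R f n \<in> S" "(\<lambda>n. c *\<^sub>R f n) \<longlonglongrightarrow> c *\<^sub>R x"
    using subspace_scale[OF assms] by (auto intro: tendsto_scaleR)
  then show "c *\<^sub>R x \<in> closure S"
    unfolding closure_sequential by (intro exI[of _ "\<lambda>n. c *\<^sub>R f n"]) simp
qed

section \<open>Monomials in the crossed product\<close>

definition monomial :: "('g::group_add \<Rightarrow> 'x \<Rightarrow> 'x) \<Rightarrow> ('x \<Rightarrow> complex) \<Rightarrow> 'g \<Rightarrow> ('g \<times> 'x) op"
  where "monomial act f g = fun_op act f o\<^sub>L group_op g"

lemma group_op_zero: "group_op 0 = id_blinfun"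
  by (intro blinfun_eqI ell2_eqI, clarify) (simp add: coord_group_op)

lemma fun_op_eq_monomial: "fun_op act f = monomial act f 0"
  by (intro blinfun_eqI) (simp add: monomial_def group_op_zero)

lemma coord_monomial:
  assumes "bounded (range f)"
  shows "coord (monomial act f g \<xi>) (h, x) = f (act h x) * coord \<xi> (- g + h, x)"
proof -
  obtain C where "\<And>x. cmod (f x) \<le> C" using assms by (auto simp: bounded_iff)
  then show ?thesis by (simp add: monomial_def coord_fun_op[where C = C] coord_group_op)
qed

lemma bounded_range_mult:
  fixes f f' :: "'x \<Rightarrow> complex"
  assumes "bounded (range f)" "bounded (range f')" shows "bounded (range (\<lambda>x. f x * f' (p x)))"
proof -
  obtain C C' where C: "\<And>x. cmod (f x) \<le> C" "\<And>x. cmod (f' x) \<le> C'"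
    using assms by (auto simp: bounded_iff)
  have "cmod (f x * f' (p x)) \<le> C * C'" for x
    unfolding norm_mult using order_trans[OF norm_ge_zero C(1)] by (intro mult_mono C) auto
  then show ?thesis by (auto simp: bounded_iff)
qed

lemma bounded_range_indicator: "bounded (range (indicator Y :: 'x \<Rightarrow> complex))"
  by (auto simp: bounded_iff indicator_def intro!: exI[of _ 1])

lemma C0_bounded_range: "f \<in> C0 \<Longrightarrow> bounded (range f)"
  using C0_bounded[of f] by (auto simp: bounded_iff)

lemma norm_monomial_le:
  fixes act :: "'g::group_add \<Rightarrow> 'x \<Rightarrow> 'x"
  assumes "\<And>x. cmod (f x) \<le> C" shows "norm (monomial act f g) \<le> C"
proof -
  have "bij (\<lambda>(h, x). (- g + h, x) :: 'g \<times> 'x)"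
    by (rule bij_betw_byWitness[where f' = "\<lambda>(h, x). (g + h, x)"]) auto
  then have "norm (group_op g :: ('g \<times> 'x) op) \<le> 1"
    unfolding group_op_def by (rule norm_perm_op_le)
  moreover have "norm (fun_op act f) \<le> C"
    unfolding fun_op_def by (rule norm_diag_op_le) (auto simp: assms)
  ultimately have "norm (fun_op act f) * norm (group_op g :: ('g \<times> 'x) op) \<le> C * 1"
    by (intro mult_mono) (auto intro: order_trans[OF norm_ge_zero])
  then show ?thesis unfolding monomial_def using norm_blinfun_compose order_trans by fastforce
qed

lemma monomial_add:
  assumes "bounded (range f)" "bounded (range f')"
  shows "monomial act (\<lambda>x. f x + f' x) g = monomial act f g + monomial act f' g"
proof (intro blinfun_eqI ell2_eqI, clarify)
  fix \<xi> h x
  have "bounded (range (\<lambda>x. f x + f' x))"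
    using bounded_plus_comp[OF assms] .
  then show "coord (monomial act (\<lambda>x. f x + f' x) g \<xi>) (h, x) =
      coord ((monomial act f g + monomial act f' g) \<xi>) (h, x)"
    by (simp add: coord_monomial assms blinfun.add_left algebra_simps)
qed

lemma monomial_scaleC:
  assumes "bounded (range f)"
  shows "monomial act (\<lambda>x. c * f x) g = scaleC_op c (monomial act f g)"
proof (intro blinfun_eqI ell2_eqI, clarify)
  fix \<xi> h x
  have "bounded (range (\<lambda>x. c * f x))"
    using bounded_range_mult[of "\<lambda>_. c" f "\<lambda>x. x"] assms by simp
  then show "coord (monomial act (\<lambda>x. c * f x) g \<xi>) (h, x) = coord (scaleC_op c (monomial act f g) \<xi>) (h, x)"
    by (simp add: coord_monomial assms coord_scaleC_op)
qed

lemma monomial_zero: "monomial act (\<lambda>_. 0) g = 0"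
  using monomial_scaleC[of "\<lambda>_. 0" act 0 g] by (simp add: scaleC_op_of_real[of 0, simplified])

lemma complex_linear_monomial:
  assumes "bounded (range f)" shows "complex_linear (monomial act f g)"
  unfolding complex_linear_def
  by (intro allI blinfun_eqI ell2_eqI, clarify) (simp add: coord_monomial[OF assms] coord_diag_const)

locale transformation =
  fixes act :: "'g::group_add \<Rightarrow> 'x::{second_countable_topology, t2_space} \<Rightarrow> 'x" and Y :: "'x set"
  assumes lc: "locally_compact_space (euclidean :: 'x topology)"
    and act_0: "act 0 x = x"
    and act_add: "act (g + h) x = act g (act h x)"
    and act_cont: "continuous_on UNIV (act g)"
    and open_Y: "open Y" and closed_Y: "closed Y"
begin

lemma act_uminus [simp]: "act (- g) (act g x) = x" "act g (act (- g) x) = x"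
  by (simp_all add: act_add[symmetric] act_0)

lemma act_image_eq_vimage: "act g ` A = act (- g) -` A"
  by (auto simp: image_iff) (metis act_uminus(2))

lemma act_image_mem: "x \<in> act g ` A \<longleftrightarrow> act (- g) x \<in> A"
  by (simp add: act_image_eq_vimage)

lemma inj_act: "inj (act g)"
  by (rule inj_on_inverseI[where g = "act (- g)"]) simp

lemma open_act_image: "open A \<Longrightarrow> open (act g ` A)"
  unfolding act_image_eq_vimage using act_cont by (rule open_vimage[rotated])

lemma closed_act_image: "closed A \<Longrightarrow> closed (act g ` A)"
  unfolding act_image_eq_vimage using act_cont by (rule closed_vimage[rotated])

lemma borel_act: "act g \<in> borel \<rightarrow>\<^sub>M borel"
  by (rule borel_measurable_continuous_onI[OF act_cont])

lemma borel_act_image: "A \<in> sets borel \<Longrightarrow> act g ` A \<in> sets borel"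
  unfolding act_image_eq_vimage using measurable_sets[OF borel_act, of A] by simp

lemma C0_compose_act:
  assumes "f \<in> C0" shows "(\<lambda>x. f (act g x)) \<in> C0"
  unfolding C0_def
proof (safe)
  show "continuous_on UNIV (\<lambda>x. f (act g x))"
    using assms by (auto simp: C0_def intro!: continuous_on_compose2[OF _ act_cont])
  fix \<epsilon> :: real assume "\<epsilon> > 0"
  then obtain K where K: "compact K" "\<And>x. x \<notin> K \<Longrightarrow> cmod (f x) < \<epsilon>"
    using assms unfolding C0_def by blast
  have "compact (act (- g) ` K)"
    using compact_continuous_image[OF continuous_on_subset[OF act_cont] K(1)] by auto
  moreover have "cmod (f (act g x)) < \<epsilon>" if "x \<notin> act (- g) ` K" for x
    using K(2)[of "act g x"] that by (auto simp: act_image_mem)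
  ultimately show "\<exists>K. compact K \<and> (\<forall>x. x \<notin> K \<longrightarrow> cmod (f (act g x)) < \<epsilon>)" by blast
qed

lemma monomial_mult:
  assumes "bounded (range f)" "bounded (range f')"
  shows "monomial act f g o\<^sub>L monomial act f' g' = monomial act (\<lambda>x. f x * f' (act (- g) x)) (g + g')"
proof (intro blinfun_eqI ell2_eqI, clarify)
  fix \<xi> h x
  have "- (g + g') + h = - g' + (- g + h)" by (simp only: minus_add add.assoc)
  moreover have "bounded (range (\<lambda>x. f x * f' (act (- g) x)))" using assms by (rule bounded_range_mult)
  ultimately show "coord ((monomial act f g o\<^sub>L monomial act f' g') \<xi>) (h, x) =
      coord (monomial act (\<lambda>x. f x * f' (act (- g) x)) (g + g') \<xi>) (h, x)"
    by (simp add: coord_monomial assms act_add)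
qed

lemma is_adj_monomial:
  assumes "bounded (range f)"
  shows "is_adj (monomial act f g) (monomial act (\<lambda>x. cnj (f (act g x))) (- g))"
proof -
  obtain C where C: "\<And>x. cmod (f x) \<le> C" using assms by (auto simp: bounded_iff)
  have bij: "bij (\<lambda>(h, x). (k + h, x) :: 'g \<times> 'x)" for k
    by (rule bij_betw_byWitness[where f' = "\<lambda>(h, x). (- k + h, x)"]) auto
  have 1: "is_adj (fun_op act f) (fun_op act (\<lambda>x. cnj (f x)))"
    using is_adj_diag[of "\<lambda>(h, x). f (act h x)" C] C by (simp add: fun_op_def case_prod_unfold)
  have 2: "is_adj (group_op g :: ('g \<times> 'x) op) (group_op (- g))"
    unfolding group_op_def by (rule is_adj_perm) (use bij[of g] bij[of "- g"] in auto)
  have 3: "group_op (- g) o\<^sub>L fun_op act (\<lambda>x. cnj (f x)) = monomial act (\<lambda>x. cnj (f (act g x))) (- g)"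
  proof (intro blinfun_eqI ell2_eqI, clarify)
    fix \<xi> h x
    have "bounded (range (\<lambda>x. cnj (f (act g x))))" using C by (auto simp: bounded_iff)
    then show "coord ((group_op (- g) o\<^sub>L fun_op act (\<lambda>x. cnj (f x))) \<xi>) (h, x) =
        coord (monomial act (\<lambda>x. cnj (f (act g x))) (- g) \<xi>) (h, x)"
      by (simp add: coord_monomial coord_group_op coord_fun_op[where C = C] C act_add)
  qed
  show ?thesis using is_adj_compose[OF 1 2] unfolding 3 by (simp add: monomial_def)
qed

lemma C0_cnj: "f \<in> C0 \<Longrightarrow> (\<lambda>x. cnj (f x)) \<in> C0"
  by (rule C0_dominated[where c = 1]) (auto simp: C0_def intro: continuous_intros)

lemma C0_mult_bounded:
  assumes "f \<in> C0" "continuous_on UNIV f'" "bounded (range f')"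
  shows "(\<lambda>x. f' x * f x) \<in> C0"
proof -
  obtain C where C: "\<And>x. cmod (f' x) \<le> C" using assms(3) by (auto simp: bounded_iff)
  show ?thesis
    by (rule C0_dominated[OF assms(1), where c = C])
       (use assms C in \<open>auto simp: C0_def norm_mult mult_right_mono intro: continuous_intros\<close>)
qed

lemma C0_mult_C0: "f \<in> C0 \<Longrightarrow> f' \<in> C0 \<Longrightarrow> (\<lambda>x. f x * f' x) \<in> C0"
  using C0_mult_bounded[of f' f] by (auto simp: C0_bounded_range) (auto simp: C0_def)

lemma continuous_indicator_clopen:
  assumes "open A" "closed A" shows "continuous_on UNIV (indicator A :: 'x \<Rightarrow> complex)"
proof -
  have "continuous_on (A \<union> - A) (\<lambda>x. if x \<in> A then 1 else 0 :: complex)"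
    using assms by (intro continuous_on_cases) (auto intro: continuous_intros)
  then show ?thesis by (simp add: indicator_def[abs_def] of_bool_def)
qed

text \<open>The coefficients that \<open>u_g\<close> may have in the corner: \<open>f\<close> lives
  on the ranges \<open>gx\<close> of the arrows \<open>(g, x)\<close> of the groupoid.\<close>

definition slice :: "'g \<Rightarrow> ('x \<Rightarrow> complex) set"
  where "slice g = {f \<in> C0. \<forall>x. f x \<noteq> 0 \<longrightarrow> x \<in> Y \<and> act (- g) x \<in> Y}"

lemma slice_C0: "f \<in> slice g \<Longrightarrow> f \<in> C0"
  and slice_bounded: "f \<in> slice g \<Longrightarrow> bounded (range f)"
  and slice_zero: "f \<in> slice g \<Longrightarrow> x \<notin> Y \<Longrightarrow> f x = 0"
  and slice_zero': "f \<in> slice g \<Longrightarrow> act (- g) x \<notin> Y \<Longrightarrow> f x = 0"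
  by (auto simp: slice_def C0_bounded_range)

text \<open>The projection onto \<open>Y\<close>. It belongs to the crossed product only if
  \<open>Y\<close> is compact and otherwise acts as a multiplier.\<close>

definition cutdown :: "('g \<times> 'x) op"
  where "cutdown = fun_op act (indicator Y)"

lemma cutdown_eq: "cutdown = monomial act (indicator Y) 0"
  by (simp add: cutdown_def fun_op_eq_monomial)

lemma cutdown_monomial_cutdown:
  assumes "bounded (range f)"
  shows "cutdown o\<^sub>L monomial act f g o\<^sub>L cutdown = monomial act (\<lambda>x. indicator Y x * f x * indicator Y (act (- g) x)) g"
  unfolding cutdown_eq
  using assms by (simp add: monomial_mult bounded_range_indicator bounded_range_mult[of _ _ "\<lambda>x. x"] act_0)

lemma cutdown_slice:
  assumes "f \<in> C0" shows "(\<lambda>x. indicator Y x * f x * indicator Y (act (- g) x)) \<in> slice g"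
proof -
  have *: "(\<lambda>x. indicator Y (act (- g) x) * (indicator Y x * f x)) \<in> C0"
    using continuous_indicator_clopen[OF open_Y closed_Y] assms act_cont[of "- g"]
    by (intro C0_mult_bounded bounded_range_indicator continuous_on_compose2[OF _ act_cont])
       (auto simp: bounded_iff indicator_def intro!: exI[of _ 1])
  show ?thesis unfolding slice_def using * by (auto simp: mult_ac indicator_def)
qed

lemma cutdown_slice_eq: "f \<in> slice g \<Longrightarrow> (\<lambda>x. indicator Y x * f x * indicator Y (act (- g) x)) = f"
  by (rule ext) (auto simp: indicator_def slice_zero slice_zero')

definition monomials :: "('g \<times> 'x) op set"
  where "monomials = {monomial act f g | f g. f \<in> C0}"

definition corner_monomials :: "('g \<times> 'x) op set"
  where "corner_monomials = {monomial act f g | f g. f \<in> slice g}"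

lemma crossed_product_eq: "crossed_product act = closure (span monomials)"
  by (simp add: crossed_product_def monomials_def monomial_def)

text \<open>Cutting down by the projection is continuous and linear, sends monomials to corner
  monomials and fixes the latter. So its image on the crossed product is exactly their closed span,
  and in particular closed.\<close>

lemma corner_eq: "corner act Y = closure (span corner_monomials)"
proof
  have gens: "(\<lambda>a. cutdown o\<^sub>L a o\<^sub>L cutdown) ` monomials \<subseteq> corner_monomials"
    unfolding monomials_def corner_monomials_def
    using cutdown_slice by (fastforce simp: cutdown_monomial_cutdown C0_bounded_range)
  have "(\<lambda>a. cutdown o\<^sub>L a o\<^sub>L cutdown) ` span monomials = span ((\<lambda>a. cutdown o\<^sub>L a o\<^sub>L cutdown) ` monomials)"
    by (rule linear_span_image[symmetric], rule linearI)
       (simp_all add: blinfun_compose_add_left blinfun_compose_add_right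
          blinfun_compose_scaleR_left blinfun_compose_scaleR_right)
  also have "\<dots> \<subseteq> closure (span corner_monomials)"
    using span_mono[OF gens] closure_subset by blast
  finally have "(\<lambda>a. cutdown o\<^sub>L a o\<^sub>L cutdown) ` closure (span monomials) \<subseteq> closure (span corner_monomials)"
    by (intro image_closure_subset) (auto intro!: continuous_intros)
  then show "corner act Y \<subseteq> closure (span corner_monomials)"
    by (auto simp: corner_def cutdown_def[symmetric] crossed_product_eq)
  have closed: "closed {a. cutdown o\<^sub>L a o\<^sub>L cutdown = a}"
    by (intro closed_Collect_eq continuous_intros)
  have subsp: "subspace {a. cutdown o\<^sub>L a o\<^sub>L cutdown = a}"
    by (simp add: subspace_def blinfun_compose_add_left blinfun_compose_add_right
          blinfun_compose_scaleR_left blinfun_compose_scaleR_right)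
  have "corner_monomials \<subseteq> {a. cutdown o\<^sub>L a o\<^sub>L cutdown = a}"
    unfolding corner_monomials_def by (auto simp: cutdown_monomial_cutdown slice_bounded cutdown_slice_eq)
  then have "closure (span corner_monomials) \<subseteq> {a. cutdown o\<^sub>L a o\<^sub>L cutdown = a}"
    by (intro closure_minimal span_minimal closed subsp)
  moreover have "closure (span corner_monomials) \<subseteq> crossed_product act"
    unfolding crossed_product_eq
    by (intro closure_mono span_mono) (auto simp: corner_monomials_def monomials_def slice_C0)
  ultimately show "closure (span corner_monomials) \<subseteq> corner act Y"
    unfolding corner_def cutdown_def[symmetric] by (force simp: image_iff)
qed

lemma corner_subset_crossed: "corner act Y \<subseteq> crossed_product act"
  unfolding corner_eq crossed_product_eq
  by (intro closure_mono span_mono) (auto simp: corner_monomials_def monomials_def slice_C0)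

lemma closed_corner: "closed (corner act Y)"
  by (simp add: corner_eq)

lemma subspace_corner: "subspace (corner act Y)"
  unfolding corner_eq by (intro subspace_closure subspace_span)

lemma corner_induct:
  assumes "a \<in> corner act Y" and closed: "closed {a. P a}" and subsp: "subspace {a. P a}"
    and gen: "\<And>f g. f \<in> slice g \<Longrightarrow> P (monomial act f g)"
  shows "P a"
proof -
  have "closure (span corner_monomials) \<subseteq> {a. P a}"
    by (intro closure_minimal span_minimal closed subsp) (auto simp: corner_monomials_def gen)
  then show ?thesis using assms(1) by (auto simp: corner_eq)
qed

lemma monomial_corner: "f \<in> slice g \<Longrightarrow> monomial act f g \<in> corner act Y"
  unfolding corner_eq corner_monomials_def
  by (intro closure_subset[THEN subsetD] span_base) blast

lemma corner_complex_linear: "a \<in> corner act Y \<Longrightarrow> complex_linear a"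
  by (erule corner_induct) (auto intro: closed_complex_linear subspace_complex_linear
      complex_linear_monomial slice_bounded)

lemma slice_scale: "f \<in> slice g \<Longrightarrow> (\<lambda>x. c * f x) \<in> slice g"
  unfolding slice_def using C0_mult by fastforce

lemma slice_mult:
  assumes "f \<in> slice g" "f' \<in> slice g'" shows "(\<lambda>x. f x * f' (act (- g) x)) \<in> slice (g + g')"
proof -
  have "(\<lambda>x. f x * f' (act (- g) x)) \<in> C0"
    by (intro C0_mult_C0 C0_compose_act slice_C0[OF assms(1)] slice_C0[OF assms(2)])
  moreover have "act (- (g + g')) x = act (- g') (act (- g) x)" for x
    by (simp only: minus_add act_add)
  ultimately show ?thesis using assms by (auto simp: slice_def)
qed

lemma slice_adj:
  assumes "f \<in> slice g" shows "(\<lambda>x. cnj (f (act g x))) \<in> slice (- g)"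
  using C0_cnj[OF C0_compose_act[OF slice_C0[OF assms], of g]] assms by (auto simp: slice_def)

lemma corner_scaleC:
  assumes "a \<in> corner act Y" shows "scaleC_op c a \<in> corner act Y"
  using assms
proof (rule corner_induct)
  have "continuous_on UNIV (\<lambda>a :: ('g \<times> 'x) op. scaleC_op c a)"
    unfolding scaleC_op_def by (intro continuous_intros)
  then show "closed {a. scaleC_op c a \<in> corner act Y}"
    using closed_corner by (simp add: closed_vimage[of "corner act Y" "scaleC_op c", unfolded vimage_def])
  show "subspace {a. scaleC_op c a \<in> corner act Y}"
    using subspace_corner by (auto simp: subspace_def scaleC_op_add scaleC_op_scaleR)
  fix f g assume f: "f \<in> slice g"
  show "scaleC_op c (monomial act f g) \<in> corner act Y"
    using monomial_corner[OF slice_scale[OF f]] monomial_scaleC[OF slice_bounded[OF f]] by metis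
qed

lemma corner_mult:
  assumes a: "a \<in> corner act Y" and b: "b \<in> corner act Y" shows "a o\<^sub>L b \<in> corner act Y"
  using a
proof (rule corner_induct)
  show "closed {a. a o\<^sub>L b \<in> corner act Y}"
    using closed_vimage[OF closed_corner, of "\<lambda>a. a o\<^sub>L b"] by (simp add: vimage_def continuous_intros)
  show "subspace {a. a o\<^sub>L b \<in> corner act Y}"
    using subspace_corner by (auto simp: subspace_def blinfun_compose_add_left blinfun_compose_scaleR_left)
  fix f g assume f: "f \<in> slice g"
  show "monomial act f g o\<^sub>L b \<in> corner act Y"
    using b
  proof (rule corner_induct)
    show "closed {b. monomial act f g o\<^sub>L b \<in> corner act Y}"
      using closed_vimage[OF closed_corner linear_continuous_on[OF
          bounded_bilinear.bounded_linear_right[OF bounded_bilinear_blinfun_compose]]]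
      by (simp add: vimage_def)
    show "subspace {b. monomial act f g o\<^sub>L b \<in> corner act Y}"
      using subspace_corner by (auto simp: subspace_def blinfun_compose_add_right blinfun_compose_scaleR_right)
    fix f' g' assume f': "f' \<in> slice g'"
    show "monomial act f g o\<^sub>L monomial act f' g' \<in> corner act Y"
      using monomial_corner[OF slice_mult[OF f f']] f f' by (simp add: monomial_mult slice_bounded)
  qed
qed

text \<open>Adjoints are explicit on the span of the monomials, and \<open>is_adj_limit\<close>
  carries them to the closure.\<close>

lemma corner_adj:
  assumes "a \<in> corner act Y" obtains b where "b \<in> corner act Y" "is_adj a b"
proof -
  have span: "\<exists>b\<in>corner act Y. is_adj a b" if "a \<in> span corner_monomials" for a
    using that
  proof (induction rule: span_induct_alt)
    case base
    then show ?case
      using subspace_0[OF subspace_corner] by (intro bexI[of _ 0]) (auto simp: is_adj_def cinner_conv_inner)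
  next
    case (step c x y)
    then obtain b where b: "b \<in> corner act Y" "is_adj y b" by blast
    obtain f g where f: "x = monomial act f g" "f \<in> slice g"
      using step(1) by (auto simp: corner_monomials_def)
    define b' where "b' = monomial act (\<lambda>x. cnj (f (act g x))) (- g)"
    have "is_adj x b'" "b' \<in> corner act Y"
      unfolding b'_def f(1) using f(2) by (auto intro: is_adj_monomial slice_bounded monomial_corner slice_adj)
    then show ?case
      using b subspace_corner
      by (intro bexI[of _ "c *\<^sub>R b' + b"] is_adj_add is_adj_scaleR) (auto simp: subspace_def)
  qed
  obtain s where s: "\<And>n. s n \<in> span corner_monomials" "s \<longlonglongrightarrow> a"
    using assms unfolding corner_eq closure_sequential by blast
  obtain t where t: "\<And>n. t n \<in> corner act Y" "\<And>n. is_adj (s n) (t n)"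
    using span[OF s(1)] by metis
  obtain b where b: "t \<longlonglongrightarrow> b" "is_adj a b" using is_adj_limit[OF t(2) s(2)] by blast
  then have "b \<in> corner act Y"
    using closed_sequentially[OF closed_corner] t(1) by blast
  then show ?thesis using b(2) by (rule that)
qed

end

section \<open>The conditional expectation and the dynamics\<close>

lemma continuous_on_coord: "continuous_on A f \<Longrightarrow> continuous_on A (\<lambda>x. coord (f x) i)"
  by (simp add: continuous_on_def tendsto_coord)

context transformation
begin

lemma subspace_crossed: "subspace (crossed_product act)"
  unfolding crossed_product_eq by (intro subspace_closure subspace_span)

text \<open>The vector functional at \<open>delta (0, x)\<close> satisfies the same axioms as
  \<open>E\<close>. Both are contractive and agree on monomials, hence on the closed span. The
  formula makes positivity and additivity of \<open>E\<close> immediate.\<close>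

lemma expectation_eq:
  assumes E: "canonical_expectation act E" and a: "a \<in> crossed_product act"
  shows "E a x = coord (a (delta (0, x))) (0, x)"
proof -
  define E' where "E' = (\<lambda>(a :: ('g \<times> 'x) op) x. coord (a (delta (0, x))) (0, x))"
  have E': "canonical_expectation act E'"
    using ex_canonical_expectation[of act] act_0 by (simp add: E'_def cinner_delta)
  have lin: "D (r *\<^sub>R a + b) x = of_real r * D a x + D b x" and bound: "cmod (D a x) \<le> norm a"
    if "canonical_expectation act D" "a \<in> crossed_product act" "b \<in> crossed_product act" for D r a b
  proof -
    have "r *\<^sub>R a \<in> crossed_product act" using that(2) subspace_crossed by (simp add: subspace_scale)
    then show "D (r *\<^sub>R a + b) x = of_real r * D a x + D b x"
      using that unfolding canonical_expectation_def by (simp flip: scaleC_op_of_real)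
    show "cmod (D a x) \<le> norm a" using that unfolding canonical_expectation_def by blast
  qed
  have zero: "0 \<in> crossed_product act" by (rule subspace_0[OF subspace_crossed])
  have mono: "monomials \<subseteq> crossed_product act"
    unfolding crossed_product_eq using closure_subset span_superset by blast
  have span_sub: "span monomials \<subseteq> crossed_product act"
    unfolding crossed_product_eq by (rule closure_subset)
  have span: "E b x = E' b x" if "b \<in> span monomials" for b
  proof -
    have "b \<in> crossed_product act \<and> E b x = E' b x"
      using that
    proof (induction rule: span_induct_alt)
      case base
      \<comment> \<open>Contractivity forces both values at the zero operator to vanish.\<close>
      show ?case using bound[OF E zero zero] bound[OF E' zero zero] zero by simp
    next
      case (step c b d)
      obtain f g where f: "b = monomial act f g" "f \<in> C0" using step(1) by (auto simp: monomials_def)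
      have "E b = E' b" using E E' f by (simp add: canonical_expectation_def monomial_def)
      moreover have "b \<in> crossed_product act" using step(1) mono by auto
      ultimately show ?case
        using step(2) subspace_crossed by (simp add: lin[OF E] lin[OF E'] subspace_add subspace_scale)
    qed
    then show ?thesis ..
  qed
  obtain s where s: "\<And>n. s n \<in> span monomials" "s \<longlonglongrightarrow> a"
    using a unfolding crossed_product_eq closure_sequential by blast
  have lim: "(\<lambda>n. D (s n) x) \<longlonglongrightarrow> D a x" if D: "canonical_expectation act D" for D
  proof (rule LIM_zero_cancel, rule Lim_null_comparison)
    show "(\<lambda>n. norm (s n - a)) \<longlonglongrightarrow> 0" using s(2) by (simp add: LIM_zero_iff tendsto_norm_zero)
    have "norm (D (s n) x - D a x) \<le> norm (s n - a)" for n
    proof -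
      have sn: "s n \<in> crossed_product act" using s(1) span_sub by auto
      then have "s n - a \<in> crossed_product act" using a by (intro subspace_diff[OF subspace_crossed])
      moreover have "D (- 1 *\<^sub>R a + s n) x = - D a x + D (s n) x"
        using lin[OF D a sn, of "- 1"] by simp
      ultimately show ?thesis using bound[OF D, of "s n - a"] a by simp
    qed
    then show "\<forall>\<^sub>F n in sequentially. norm (D (s n) x - D a x) \<le> norm (s n - a)" by simp
  qed
  have "E a x = E' a x"
    using LIMSEQ_unique[OF lim[OF E]] lim[OF E'] span[OF s(1)] by simp
  then show ?thesis by (simp add: E'_def)
qed

text \<open>Since \<open>E a\<close> is thus supported in \<open>Y\<close>, it can be integrated
  against measures of infinite total mass.\<close>

lemma corner_expectation_zero:
  assumes "a \<in> corner act Y" "x \<notin> Y" shows "coord (a (delta (0, x))) (0, x) = 0"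
  using assms(1)
proof (rule corner_induct)
  show "closed {a :: ('g \<times> 'x) op. coord (a (delta (0, x))) (0, x) = 0}"
    by (intro closed_Collect_eq continuous_on_coord continuous_intros)
  show "subspace {a :: ('g \<times> 'x) op. coord (a (delta (0, x))) (0, x) = 0}"
    by (auto simp: subspace_def blinfun.add_left blinfun.scaleR_left)
  fix f g assume f: "f \<in> slice g"
  show "coord (monomial act f g (delta (0, x))) (0, x) = 0"
    using slice_zero[OF f assms(2)] by (simp add: coord_monomial[OF slice_bounded[OF f]] act_0)
qed

lemma slice_approx:
  assumes f: "f \<in> slice g" and "\<epsilon> > 0"
  obtains f' K where "f' \<in> slice g" "compact K" "\<And>x. x \<notin> K \<Longrightarrow> f' x = 0" "\<And>x. cmod (f x - f' x) \<le> \<epsilon>"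
proof -
  \<comment> \<open>Soft thresholding: the modulus is lowered by \<epsilon> and cut at 0, the
    argument is kept. Zeros of \<open>f\<close> stay zeros, so \<open>f'\<close> remains in the
    slice.\<close>
  define f' where "f' x = f x * of_real (1 - \<epsilon> / max \<epsilon> (cmod (f x)))" for x
  have max_pos: "max \<epsilon> (cmod (f x)) > 0" for x using \<open>\<epsilon> > 0\<close> by simp
  have factor: "0 \<le> 1 - \<epsilon> / max \<epsilon> (cmod (f x))" "1 - \<epsilon> / max \<epsilon> (cmod (f x)) \<le> 1" for x
    using max_pos[of x] \<open>\<epsilon> > 0\<close> by (auto simp: field_simps)
  have f_C0: "f \<in> C0" by (rule slice_C0[OF f])
  then have cont: "continuous_on UNIV f" by (simp add: C0_def)
  have "continuous_on UNIV f'"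
    unfolding f'_def using max_pos \<open>\<epsilon> > 0\<close>
    by (intro continuous_intros continuous_on_max cont) (metis less_irrefl)
  then have "f' \<in> C0"
    by (rule C0_dominated[OF f_C0, where c = 1])
       (use factor in \<open>simp add: f'_def norm_mult mult_left_le del: of_real_diff\<close>)
  then have "f' \<in> slice g" using f by (auto simp: slice_def f'_def)
  moreover obtain K where K: "compact K" "\<And>x. x \<notin> K \<Longrightarrow> cmod (f x) < \<epsilon>"
    using f_C0 \<open>\<epsilon> > 0\<close> unfolding C0_def by blast
  have "f' x = 0" if "x \<notin> K" for x
    using K(2)[OF that] \<open>\<epsilon> > 0\<close> by (simp add: f'_def max_absorb1 less_imp_le)
  moreover note K(1)
  moreover have "cmod (f x - f' x) \<le> \<epsilon>" for x
  proof -
    have "f x - f' x = f x * of_real (\<epsilon> / max \<epsilon> (cmod (f x)))" by (simp add: f'_def algebra_simps)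
    then have "cmod (f x - f' x) = cmod (f x) * (\<epsilon> / max \<epsilon> (cmod (f x)))"
      using \<open>\<epsilon> > 0\<close> max_pos[of x] by (simp add: norm_mult del: of_real_divide)
    also have "\<dots> \<le> \<epsilon>" using max_pos[of x] \<open>\<epsilon> > 0\<close> by (simp add: field_simps)
    finally show ?thesis .
  qed
  ultimately show ?thesis using that by blast
qed

text \<open>The projection of a compact set to the discrete group is compact, hence finite.\<close>

lemma Cc_finite_support:
  assumes "F \<in> Cc act Y" shows "finite {g. \<exists>x. F (g, x) \<noteq> 0}"
proof -
  obtain K where K: "compactin (groupoid_top act Y) K" "\<And>p. p \<notin> K \<Longrightarrow> F p = 0"
    using assms by (auto simp: Cc_def)
  have "compactin (prod_topology (discrete_topology UNIV) euclidean) K"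
    using K(1) by (simp add: groupoid_top_def compactin_subtopology)
  from image_compactin[OF this continuous_map_fst] have "finite (fst ` K)"
    by (simp add: compactin_discrete_topology)
  moreover have "{g. \<exists>x. F (g, x) \<noteq> 0} \<subseteq> fst ` K" using K(2) by force
  ultimately show ?thesis by (rule finite_subset[rotated])
qed

lemma Cc_slice_bounded: "F \<in> Cc act Y \<Longrightarrow> bounded (range (\<lambda>y. F (g, act (- g) y)))"
  by (rule Cc_bounded[of F act Y]) (auto simp: bounded_iff)

text \<open>A larger index set allows two functions with different supports to be added over a
  common finite set.\<close>

lemma Cc_op_eq_sum:
  assumes F: "F \<in> Cc act Y" and "finite T" "{g. \<exists>x. F (g, x) \<noteq> 0} \<subseteq> T"
  shows "Cc_op act F = (\<Sum>g\<in>T. monomial act (\<lambda>y. F (g, act (- g) y)) g)"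
proof -
  have zero: "monomial act (\<lambda>y. F (g, act (- g) y)) g = 0" if "g \<in> T - {g. \<exists>x. F (g, x) \<noteq> 0}" for g
  proof -
    have "(\<lambda>y. F (g, act (- g) y)) = (\<lambda>_. 0)" using that by auto
    then show ?thesis by (simp add: monomial_zero)
  qed
  show ?thesis
    unfolding Cc_op_def monomial_def[symmetric]
    by (rule sum.mono_neutral_left) (use assms zero in auto)
qed

lemma Cc_add:
  assumes "F \<in> Cc act Y" "F' \<in> Cc act Y"
  shows "(\<lambda>p. F p + F' p) \<in> Cc act Y" "Cc_op act (\<lambda>p. F p + F' p) = Cc_op act F + Cc_op act F'"
proof -
  obtain K K' where K: "compactin (groupoid_top act Y) K" "\<And>p. p \<notin> K \<Longrightarrow> F p = 0"
    "compactin (groupoid_top act Y) K'" "\<And>p. p \<notin> K' \<Longrightarrow> F' p = 0"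
    using assms by (auto simp: Cc_def)
  show 1: "(\<lambda>p. F p + F' p) \<in> Cc act Y"
    unfolding Cc_def
  proof (intro CollectI conjI exI[of _ "K \<union> K'"] allI impI)
    show "continuous_map (groupoid_top act Y) euclidean (\<lambda>p. F p + F' p)"
      using assms by (intro continuous_map_add) (auto simp: Cc_def)
    show "F p + F' p = 0" if "p \<notin> K \<union> K'" for p using K(2,4)[of p] that by simp
  qed (rule compactin_Un[OF K(1,3)])
  define T where "T = {g. \<exists>x. F (g, x) \<noteq> 0} \<union> {g. \<exists>x. F' (g, x) \<noteq> 0}"
  have T: "finite T" using assms by (simp add: T_def Cc_finite_support)
  show "Cc_op act (\<lambda>p. F p + F' p) = Cc_op act F + Cc_op act F'"
    using assms 1 T
    by (subst (1 2 3) Cc_op_eq_sum[where T = T])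
       (auto simp: T_def sum.distrib[symmetric] monomial_add Cc_slice_bounded)
qed

lemma Cc_scale:
  assumes "F \<in> Cc act Y"
  shows "(\<lambda>p. c * F p) \<in> Cc act Y" "Cc_op act (\<lambda>p. c * F p) = scaleC_op c (Cc_op act F)"
proof -
  have "continuous_map euclidean euclidean (\<lambda>z :: complex. c * z)"
    by (auto intro: continuous_intros)
  then have "continuous_map (groupoid_top act Y) euclidean ((\<lambda>z. c * z) \<circ> F)"
    using assms by (intro continuous_map_compose[of _ euclidean]) (auto simp: Cc_def)
  then show 1: "(\<lambda>p. c * F p) \<in> Cc act Y"
    using assms unfolding Cc_def by (auto simp: o_def)
  define T where "T = {g. \<exists>x. F (g, x) \<noteq> 0}"
  have T: "finite T" using assms by (simp add: T_def Cc_finite_support)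
  have sum: "scaleC_op c (\<Sum>g\<in>S. m g) = (\<Sum>g\<in>S. scaleC_op c (m g))" for m and S :: "'g set"
    by (induction S rule: infinite_finite_induct) (auto simp: scaleC_op_add)
  show "Cc_op act (\<lambda>p. c * F p) = scaleC_op c (Cc_op act F)"
    using assms 1 T
    by (subst (1 2) Cc_op_eq_sum[where T = T])
       (auto simp: T_def sum monomial_scaleC Cc_slice_bounded)
qed

lemma monomial_Cc:
  assumes f: "f \<in> slice g" and K: "compact K" "\<And>x. x \<notin> K \<Longrightarrow> f x = 0"
  obtains F where "F \<in> Cc act Y" "Cc_op act F = monomial act f g"
proof -
  \<comment> \<open>Inverts the convention of \<open>Cc_op\<close>: the arrow \<open>(g, x)\<close>
    has range \<open>act g x\<close>, and that is where \<open>f\<close> is evaluated.\<close>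
  define F where "F = (\<lambda>(h, x). if h = g then f (act g x) else 0)"
  have cont: "continuous_on UNIV (\<lambda>x. f (act g x))"
    using C0_compose_act[OF slice_C0[OF f]] by (simp add: C0_def)
  have "continuous_map (prod_topology (discrete_topology UNIV) euclidean) euclidean F"
    unfolding continuous_map_def
  proof (safe)
    fix U :: "complex set" assume "openin euclidean U"
    then have "open U" by simp
    have "{p \<in> topspace (prod_topology (discrete_topology UNIV) euclidean). F p \<in> U} =
      ({g} \<times> ((\<lambda>x. f (act g x)) -` U)) \<union> ((UNIV - {g}) \<times> (if 0 \<in> U then UNIV else {}))"
      by (auto simp: F_def split: if_splits)
    moreover have "openin (prod_topology (discrete_topology UNIV) euclidean) ({g} \<times> ((\<lambda>x. f (act g x)) -` U))"
      using open_vimage[OF \<open>open U\<close> cont] by (simp add: openin_prod_Times_iff)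
    moreover have "openin (prod_topology (discrete_topology UNIV) euclidean)
        ((UNIV - {g}) \<times> (if 0 \<in> U then UNIV else {} :: 'x set))"
      by (auto simp: openin_prod_Times_iff)
    ultimately show "openin (prod_topology (discrete_topology UNIV) euclidean)
        {p \<in> topspace (prod_topology (discrete_topology UNIV) euclidean). F p \<in> U}"
      by (simp only: openin_Un)
  qed simp
  then have "continuous_map (groupoid_top act Y) euclidean F"
    unfolding groupoid_top_def by (rule continuous_map_from_subtopology)
  \<comment> \<open>Cutting with \<open>Y\<close> and its translate places the support in the
    groupoid; both sets are closed, so compactness survives.\<close>
  moreover have "compactin (groupoid_top act Y) ({g} \<times> (act (- g) ` (K \<inter> Y \<inter> act g ` Y)))"
  proof -
    have "compact (K \<inter> (Y \<inter> act g ` Y))"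
      using K(1) closed_Y closed_act_image[OF closed_Y] by (intro compact_Int_closed closed_Int)
    then have "compact (act (- g) ` (K \<inter> Y \<inter> act g ` Y))"
      by (intro compact_continuous_image continuous_on_subset[OF act_cont]) (auto simp: Int_assoc)
    then show ?thesis
      by (auto simp: groupoid_top_def compactin_subtopology compactin_Times act_image_mem)
  qed
  moreover have "F p = 0" if "p \<notin> {g} \<times> (act (- g) ` (K \<inter> Y \<inter> act g ` Y))" for p
    using that K(2) slice_zero[OF f] slice_zero'[OF f] 
    by (cases p) (auto simp: F_def act_image_mem)
  ultimately have F: "F \<in> Cc act Y" unfolding Cc_def by blast
  have "Cc_op act F = (\<Sum>h\<in>{g}. monomial act (\<lambda>y. F (h, act (- h) y)) h)"
    by (rule Cc_op_eq_sum[OF F]) (auto simp: F_def split: if_splits)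
  also have "\<dots> = monomial act f g" by (simp add: F_def)
  finally show ?thesis using F that by blast
qed

text \<open>The dynamics is prescribed on operators from \<open>Cc\<close> and continuous on the
  corner, so density determines it there. Coefficients without compact support are reached through
  \<open>slice_approx\<close>.\<close>

lemma corner_Cc_dense:
  assumes "a \<in> corner act Y"
  obtains F where "\<And>n :: nat. F n \<in> Cc act Y" "\<And>n. Cc_op act (F n) \<in> corner act Y"
    "(\<lambda>n. Cc_op act (F n)) \<longlonglongrightarrow> a"
proof -
  define D where "D = {a \<in> corner act Y. \<exists>F\<in>Cc act Y. a = Cc_op act F}"
  have "subspace D"
    unfolding subspace_def
  proof (intro conjI ballI allI)
    have 0: "(\<lambda>_. 0) \<in> Cc act Y" by (auto simp: Cc_def intro!: exI[of _ "{}"])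
    moreover have "Cc_op act (\<lambda>_. 0) = (0 :: ('g \<times> 'x) op)" by (simp add: Cc_op_def)
    ultimately show "0 \<in> D" using subspace_0[OF subspace_corner] unfolding D_def by force
  next
    fix x y assume "x \<in> D" "y \<in> D"
    then obtain F F' where F: "F \<in> Cc act Y" "x = Cc_op act F" "F' \<in> Cc act Y" "y = Cc_op act F'"
      "x \<in> corner act Y" "y \<in> corner act Y" by (auto simp: D_def)
    show "x + y \<in> D"
      unfolding D_def
    proof (intro CollectI conjI bexI)
      show "x + y \<in> corner act Y" by (rule subspace_add[OF subspace_corner F(5,6)])
      show "x + y = Cc_op act (\<lambda>p. F p + F' p)" unfolding F(2,4) by (rule Cc_add(2)[OF F(1,3), symmetric])
    qed (rule Cc_add(1)[OF F(1,3)])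
  next
    fix c x assume "x \<in> D"
    then obtain F where F: "F \<in> Cc act Y" "x = Cc_op act F" "x \<in> corner act Y" by (auto simp: D_def)
    show "c *\<^sub>R x \<in> D"
      unfolding D_def
    proof (intro CollectI conjI bexI)
      show "c *\<^sub>R x \<in> corner act Y" by (rule subspace_scale[OF subspace_corner F(3)])
      show "c *\<^sub>R x = Cc_op act (\<lambda>p. of_real c * F p)"
        unfolding F(2) Cc_scale(2)[OF F(1)] by (rule scaleC_op_of_real[symmetric])
    qed (rule Cc_scale(1)[OF F(1)])
  qed
  moreover have "corner_monomials \<subseteq> closure D"
  proof
    fix m assume "m \<in> corner_monomials"
    then obtain f g where f: "m = monomial act f g" "f \<in> slice g" by (auto simp: corner_monomials_def)
    show "m \<in> closure D"
      unfolding closure_approachable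
    proof (intro allI impI)
      fix e :: real assume "e > 0"
      obtain f' K where f': "f' \<in> slice g" "compact K" "\<And>x. x \<notin> K \<Longrightarrow> f' x = 0"
          "\<And>x. cmod (f x - f' x) \<le> e / 2"
        using slice_approx[OF f(2), of "e / 2"] \<open>e > 0\<close> by (metis half_gt_zero)
      have eq: "monomial act (\<lambda>x. f' x + - 1 * f x) g = monomial act f' g + scaleC_op (- 1) (monomial act f g)"
        using f(2) f'(1) slice_scale[OF f(2), of "- 1"]
        by (subst monomial_add) (auto simp: slice_bounded monomial_scaleC[symmetric])
      have "norm (monomial act (\<lambda>x. f' x + - 1 * f x) g) \<le> e / 2"
        by (rule norm_monomial_le) (use f'(4) in \<open>simp add: norm_minus_commute\<close>)
      then have "dist (monomial act f' g) m \<le> e / 2"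
        unfolding eq dist_norm f(1) using scaleC_op_of_real[of "- 1" "monomial act f g"] by simp
      moreover have "monomial act f' g \<in> D"
      proof -
        obtain F where "F \<in> Cc act Y" "Cc_op act F = monomial act f' g"
          using monomial_Cc[OF f'(1-3)] .
        with monomial_corner[OF f'(1)] show ?thesis
          unfolding D_def by (intro CollectI conjI bexI[of _ F]) simp_all
      qed
      ultimately show "\<exists>y\<in>D. dist y m < e" using \<open>e > 0\<close> by (intro bexI[of _ "monomial act f' g"]) auto
    qed
  qed
  ultimately have "closure (span corner_monomials) \<subseteq> closure D"
    by (intro closure_minimal span_minimal subspace_closure closed_closure)
  then have "a \<in> closure D" using assms by (auto simp: corner_eq)
  then obtain s where s: "\<And>n. s n \<in> D" "s \<longlonglongrightarrow> a" unfolding closure_sequential by blast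
  then obtain F where F: "\<And>n. F n \<in> Cc act Y" "\<And>n. s n = Cc_op act (F n)"
    unfolding D_def by simp metis
  then have "s = (\<lambda>n. Cc_op act (F n))" by auto
  with s F(1) show ?thesis unfolding D_def by (intro that[of F]) auto
qed

end

section \<open>The dynamics as conjugation by unitaries\<close>

locale dynamics = transformation act Y
  for act :: "'g::group_add \<Rightarrow> 'x::{second_countable_topology, t2_space} \<Rightarrow> 'x" and Y +
  fixes N :: "'g \<Rightarrow> real"
  assumes N_pos: "N g > 0" and N_add: "N (g + h) = N g * N h"
begin

definition log_N :: "'g \<Rightarrow> real" where "log_N g = ln (N g)"

lemma log_N_add: "log_N (g + h) = log_N g + log_N h"
  using N_pos[of g] N_pos[of h] by (simp add: log_N_def N_add ln_mult)

lemma log_N_zero [simp]: "log_N 0 = 0"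
  using log_N_add[of 0 0] by simp

lemma log_N_uminus: "log_N (- g) = - log_N g"
  using log_N_add[of g "- g"] by simp

lemma N_powr: "N g powr b = exp (b * log_N g)"
  using N_pos[of g] by (simp add: powr_def log_N_def)

lemma N_powr_imaginary: "complex_of_real (N g) powr (\<i> * complex_of_real t) = cis (t * log_N g)"
  using N_pos[of g] by (simp add: powr_def log_N_def Ln_of_real cis_conv_exp mult_ac)

definition phase_op :: "real \<Rightarrow> ('g \<times> 'x) op"
  where "phase_op t = diag_op (\<lambda>(h, x). cis (t * log_N h))"

text \<open>A formula for \<sigma>_t that makes sense on all operators; it is multiplicative,
  continuous and does not increase norms.\<close>

definition conj_phase :: "real \<Rightarrow> ('g \<times> 'x) op \<Rightarrow> ('g \<times> 'x) op"
  where "conj_phase t a = phase_op t o\<^sub>L a o\<^sub>L phase_op (- t)"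

lemma coord_phase_op: "coord (phase_op t \<xi>) (h, x) = cis (t * log_N h) * coord \<xi> (h, x)"
  unfolding phase_op_def by (subst coord_diag_op[where C = 1]) (auto simp: norm_cis)

lemma norm_phase_op: "norm (phase_op t) \<le> 1"
  unfolding phase_op_def by (rule norm_diag_op_le) (auto simp: norm_cis)

lemma phase_op_compose: "phase_op s o\<^sub>L phase_op t = phase_op (s + t)"
  by (intro blinfun_eqI ell2_eqI, clarify) (simp add: coord_phase_op cis_mult[symmetric] distrib_right)

lemma phase_op_zero: "phase_op 0 = id_blinfun"
  by (intro blinfun_eqI ell2_eqI, clarify) (simp add: coord_phase_op)

lemma id_blinfun_compose [simp]: "id_blinfun o\<^sub>L a = a" "a o\<^sub>L id_blinfun = a"
  by (simp_all add: blinfun_eqI)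

lemma conj_phase_add: "conj_phase t (a + b) = conj_phase t a + conj_phase t b"
  by (simp add: conj_phase_def blinfun_compose_add_left blinfun_compose_add_right)

lemma conj_phase_null: "conj_phase t 0 = 0"
  by (simp add: conj_phase_def)

lemma conj_phase_scaleR: "conj_phase t (r *\<^sub>R a) = r *\<^sub>R conj_phase t a"
  by (simp add: conj_phase_def blinfun_compose_scaleR_left blinfun_compose_scaleR_right)

lemma conj_phase_mult: "conj_phase t (a o\<^sub>L b) = conj_phase t a o\<^sub>L conj_phase t b"
proof -
  have "conj_phase t a o\<^sub>L conj_phase t b = phase_op t o\<^sub>L (a o\<^sub>L ((phase_op (- t) o\<^sub>L phase_op t) o\<^sub>L (b o\<^sub>L phase_op (- t))))"
    by (simp add: conj_phase_def blinfun_compose_assoc)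
  then show ?thesis by (simp add: phase_op_compose phase_op_zero conj_phase_def blinfun_compose_assoc)
qed

lemma conj_phase_conj_phase: "conj_phase s (conj_phase t a) = conj_phase (s + t) a"
proof -
  have "conj_phase s (conj_phase t a) = (phase_op s o\<^sub>L phase_op t) o\<^sub>L (a o\<^sub>L (phase_op (- t) o\<^sub>L phase_op (- s)))"
    by (simp add: conj_phase_def blinfun_compose_assoc)
  then show ?thesis by (simp add: phase_op_compose conj_phase_def blinfun_compose_assoc add.commute)
qed

lemma conj_phase_zero: "conj_phase 0 a = a"
  by (simp add: conj_phase_def phase_op_zero)

lemma norm_conj_phase_le: "norm (conj_phase t a) \<le> norm a"
proof -
  have "norm (conj_phase t a) \<le> norm (phase_op t o\<^sub>L a) * norm (phase_op (- t))"
    unfolding conj_phase_def by (rule norm_blinfun_compose)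
  also have "\<dots> \<le> (norm (phase_op t) * norm a) * norm (phase_op (- t))"
    by (intro mult_right_mono norm_blinfun_compose) simp
  also have "\<dots> \<le> (1 * norm a) * 1"
    by (intro mult_mono norm_phase_op) auto
  finally show ?thesis by simp
qed

lemma continuous_conj_phase: "continuous_on A (conj_phase t)"
  unfolding conj_phase_def by (intro continuous_intros)

text \<open>Monomials are eigenvectors: \<open>u_g\<close> shifts the group coordinate by
  \<open>g\<close>, and \<open>log_N\<close> is additive, so the phases before and after differ by
  the one of \<open>g\<close>.\<close>

lemma conj_phase_monomial:
  assumes "bounded (range f)"
  shows "conj_phase t (monomial act f g) = scaleC_op (cis (t * log_N g)) (monomial act f g)"
proof (intro blinfun_eqI ell2_eqI, clarify)
  fix \<xi> h x
  have "cis (t * log_N h) * cis (- t * log_N (- g + h)) = cis (t * log_N g)"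
    by (simp add: cis_mult log_N_add log_N_uminus algebra_simps)
  then have "cis (t * log_N h) * (z * (cis (- t * log_N (- g + h)) * w)) = cis (t * log_N g) * (z * w)" for z w
    by (metis mult.assoc mult.left_commute)
  then show "coord (conj_phase t (monomial act f g) \<xi>) (h, x) =
      coord (scaleC_op (cis (t * log_N g)) (monomial act f g) \<xi>) (h, x)"
    by (simp add: conj_phase_def coord_phase_op coord_monomial[OF assms] coord_scaleC_op)
qed

lemma conj_phase_corner:
  assumes "a \<in> corner act Y" shows "conj_phase t a \<in> corner act Y"
  using assms
proof (rule corner_induct)
  show "closed {a. conj_phase t a \<in> corner act Y}"
    using closed_vimage[OF closed_corner continuous_conj_phase] by (simp add: vimage_def)
  show "subspace {a. conj_phase t a \<in> corner act Y}"
    using subspace_corner by (auto simp: subspace_def conj_phase_add conj_phase_scaleR conj_phase_null)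
  fix f g assume "f \<in> slice g"
  then show "conj_phase t (monomial act f g) \<in> corner act Y"
    by (simp add: conj_phase_monomial slice_bounded corner_scaleC monomial_corner)
qed

text \<open>Both sides are continuous and agree on the dense set of operators from
  \<open>Cc\<close>. All later arguments work with the conjugation.\<close>

lemma dynamics_eq:
  assumes \<sigma>: "associated_dynamics act Y N \<sigma>" and a: "a \<in> corner act Y"
  shows "\<sigma> t a = conj_phase t a"
proof -
  obtain F where F: "\<And>n :: nat. F n \<in> Cc act Y" "\<And>n. Cc_op act (F n) \<in> corner act Y"
    "(\<lambda>n. Cc_op act (F n)) \<longlonglongrightarrow> a"
    using corner_Cc_dense[OF a] by blast
  have sum: "conj_phase t (\<Sum>g\<in>S. m g) = (\<Sum>g\<in>S. conj_phase t (m g))" for m and S :: "'g set"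
    by (induction S rule: infinite_finite_induct) (simp_all add: conj_phase_add conj_phase_null)
  have *: "\<sigma> t (Cc_op act F) = conj_phase t (Cc_op act F)" if "F \<in> Cc act Y" for F
  proof -
    have "\<sigma> t (Cc_op act F) = Cc_op act (\<lambda>(g, x). cis (t * log_N g) * F (g, x))"
      using \<sigma> that by (simp add: associated_dynamics_def N_powr_imaginary)
    also have "\<dots> = conj_phase t (Cc_op act F)"
      unfolding Cc_op_def sum monomial_def[symmetric]
      using that by (simp add: conj_phase_monomial Cc_slice_bounded monomial_scaleC)
    finally show ?thesis .
  qed
  have "(\<lambda>n. \<sigma> t (Cc_op act (F n))) \<longlonglongrightarrow> \<sigma> t a"
    using \<sigma> F(2,3) a unfolding associated_dynamics_def continuous_on_sequentially
    by (auto simp: o_def)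
  moreover have "(\<lambda>n. conj_phase t (Cc_op act (F n))) \<longlonglongrightarrow> conj_phase t a"
    unfolding conj_phase_def by (intro tendsto_intros F)
  ultimately show ?thesis using *[OF F(1)] LIMSEQ_unique by auto
qed

text \<open>On an eigenvector the orbit map is a scalar exponential times a fixed operator, so
  differentiability is that of \<open>exp\<close>.\<close>

lemma entire_extension_monomial:
  assumes \<sigma>: "associated_dynamics act Y N \<sigma>" and f: "f \<in> slice g"
  shows "entire_extension (corner act Y) \<sigma> (monomial act f g)
    (\<lambda>z. scaleC_op (exp (\<i> * z * of_real (log_N g))) (monomial act f g))"
  unfolding entire_extension_def
proof (intro conjI allI)
  show "range (\<lambda>z. scaleC_op (exp (\<i> * z * of_real (log_N g))) (monomial act f g)) \<subseteq> corner act Y"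
    using f by (auto intro: corner_scaleC monomial_corner)
  show "scaleC_op (exp (\<i> * complex_of_real t * complex_of_real (log_N g))) (monomial act f g) = \<sigma> t (monomial act f g)" for t
    using f by (simp add: dynamics_eq[OF \<sigma>] monomial_corner conj_phase_monomial slice_bounded cis_conv_exp mult.assoc)
  fix z
  define e where "e z = exp (\<i> * z * complex_of_real (log_N g))" for z
  have "(e has_field_derivative e z * (\<i> * complex_of_real (log_N g))) (at z)"
    unfolding e_def by (auto intro!: derivative_eq_intros simp: mult_ac)
  then have "((\<lambda>w. (e w - e z) / (w - z)) \<longlongrightarrow> e z * (\<i> * complex_of_real (log_N g))) (at z)"
    by (simp add: has_field_derivative_iff)
  then have lim: "((\<lambda>w. scaleC_op ((e w - e z) / (w - z)) (monomial act f g)) \<longlongrightarrow>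
      scaleC_op (e z * (\<i> * complex_of_real (log_N g))) (monomial act f g)) (at z)"
    by (intro tendsto_scaleC_op tendsto_const)
  have eq: "scaleC_op ((e w - e z) / (w - z)) a = scaleC_op (inverse (w - z)) (scaleC_op (e w) a - scaleC_op (e z) a)" for w a
    by (simp add: scaleC_op_diff_left[symmetric] divide_inverse mult.commute)
  have "((\<lambda>w. scaleC_op (inverse (w - z)) (scaleC_op (e w) (monomial act f g) - scaleC_op (e z) (monomial act f g))) \<longlongrightarrow>
      scaleC_op (e z * (\<i> * complex_of_real (log_N g))) (monomial act f g)) (at z)"
    using lim unfolding eq .
  then show "\<exists>D. ((\<lambda>w. scaleC_op (inverse (w - z)) (scaleC_op (exp (\<i> * w * complex_of_real (log_N g))) (monomial act f g) -
      scaleC_op (exp (\<i> * z * complex_of_real (log_N g))) (monomial act f g))) \<longlongrightarrow> D) (at z)"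
    unfolding e_def by (rule exI)
qed

end

section \<open>From measures to KMS states\<close>

locale kms_setting = dynamics act Y N
  for act :: "'g::group_add \<Rightarrow> 'x::{second_countable_topology, t2_space} \<Rightarrow> 'x" and Y N +
  fixes \<sigma> :: "real \<Rightarrow> ('g \<times> 'x) op \<Rightarrow> ('g \<times> 'x) op" and E :: "('g \<times> 'x) op \<Rightarrow> 'x \<Rightarrow> complex" and \<beta> :: real
  assumes countable_group: "countable (UNIV :: 'g set)"
    and cover: "(\<Union>g. act g ` Y) = UNIV"
    and \<sigma>: "associated_dynamics act Y N \<sigma>"
    and E: "canonical_expectation act E"
begin

lemma corner_E_eq: "a \<in> corner act Y \<Longrightarrow> E a x = coord (a (delta (0, x))) (0, x)"
  using expectation_eq[OF E] corner_subset_crossed by blast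

lemma corner_E_C0: "a \<in> corner act Y \<Longrightarrow> E a \<in> C0"
  and corner_E_bound: "a \<in> corner act Y \<Longrightarrow> cmod (E a x) \<le> norm a"
  using E corner_subset_crossed unfolding canonical_expectation_def by blast+

lemma corner_E_zero: "a \<in> corner act Y \<Longrightarrow> x \<notin> Y \<Longrightarrow> E a x = 0"
  by (simp add: corner_E_eq corner_expectation_zero)

lemma corner_E_add: "a \<in> corner act Y \<Longrightarrow> b \<in> corner act Y \<Longrightarrow> E (a + b) x = E a x + E b x"
  using subspace_add[OF subspace_corner] by (simp add: corner_E_eq blinfun.add_left)

lemma corner_E_scaleC: "a \<in> corner act Y \<Longrightarrow> E (scaleC_op c a) x = c * E a x"
  by (simp add: corner_E_eq corner_scaleC coord_scaleC_op)

lemma E_monomial: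
  assumes "f \<in> C0" shows "E (monomial act f g) = (if g = 0 then f else (\<lambda>_. 0))"
  using E assms unfolding canonical_expectation_def monomial_def by blast

lemma slice_0I: "f \<in> C0 \<Longrightarrow> (\<And>x. x \<notin> Y \<Longrightarrow> f x = 0) \<Longrightarrow> f \<in> slice 0"
  by (auto simp: slice_def act_0)

section \<open>A Borel partition into pieces of translates of Y\<close>

definition g_enum :: "nat \<Rightarrow> 'g" where "g_enum = from_nat_into UNIV"

text \<open>The \<open>n\<close>-th piece lies in the translate of \<open>Y\<close> by
  \<open>g_enum n\<close>, so the scaling condition reduces a measure on \<open>X\<close> to its
  values on subsets of \<open>Y\<close>. If the group is finite, the enumeration repeats and later
  pieces are empty.\<close>

definition piece :: "nat \<Rightarrow> 'x set" where "piece = disjointed (\<lambda>n. act (g_enum n) ` Y)"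

lemma piece_disjoint: "disjoint_family piece"
  unfolding piece_def by (rule disjoint_family_disjointed)

lemma piece_UN: "(\<Union>n. piece n) = UNIV"
proof -
  have "range g_enum = UNIV"
    unfolding g_enum_def by (rule range_from_nat_into) (use countable_group in auto)
  then have "(\<Union>g. act g ` Y) = (\<Union>g\<in>range g_enum. act g ` Y)" by simp
  also have "\<dots> = (\<Union>n. act (g_enum n) ` Y)" by blast
  finally show ?thesis using cover by (simp add: piece_def UN_disjointed_eq)
qed

lemma piece_subset: "piece n \<subseteq> act (g_enum n) ` Y"
  unfolding piece_def by (rule disjointed_subset)

lemma borel_Y: "Y \<in> sets borel"
  using open_Y by auto

lemma piece_borel: "piece n \<in> sets borel"
proof -
  have "range piece \<subseteq> sets borel"
    unfolding piece_def by (rule sets.range_disjointed_sets) (auto intro: borel_act_image borel_Y)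
  then show ?thesis by auto
qed

lemma piece_pull: "act (- g_enum n) ` (A \<inter> piece n) \<subseteq> Y"
  using piece_subset[of n] by (auto simp: act_image_mem)

section \<open>Integration against measures with the scaling condition\<close>

abbreviation "M \<equiv> kms_measures act Y N \<beta>"

lemma M_sets: "\<mu> \<in> M \<Longrightarrow> sets \<mu> = sets borel"
  and M_Y: "\<mu> \<in> M \<Longrightarrow> emeasure \<mu> Y = 1"
  and M_compact: "\<mu> \<in> M \<Longrightarrow> compact K \<Longrightarrow> emeasure \<mu> K < \<infinity>"
  and M_scaling: "\<mu> \<in> M \<Longrightarrow> A \<in> sets borel \<Longrightarrow> emeasure \<mu> (act g ` A) = ennreal (N g powr - \<beta>) * emeasure \<mu> A"
  by (auto simp: kms_measures_def radon_measure_def)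

text \<open>The total mass of \<mu> may be infinite while \<open>Y\<close> has mass 1, hence the
  condition on the support.\<close>

lemma M_integrable:
  fixes f :: "'x \<Rightarrow> 'b::{banach, second_countable_topology}"
  assumes "\<mu> \<in> M" "f \<in> borel_measurable borel" "\<And>x. norm (f x) \<le> C" "\<And>x. x \<notin> Y \<Longrightarrow> f x = 0"
  shows "integrable \<mu> f"
proof -
  have "integrable \<mu> (\<lambda>x. indicator Y x *\<^sub>R f x)"
  proof (rule integrableI_bounded_set_indicator)
    show "Y \<in> sets \<mu>" "f \<in> borel_measurable \<mu>"
      using assms(2) borel_Y M_sets[OF assms(1)] by (simp_all add: measurable_cong_sets[OF M_sets[OF assms(1)] refl])
    show "emeasure \<mu> Y < \<infinity>" using M_Y[OF assms(1)] by simp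
    show "AE x in \<mu>. x \<in> Y \<longrightarrow> norm (f x) \<le> C" using assms(3) by simp
  qed
  moreover have "(\<lambda>x. indicator Y x *\<^sub>R f x) = f" using assms(4) by (auto simp: indicator_def)
  ultimately show ?thesis by simp
qed

lemma borel_measurable_C0: "f \<in> C0 \<Longrightarrow> f \<in> borel_measurable borel"
  by (auto simp: C0_def intro: borel_measurable_continuous_onI)

lemma M_integrable_C0:
  fixes f :: "'x \<Rightarrow> complex"
  assumes "\<mu> \<in> M" "f \<in> C0" "\<And>x. x \<notin> Y \<Longrightarrow> f x = 0"
  shows "integrable \<mu> f"
proof -
  obtain C where "\<And>x. cmod (f x) \<le> C" using C0_bounded[OF assms(2)] by blast
  then show ?thesis using M_integrable[OF assms(1) borel_measurable_C0[OF assms(2)] _ assms(3)] by blast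
qed

lemma M_integral_bound:
  fixes f :: "'x \<Rightarrow> complex"
  assumes "\<mu> \<in> M" "f \<in> C0" "\<And>x. x \<notin> Y \<Longrightarrow> f x = 0" "\<And>x. cmod (f x) \<le> C"
  shows "cmod (integral\<^sup>L \<mu> f) \<le> C"
proof -
  have int: "integrable \<mu> f" using M_integrable_C0[OF assms(1-3)] by blast
  have ind: "integrable \<mu> (\<lambda>x. C * indicator Y x)"
    using borel_Y M_Y[OF assms(1)] M_sets[OF assms(1)] by simp
  have "cmod (integral\<^sup>L \<mu> f) \<le> (\<integral>x. cmod (f x) \<partial>\<mu>)" by (rule integral_norm_bound)
  also have "\<dots> \<le> (\<integral>x. C * indicator Y x \<partial>\<mu>)"
    using int ind assms(3,4) by (intro integral_mono) (auto simp: indicator_def)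
  also have "\<dots> = C"
    using borel_Y M_Y[OF assms(1)] M_sets[OF assms(1)] sets_eq_imp_space_eq[OF M_sets[OF assms(1)]]
    by (simp add: measure_def)
  finally show ?thesis .
qed

text \<open>Preimages under \<open>act (- g)\<close> are images under \<open>act g\<close>, so the
  scaling condition says that the image of \<mu> under \<open>act (- g)\<close> is a constant
  multiple of \<mu>.\<close>

lemma M_change_of_variables:
  fixes f :: "'x \<Rightarrow> complex"
  assumes \<mu>: "\<mu> \<in> M" and f: "f \<in> borel_measurable borel"
  shows "(\<integral>x. f (act (- g) x) \<partial>\<mu>) = of_real (N g powr - \<beta>) * integral\<^sup>L \<mu> f"
proof -
  note sets = M_sets[OF \<mu>] and space = sets_eq_imp_space_eq[OF M_sets[OF \<mu>]]
  have meas: "act (- g) \<in> \<mu> \<rightarrow>\<^sub>M borel"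
    using borel_act by (simp add: measurable_cong_sets[OF sets refl])
  have "distr \<mu> borel (act (- g)) = density \<mu> (\<lambda>_. ennreal (N g powr - \<beta>))"
  proof (rule measure_eqI)
    fix A assume "A \<in> sets (distr \<mu> borel (act (- g)))"
    then have A: "A \<in> sets borel" by simp
    have "emeasure (distr \<mu> borel (act (- g))) A = emeasure \<mu> (act g ` A)"
      using A meas space by (simp add: emeasure_distr act_image_eq_vimage)
    also have "\<dots> = emeasure (density \<mu> (\<lambda>_. ennreal (N g powr - \<beta>))) A"
      using A sets by (simp add: M_scaling[OF \<mu>] emeasure_density nn_integral_cmult_indicator)
    finally show "emeasure (distr \<mu> borel (act (- g))) A = emeasure (density \<mu> (\<lambda>_. ennreal (N g powr - \<beta>))) A" .
  qed (simp add: sets)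
  then have "integral\<^sup>L (distr \<mu> borel (act (- g))) f = integral\<^sup>L (density \<mu> (\<lambda>_. ennreal (N g powr - \<beta>))) f"
    by simp
  moreover have "f \<in> borel_measurable \<mu>" using f by (simp add: measurable_cong_sets[OF sets refl])
  ultimately show ?thesis
    using f meas by (simp add: integral_distr integral_density scaleR_conv_of_real)
qed

abbreviation "A \<equiv> corner act Y"

lemma state_of_measure_eq: "a \<in> A \<Longrightarrow> state_of_measure act Y E \<mu> a = integral\<^sup>L \<mu> (E a)"
  by (simp add: state_of_measure_def)

lemma E_integrable: "\<mu> \<in> M \<Longrightarrow> a \<in> A \<Longrightarrow> integrable \<mu> (E a)"
  by (rule M_integrable_C0) (auto intro: corner_E_C0 corner_E_zero)

lemma state_of_measure_bound: "\<mu> \<in> M \<Longrightarrow> a \<in> A \<Longrightarrow> cmod (state_of_measure act Y E \<mu> a) \<le> norm a"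
  unfolding state_of_measure_eq
  by (rule M_integral_bound) (auto intro: corner_E_C0 corner_E_zero corner_E_bound)

lemma ex_approx_unit:
  obtains f :: "nat \<Rightarrow> 'x \<Rightarrow> real" where "\<And>n. f n \<in> C0_real" "\<And>n x. 0 \<le> f n x" "\<And>n x. f n x \<le> 1"
    "\<And>n x. x \<notin> Y \<Longrightarrow> f n x = 0" "\<And>x. (\<lambda>n. f n x) \<longlonglongrightarrow> indicator Y x"
  using C0_real_approx_open[OF lc open_Y] by metis

lemma state_of_measure_state:
  assumes \<mu>: "\<mu> \<in> M" shows "is_state A (state_of_measure act Y E \<mu>)"
proof -
  let ?\<phi> = "state_of_measure act Y E \<mu>"
  let ?B = "{cmod (?\<phi> a) | a. a \<in> A \<and> norm a \<le> 1}"
  have zero: "0 \<in> A" by (rule subspace_0[OF subspace_corner])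
  have B_le: "x \<le> 1" if "x \<in> ?B" for x
    using that state_of_measure_bound[OF \<mu>] by force
  have bdd: "bdd_above ?B" using B_le by (rule bdd_aboveI)
  have "Sup ?B \<le> 1" using zero B_le by (intro cSup_least) force+
  \<comment> \<open>An approximate unit of functions on \<open>Y\<close> stands in for the
    indicator; dominated convergence brings its integrals to 1.\<close>
  moreover have "1 \<le> Sup ?B"
  proof -
    obtain f :: "nat \<Rightarrow> 'x \<Rightarrow> real" where f: "\<And>n. f n \<in> C0_real" "\<And>n x. 0 \<le> f n x" "\<And>n x. f n x \<le> 1"
      "\<And>n x. x \<notin> Y \<Longrightarrow> f n x = 0" "\<And>x. (\<lambda>n. f n x) \<longlonglongrightarrow> indicator Y x"
      using ex_approx_unit by blast
    define F where "F n = (\<lambda>x. complex_of_real (f n x))" for n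
    have F_C0: "F n \<in> C0" for n using f(1) by (simp add: F_def C0_real_def)
    then have F: "F n \<in> slice 0" for n using f(4) by (intro slice_0I) (auto simp: F_def)
    have ind: "integrable \<mu> (indicator Y :: 'x \<Rightarrow> real)"
      using borel_Y M_Y[OF \<mu>] M_sets[OF \<mu>] by simp
    have "(\<lambda>n. integral\<^sup>L \<mu> (f n)) \<longlonglongrightarrow> integral\<^sup>L \<mu> (indicator Y)"
    proof (rule integral_dominated_convergence[where w = "indicator Y"])
      show "f n \<in> borel_measurable \<mu>" for n
        using borel_measurable_continuous_onI[OF C0_real_cont[OF f(1)]]
        by (simp add: measurable_cong_sets[OF M_sets[OF \<mu>] refl])
      show "AE x in \<mu>. norm (f n x) \<le> indicator Y x" for n
        using f(2,3,4) by (auto simp: indicator_def)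
    qed (use ind f(5) in auto)
    moreover have "integral\<^sup>L \<mu> (indicator Y :: 'x \<Rightarrow> real) = 1"
      using borel_Y M_Y[OF \<mu>] sets_eq_imp_space_eq[OF M_sets[OF \<mu>]] by (simp add: measure_def)
    ultimately have "(\<lambda>n. integral\<^sup>L \<mu> (f n)) \<longlonglongrightarrow> 1" by simp
    moreover have "integral\<^sup>L \<mu> (f n) \<le> Sup ?B" for n
    proof -
      have "?\<phi> (monomial act (F n) 0) = of_real (integral\<^sup>L \<mu> (f n))"
        using monomial_corner[OF F[of n]] F_C0[of n] by (simp add: state_of_measure_eq E_monomial F_def)
      moreover have "norm (monomial act (F n) 0) \<le> 1"
        by (rule norm_monomial_le) (use f(2,3) in \<open>auto simp: F_def\<close>)
      ultimately have "cmod (of_real (integral\<^sup>L \<mu> (f n))) \<in> ?B"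
        using monomial_corner[OF F[of n]] by (metis (mono_tags, lifting) mem_Collect_eq)
      then have "\<bar>integral\<^sup>L \<mu> (f n)\<bar> \<le> Sup ?B" using cSup_upper[OF _ bdd] by simp
      then show ?thesis by linarith
    qed
    ultimately show ?thesis by (intro LIMSEQ_le_const2) auto
  qed
  ultimately have "Sup ?B = 1" by simp
  moreover have "?\<phi> (adj a o\<^sub>L a) \<in> \<real>\<^sub>\<ge>\<^sub>0" if a: "a \<in> A" for a
  proof -
    obtain b where b: "b \<in> A" "is_adj a b" using corner_adj[OF a] by blast
    have ba: "b o\<^sub>L a \<in> A" using b(1) a by (rule corner_mult)
    \<comment> \<open>The vector functional at \<open>delta (0, x)\<close> turns the product with
      the adjoint into a squared norm, which is where positivity comes from.\<close>
    have "E (b o\<^sub>L a) x = of_real ((norm (a (delta (0, x))))\<^sup>2)" for x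
    proof -
      have "E (b o\<^sub>L a) x = cinner (delta (0, x)) (b (a (delta (0, x))))"
        using ba by (simp add: corner_E_eq cinner_delta)
      also have "\<dots> = cinner (a (delta (0, x))) (a (delta (0, x)))" using b(2) by (simp add: is_adj_def)
      finally show ?thesis by (simp add: cinner_self)
    qed
    then have "E (b o\<^sub>L a) = (\<lambda>x. of_real ((norm (a (delta (0, x))))\<^sup>2))" by (rule ext)
    then have "?\<phi> (b o\<^sub>L a) = of_real (\<integral>x. (norm (a (delta (0, x))))\<^sup>2 \<partial>\<mu>)"
      using ba by (simp only: state_of_measure_eq integral_complex_of_real)
    then show ?thesis by (simp add: adj_eqI[OF b(2)] Bochner_Integration.integral_nonneg)
  qed
  moreover have "?\<phi> (a + b) = ?\<phi> a + ?\<phi> b" if ab: "a \<in> A" "b \<in> A" for a b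
  proof -
    have "E (a + b) = (\<lambda>x. E a x + E b x)" using corner_E_add[OF ab] by (rule ext)
    then show ?thesis
      using ab \<mu> subspace_add[OF subspace_corner ab] by (simp add: state_of_measure_eq E_integrable)
  qed
  moreover have "?\<phi> (scaleC_op c a) = c * ?\<phi> a" if a: "a \<in> A" for c a
  proof -
    have "E (scaleC_op c a) = (\<lambda>x. c * E a x)" using corner_E_scaleC[OF a] by (rule ext)
    then show ?thesis using a \<mu> corner_scaleC[OF a, of c] by (simp add: state_of_measure_eq)
  qed
  moreover have "?\<phi> \<in> extensional A" by (simp add: state_of_measure_def)
  ultimately show ?thesis
    unfolding is_state_def using bdd by blast
qed

text \<open>The unitaries fix \<open>delta (0, x)\<close>, because \<open>N\<close> is 1 at the unit
  of the group.\<close>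

lemma E_conj_phase:
  assumes "a \<in> A" shows "E (conj_phase t a) = E a"
proof
  fix x
  have "phase_op (- t) (delta (0, x)) = delta (0, x)"
    by (rule ell2_eqI, clarify) (simp add: coord_phase_op delta.rep_eq)
  then show "E (conj_phase t a) x = E a x"
    using assms conj_phase_corner[OF assms, of t] by (simp add: corner_E_eq conj_phase_def coord_phase_op)
qed

text \<open>Only products of total degree 0 contribute. Then \<open>g' = - g\<close>, and the two
  orders of multiplication differ by a substitution along \<open>g\<close>, which costs the
  factor.\<close>

lemma state_of_measure_monomials:
  assumes \<mu>: "\<mu> \<in> M" and f: "f \<in> slice g" "f' \<in> slice g'"
  shows "state_of_measure act Y E \<mu> (monomial act f g o\<^sub>L monomial act f' g') =
    of_real (N g powr - \<beta>) * state_of_measure act Y E \<mu> (monomial act f' g' o\<^sub>L monomial act f g)"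
proof -
  let ?\<phi> = "state_of_measure act Y E \<mu>"
  have *: "?\<phi> (monomial act f g o\<^sub>L monomial act f' g') = (if g + g' = 0 then \<integral>x. f x * f' (act (- g) x) \<partial>\<mu> else 0)"
    if f: "f \<in> slice g" "f' \<in> slice g'" for f g f' g'
    using slice_mult[OF f] f
    by (simp add: monomial_mult slice_bounded state_of_measure_eq monomial_corner E_monomial slice_C0)
  \<comment> \<open>The group need not be commutative.\<close>
  have eq: "g + g' = 0 \<longleftrightarrow> g' + g = 0"
    unfolding add_eq_0_iff[of g g'] by (rule eq_neg_iff_add_eq_0)
  show ?thesis
  proof (cases "g + g' = 0")
    case True
    then have g': "g' = - g" by (simp add: add_eq_0_iff)
    have "(\<lambda>x. f' x * f (act g x)) \<in> C0"
      using f by (intro C0_mult_C0 C0_compose_act) (auto intro: slice_C0)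
    from M_change_of_variables[OF \<mu> borel_measurable_C0[OF this], of g]
    show ?thesis unfolding *[OF f] *[OF f(2,1)] using True eq by (simp add: g' mult.commute)
  qed (use eq in \<open>simp add: *[OF f] *[OF f(2,1)]\<close>)
qed

lemma state_of_measure_kms:
  assumes \<mu>: "\<mu> \<in> M" shows "is_kms_state A \<sigma> \<beta> (state_of_measure act Y E \<mu>)"
  unfolding is_kms_state_def
proof (intro conjI allI ballI exI[of _ corner_monomials])
  let ?\<phi> = "state_of_measure act Y E \<mu>"
  show "is_state A ?\<phi>" using \<mu> by (rule state_of_measure_state)
  show "?\<phi> (\<sigma> t a) = ?\<phi> a" if "a \<in> A" for t a
    using that conj_phase_corner[OF that, of t] by (simp add: dynamics_eq[OF \<sigma>] state_of_measure_eq E_conj_phase)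
  show "corner_monomials \<subseteq> A" unfolding corner_eq using closure_subset span_superset by blast
  have "corner_monomials \<subseteq> {scaleC_op c a | c a. a \<in> corner_monomials}"
    by (metis (mono_tags, lifting) mem_Collect_eq scaleC_op_one subsetI)
  then show "A \<subseteq> closure (span {scaleC_op c a | c a. a \<in> corner_monomials})"
    unfolding corner_eq by (intro closure_mono span_mono)
  fix a assume "a \<in> corner_monomials"
  then obtain f g where f: "a = monomial act f g" "f \<in> slice g" by (auto simp: corner_monomials_def)
  define F where "F = (\<lambda>z. scaleC_op (exp (\<i> * z * of_real (log_N g))) a)"
  have "?\<phi> (a o\<^sub>L b) = ?\<phi> (b o\<^sub>L F (\<i> * complex_of_real \<beta>))" if b: "b \<in> corner_monomials" for b
  proof -
    obtain f' g' where f': "b = monomial act f' g'" "f' \<in> slice g'"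
      using b by (auto simp: corner_monomials_def)
    have ba: "a \<in> A" "b \<in> A" "b o\<^sub>L a \<in> A" unfolding f f' using f f' by (auto intro: monomial_corner corner_mult)
    \<comment> \<open>At this point the exponent is \<open>\<i> * \<i> * \<beta> * log_N g\<close>,
      hence real.\<close>
    have "F (\<i> * complex_of_real \<beta>) = scaleC_op (of_real (N g powr - \<beta>)) a"
      unfolding F_def N_powr exp_of_real[symmetric] by (simp add: mult.assoc[symmetric])
    then have "b o\<^sub>L F (\<i> * complex_of_real \<beta>) = scaleC_op (of_real (N g powr - \<beta>)) (b o\<^sub>L a)"
      using compose_scaleC_right[OF corner_complex_linear[OF ba(2)]] by simp
    then have "?\<phi> (b o\<^sub>L F (\<i> * complex_of_real \<beta>)) = of_real (N g powr - \<beta>) * ?\<phi> (b o\<^sub>L a)"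
      using state_of_measure_state[OF \<mu>] ba(3) by (simp add: is_state_def)
    then show ?thesis using state_of_measure_monomials[OF \<mu> f(2) f'(2)] by (simp add: f(1) f'(1))
  qed
  moreover have "entire_extension A \<sigma> a F"
    unfolding f(1) F_def by (rule entire_extension_monomial[OF \<sigma> f(2)])
  ultimately show "\<exists>F. entire_extension A \<sigma> a F \<and>
      (\<forall>b\<in>corner_monomials. ?\<phi> (a o\<^sub>L b) = ?\<phi> (b o\<^sub>L F (\<i> * complex_of_real \<beta>)))" by blast
qed

text \<open>The state determines the finite measure obtained by restricting \<mu> to
  \<open>Y\<close>. The scaling condition expresses the mass of each part
  \<open>B \<inter> piece n\<close> by a subset of \<open>Y\<close>, so \<mu> is recovered on all of
  \<open>X\<close>.\<close>

lemma state_of_measure_inj: "inj_on (state_of_measure act Y E) M"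
proof (rule inj_onI)
  fix \<mu> \<nu> assume M: "\<mu> \<in> M" "\<nu> \<in> M" and eq: "state_of_measure act Y E \<mu> = state_of_measure act Y E \<nu>"
  have emeasure: "emeasure (density \<kappa> (indicator Y)) B = emeasure \<kappa> (Y \<inter> B)"
    if "\<kappa> \<in> M" "B \<in> sets borel" for \<kappa> B
    using that borel_Y by (intro emeasure_restricted) (auto simp: M_sets)
  have finite: "finite_measure (density \<kappa> (indicator Y))" if "\<kappa> \<in> M" for \<kappa>
    using emeasure[OF that, of UNIV] M_Y[OF that] sets_eq_imp_space_eq[OF M_sets[OF that]]
    by (intro finite_measureI) simp
  have integral: "complex_of_real (integral\<^sup>L (density \<kappa> (indicator Y)) f) =
      state_of_measure act Y E \<kappa> (monomial act (\<lambda>x. indicator Y x * of_real (f x)) 0)"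
    if "\<kappa> \<in> M" "f \<in> C0_real" for \<kappa> f
  proof -
    have F: "(\<lambda>x. indicator Y x * complex_of_real (f x)) \<in> slice 0"
      using that(2) continuous_indicator_clopen[OF open_Y closed_Y]
      by (intro slice_0I C0_mult_bounded bounded_range_indicator) (auto simp: C0_real_def)
    have "integral\<^sup>L (density \<kappa> (\<lambda>x. ennreal (indicator Y x))) f = (\<integral>x. indicator Y x *\<^sub>R f x \<partial>\<kappa>)"
      using borel_Y borel_measurable_continuous_onI[OF C0_real_cont[OF that(2)]] M_sets[OF that(1)]
      by (intro integral_density) (simp_all add: measurable_cong_sets[OF M_sets[OF that(1)] refl])
    moreover have "(\<lambda>x. ennreal (indicator Y x)) = indicator Y" by (auto simp: indicator_def)
    ultimately have "complex_of_real (integral\<^sup>L (density \<kappa> (indicator Y)) f) =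
        (\<integral>x. complex_of_real (indicator Y x *\<^sub>R f x) \<partial>\<kappa>)"
      by (simp only: integral_complex_of_real)
    also have "\<dots> = (\<integral>x. indicator Y x * complex_of_real (f x) \<partial>\<kappa>)"
      by (rule Bochner_Integration.integral_cong) (auto simp: indicator_def)
    also have "\<dots> = state_of_measure act Y E \<kappa> (monomial act (\<lambda>x. indicator Y x * of_real (f x)) 0)"
      using monomial_corner[OF F] slice_C0[OF F] by (simp add: state_of_measure_eq E_monomial)
    finally show ?thesis .
  qed
  have "density \<mu> (indicator Y) = density \<nu> (indicator Y)"
  proof (rule finite_borel_measure_eqI[OF lc])
    fix f :: "'x \<Rightarrow> real" assume f: "f \<in> C0_real"
    have "complex_of_real (integral\<^sup>L (density \<mu> (indicator Y)) f) = of_real (integral\<^sup>L (density \<nu> (indicator Y)) f)"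
      unfolding integral[OF M(1) f] integral[OF M(2) f] eq ..
    then show "integral\<^sup>L (density \<mu> (indicator Y)) f = integral\<^sup>L (density \<nu> (indicator Y)) f" by simp
  qed (use M finite in \<open>simp_all add: M_sets\<close>)
  then have Y_eq: "emeasure \<mu> B = emeasure \<nu> B" if "B \<in> sets borel" "B \<subseteq> Y" for B
    using emeasure[OF M(1) that(1)] emeasure[OF M(2) that(1)] that(2) by (simp add: Int_absorb1)
  have decomp: "emeasure \<kappa> B = (\<Sum>n. ennreal (N (g_enum n) powr - \<beta>) * emeasure \<kappa> (act (- g_enum n) ` (B \<inter> piece n)))"
    if "\<kappa> \<in> M" "B \<in> sets borel" for \<kappa> B
  proof -
    have "emeasure \<kappa> (\<Union>n. B \<inter> piece n) = (\<Sum>n. emeasure \<kappa> (B \<inter> piece n))"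
      using that piece_borel piece_disjoint M_sets[OF that(1)]
      by (intro suminf_emeasure[symmetric]) (auto simp: disjoint_family_on_def)
    moreover have "(\<Union>n. B \<inter> piece n) = B" using piece_UN by (simp flip: Int_UN_distrib)
    moreover have "emeasure \<kappa> (B \<inter> piece n) =
        ennreal (N (g_enum n) powr - \<beta>) * emeasure \<kappa> (act (- g_enum n) ` (B \<inter> piece n))" for n
    proof -
      have "act (g_enum n) ` act (- g_enum n) ` (B \<inter> piece n) = B \<inter> piece n" by (simp add: image_image)
      then show ?thesis
        using M_scaling[OF that(1) borel_act_image[of "B \<inter> piece n" "- g_enum n"], of "g_enum n"]
          that(2) piece_borel by (simp add: sets.Int)
    qed
    ultimately show ?thesis by simp
  qed
  show "\<mu> = \<nu>"
  proof (rule measure_eqI)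
    fix B assume "B \<in> sets \<mu>"
    then have B: "B \<in> sets borel" using M_sets[OF M(1)] by simp
    have "emeasure \<mu> (act (- g_enum n) ` (B \<inter> piece n)) = emeasure \<nu> (act (- g_enum n) ` (B \<inter> piece n))" for n
      using B piece_borel piece_pull by (intro Y_eq borel_act_image) auto
    then show "emeasure \<mu> B = emeasure \<nu> B" using decomp B M by simp
  qed (use M in \<open>simp add: M_sets\<close>)
qed

end

section \<open>Convex combinations of measures\<close>

lemma sets_convex_comb: "sets (convex_comb s \<mu> \<nu>) = sets borel"
  unfolding convex_comb_def
  using sets.sigma_sets_eq[of "borel :: 'a measure"] by (auto simp: space_measure_of_conv)

lemma emeasure_convex_comb:
  assumes "sets \<mu> = sets borel" "sets \<nu> = sets borel" "B \<in> sets borel"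
  shows "emeasure (convex_comb s \<mu> \<nu>) B = ennreal s * emeasure \<mu> B + ennreal (1 - s) * emeasure \<nu> B"
  unfolding convex_comb_def
proof (rule emeasure_measure_of_sigma)
  show "sigma_algebra UNIV (sets borel :: 'a set set)"
    using sets.sigma_algebra_axioms[of "borel :: 'a measure"] by simp
  show "countably_additive (sets borel) (\<lambda>B. ennreal s * emeasure \<mu> B + ennreal (1 - s) * emeasure \<nu> B)"
  proof (rule countably_additiveI)
    fix F :: "nat \<Rightarrow> 'a set" assume "range F \<subseteq> sets borel" "disjoint_family F"
    then show "(\<Sum>i. ennreal s * emeasure \<mu> (F i) + ennreal (1 - s) * emeasure \<nu> (F i)) =
        ennreal s * emeasure \<mu> (\<Union> (range F)) + ennreal (1 - s) * emeasure \<nu> (\<Union> (range F))"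
      using assms by (subst suminf_add[symmetric]) (auto simp: suminf_emeasure)
  qed
qed (use assms in \<open>auto simp: positive_def\<close>)

lemma nn_integral_convex_comb:
  assumes \<mu>: "sets \<mu> = sets borel" and \<nu>: "sets \<nu> = sets borel" and f: "f \<in> borel_measurable borel"
  shows "nn_integral (convex_comb s \<mu> \<nu>) f = ennreal s * nn_integral \<mu> f + ennreal (1 - s) * nn_integral \<nu> f"
proof -
  note meas = measurable_cong_sets[OF \<mu> refl] measurable_cong_sets[OF \<nu> refl]
    measurable_cong_sets[OF sets_convex_comb[of s \<mu> \<nu>] refl]
  show ?thesis
    using f
  proof (induction rule: borel_measurable_induct)
    case (cong f g)
    then have "f = g" by auto
    then show ?case using cong by simp
  next
    case (set B)
    then show ?case using \<mu> \<nu> by (simp add: emeasure_convex_comb sets_convex_comb)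
  next
    case (mult u c)
    then show ?case by (simp add: nn_integral_cmult meas distrib_left mult_ac)
  next
    case (add u v)
    then show ?case by (simp add: nn_integral_add meas distrib_left add_ac)
  next
    case (seq U)
    have sup: "nn_integral \<kappa> (SUP i. U i) = (SUP i. nn_integral \<kappa> (U i))"
      if "\<And>i. U i \<in> borel_measurable \<kappa>" for \<kappa>
    proof -
      have "(SUP i. U i) = (\<lambda>x. SUP i. U i x)" by (auto simp: fun_eq_iff image_comp)
      then show ?thesis using nn_integral_monotone_convergence_SUP[OF \<open>incseq U\<close> that] by simp
    qed
    have inc: "incseq (\<lambda>i. c * nn_integral \<kappa> (U i))" for c and \<kappa> :: "'a measure"
      using \<open>incseq U\<close> by (auto simp: incseq_def le_fun_def intro!: mult_left_mono nn_integral_mono)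
    have U: "U i \<in> borel_measurable \<mu>" "U i \<in> borel_measurable \<nu>"
        "U i \<in> borel_measurable (convex_comb s \<mu> \<nu>)" for i
      using seq(1) by (simp_all add: meas)
    have "nn_integral (convex_comb s \<mu> \<nu>) (SUP i. U i) = (SUP i. nn_integral (convex_comb s \<mu> \<nu>) (U i))"
      by (rule sup[OF U(3)])
    also have "\<dots> = (SUP i. ennreal s * nn_integral \<mu> (U i) + ennreal (1 - s) * nn_integral \<nu> (U i))"
      by (simp only: seq.IH)
    also have "\<dots> = (SUP i. ennreal s * nn_integral \<mu> (U i)) + (SUP i. ennreal (1 - s) * nn_integral \<nu> (U i))"
      by (rule ennreal_SUP_add[OF inc inc])
    also have "\<dots> = ennreal s * (SUP i. nn_integral \<mu> (U i)) + ennreal (1 - s) * (SUP i. nn_integral \<nu> (U i))"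
      by (simp only: SUP_mult_left_ennreal)
    also have "\<dots> = ennreal s * nn_integral \<mu> (SUP i. U i) + ennreal (1 - s) * nn_integral \<nu> (SUP i. U i)"
      by (simp only: sup[OF U(1)] sup[OF U(2)])
    finally show ?case .
  qed
qed

context kms_setting
begin

lemma convex_comb_M:
  assumes M: "\<mu> \<in> M" "\<nu> \<in> M" and s: "s \<in> {0..1}"
  shows "convex_comb s \<mu> \<nu> \<in> M"
proof -
  note emeasure = emeasure_convex_comb[OF M_sets[OF M(1)] M_sets[OF M(2)], of _ s]
  have "emeasure (convex_comb s \<mu> \<nu>) K < \<infinity>" if "compact K" for K
    using M_compact[OF M(1) that] M_compact[OF M(2) that] that
    by (simp add: emeasure borel_compact ennreal_mult_less_top)
  then have "radon_measure (convex_comb s \<mu> \<nu>)"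
    by (intro radon_measureI lc sets_convex_comb)
  moreover have "emeasure (convex_comb s \<mu> \<nu>) Y = 1"
    using s by (simp add: emeasure borel_Y M_Y M ennreal_plus[symmetric] del: ennreal_plus)
  moreover have "emeasure (convex_comb s \<mu> \<nu>) (act g ` B) = ennreal (N g powr - \<beta>) * emeasure (convex_comb s \<mu> \<nu>) B"
    if "B \<in> sets borel" for g B
    using that borel_act_image[OF that] by (simp add: emeasure M_scaling M distrib_left mult_ac)
  ultimately show ?thesis unfolding kms_measures_def by blast
qed

lemma integral_convex_comb:
  fixes f :: "'x \<Rightarrow> real"
  assumes M: "\<mu> \<in> M" "\<nu> \<in> M" and s: "s \<in> {0..1}"
    and f: "f \<in> borel_measurable borel" "\<And>x. \<bar>f x\<bar> \<le> C" "\<And>x. x \<notin> Y \<Longrightarrow> f x = 0"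
  shows "integral\<^sup>L (convex_comb s \<mu> \<nu>) f = s * integral\<^sup>L \<mu> f + (1 - s) * integral\<^sup>L \<nu> f"
proof -
  have nonneg: "integral\<^sup>L (convex_comb s \<mu> \<nu>) u = s * integral\<^sup>L \<mu> u + (1 - s) * integral\<^sup>L \<nu> u"
    if u: "u \<in> borel_measurable borel" "\<And>x. \<bar>u x\<bar> \<le> C" "\<And>x. x \<notin> Y \<Longrightarrow> u x = 0" "\<And>x. 0 \<le> u x" for u :: "'x \<Rightarrow> real"
  proof -
    have int: "integrable \<kappa> u" if "\<kappa> \<in> M" for \<kappa>
      by (rule M_integrable[OF that u(1) _ u(3)]) (use u(2) in auto)
    have pos: "0 \<le> integral\<^sup>L \<kappa> u" for \<kappa> using u(4) by (intro Bochner_Integration.integral_nonneg)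
    have "ennreal (integral\<^sup>L (convex_comb s \<mu> \<nu>) u) = nn_integral (convex_comb s \<mu> \<nu>) (\<lambda>x. ennreal (u x))"
      using u(4) int[OF convex_comb_M[OF M s]] by (simp add: nn_integral_eq_integral)
    also have "\<dots> = ennreal s * ennreal (integral\<^sup>L \<mu> u) + ennreal (1 - s) * ennreal (integral\<^sup>L \<nu> u)"
      using u(1,4) int M by (simp add: nn_integral_convex_comb M_sets nn_integral_eq_integral)
    also have "\<dots> = ennreal (s * integral\<^sup>L \<mu> u + (1 - s) * integral\<^sup>L \<nu> u)"
      using s pos by (simp add: ennreal_mult ennreal_plus)
    finally show ?thesis using s pos by (subst (asm) ennreal_inj) auto
  qed
  define f1 where "f1 = (\<lambda>x. max 0 (f x))"
  define f2 where "f2 = (\<lambda>x. max 0 (- f x))"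
  have f12: "f1 \<in> borel_measurable borel" "\<And>x. \<bar>f1 x\<bar> \<le> C" "\<And>x. x \<notin> Y \<Longrightarrow> f1 x = 0" "\<And>x. 0 \<le> f1 x"
      "f2 \<in> borel_measurable borel" "\<And>x. \<bar>f2 x\<bar> \<le> C" "\<And>x. x \<notin> Y \<Longrightarrow> f2 x = 0" "\<And>x. 0 \<le> f2 x"
  proof -
    show "f1 \<in> borel_measurable borel" "f2 \<in> borel_measurable borel"
      unfolding f1_def f2_def using f(1) by simp_all
    have "\<bar>f1 x\<bar> \<le> \<bar>f x\<bar>" "\<bar>f2 x\<bar> \<le> \<bar>f x\<bar>" for x by (auto simp: f1_def f2_def)
    then show "\<bar>f1 x\<bar> \<le> C" "\<bar>f2 x\<bar> \<le> C" for x using f(2)[of x] order_trans by blast+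
  qed (use f(3) in \<open>auto simp: f1_def f2_def\<close>)
  have int: "integrable \<kappa> f1" "integrable \<kappa> f2" if "\<kappa> \<in> M" for \<kappa>
    using M_integrable[OF that, of f1 C] M_integrable[OF that, of f2 C] f12 by auto
  have "f = (\<lambda>x. f1 x - f2 x)" by (auto simp: f1_def f2_def max_def)
  then show ?thesis
    using nonneg[of f1] nonneg[of f2] f12 int M int[OF convex_comb_M[OF M s]] by (simp add: algebra_simps)
qed

lemma state_of_convex_comb:
  assumes M: "\<mu> \<in> M" "\<nu> \<in> M" and s: "s \<in> {0..1}" and a: "a \<in> A"
  shows "state_of_measure act Y E (convex_comb s \<mu> \<nu>) a =
    complex_of_real s * state_of_measure act Y E \<mu> a + complex_of_real (1 - s) * state_of_measure act Y E \<nu> a"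
proof -
  have int: "integrable \<kappa> (E a)" if "\<kappa> \<in> M" for \<kappa> using that a by (rule E_integrable)
  have meas: "E a \<in> borel_measurable borel" by (rule borel_measurable_C0[OF corner_E_C0[OF a]])
  have bound: "\<bar>Re (E a x)\<bar> \<le> norm a" "\<bar>Im (E a x)\<bar> \<le> norm a" for x
    using corner_E_bound[OF a, of x] abs_Re_le_cmod[of "E a x"] abs_Im_le_cmod[of "E a x"] by linarith+
  have "integral\<^sup>L (convex_comb s \<mu> \<nu>) (\<lambda>x. Re (E a x)) = s * integral\<^sup>L \<mu> (\<lambda>x. Re (E a x)) + (1 - s) * integral\<^sup>L \<nu> (\<lambda>x. Re (E a x))"
    using meas bound corner_E_zero[OF a] by (intro integral_convex_comb[OF M s]) auto
  moreover have "integral\<^sup>L (convex_comb s \<mu> \<nu>) (\<lambda>x. Im (E a x)) = s * integral\<^sup>L \<mu> (\<lambda>x. Im (E a x)) + (1 - s) * integral\<^sup>L \<nu> (\<lambda>x. Im (E a x))"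
    using meas bound corner_E_zero[OF a] by (intro integral_convex_comb[OF M s]) auto
  ultimately show ?thesis
    using int M int[OF convex_comb_M[OF M s]]
    by (intro complex_eqI) (simp_all add: state_of_measure_eq[OF a])
qed

end

section \<open>The KMS condition for homogeneous elements\<close>

text \<open>Both horizontal sides of a long rectangle have integral close to a constant times the length,
  while the contribution of the vertical sides stays bounded.\<close>

lemma strip_boundary_values:
  fixes G :: "complex \<Rightarrow> complex"
  assumes G: "G holomorphic_on UNIV"
    and bot: "\<And>t. cmod (G (of_real t) - c0) \<le> e"
    and top: "\<And>t. cmod (G (of_real t + \<i> * of_real b) - c1) \<le> e"
    and bound: "\<And>t z. z \<in> closed_segment 0 (\<i> * of_real b) \<Longrightarrow> cmod (G (of_real t + z)) \<le> M"
  shows "cmod (c0 - c1) \<le> 2 * e"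
proof -
  \<comment> \<open>A primitive replaces contour integrals: integrals along segments become
    differences of values of \<open>P\<close>.\<close>
  obtain P where P: "\<And>z. (P has_field_derivative G z) (at z)"
    using holomorphic_convex_primitive'[OF convex_UNIV open_UNIV G] by auto
  have P': "(P has_field_derivative G z) (at z within S)" for z S
    using P by (rule has_field_derivative_at_within)
  \<comment> \<open>Here \<open>c\<close> is the approximate value of \<open>G\<close> on the
    horizontal line, so \<open>P z - c * z\<close> has derivative at most \<open>e\<close>
    there.\<close>
  have hor: "cmod ((P (of_real R + z) - c * (of_real R + z)) - (P z - c * z)) \<le> e * R"
    if "R > 0" "\<And>t. cmod (G (of_real t + z) - c) \<le> e" for R z c
  proof -
    have "cmod ((P (of_real R + z) - c * (of_real R + z)) - (P z - c * z)) \<le> e * cmod ((of_real R + z) - z)"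
    proof (rule field_differentiable_bound[where S = "closed_segment z (of_real R + z)"])
      fix w
      show "((\<lambda>z. P z - c * z) has_field_derivative G w - c) (at w within closed_segment z (of_real R + z))"
        by (rule derivative_eq_intros P' refl | simp)+
      assume "w \<in> closed_segment z (of_real R + z)"
      then obtain u where "w = (1 - u) *\<^sub>R z + u *\<^sub>R (of_real R + z)" by (auto simp: in_segment)
      then have "w = of_real (u * R) + z" by (simp add: algebra_simps scaleR_conv_of_real)
      then show "cmod (G w - c) \<le> e" using that(2)[of "u * R"] by simp
    qed auto
    then show ?thesis using \<open>R > 0\<close> by simp
  qed
  have vert: "cmod (P (of_real t + \<i> * of_real b) - P (of_real t)) \<le> M * \<bar>b\<bar>" for t
  proof -
    have "cmod (P (of_real t + \<i> * of_real b) - P (of_real t)) \<le> M * cmod ((of_real t + \<i> * of_real b) - of_real t)"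
    proof (rule field_differentiable_bound[where S = "closed_segment (of_real t) (of_real t + \<i> * of_real b)" and f' = G])
      fix w assume "w \<in> closed_segment (complex_of_real t) (of_real t + \<i> * of_real b)"
      then obtain u where u: "0 \<le> u" "u \<le> 1" "w = (1 - u) *\<^sub>R of_real t + u *\<^sub>R (of_real t + \<i> * of_real b)"
        by (auto simp: in_segment)
      have "w = of_real t + u *\<^sub>R (\<i> * of_real b)" using u(3) by (simp add: algebra_simps scaleR_conv_of_real)
      moreover have "u *\<^sub>R (\<i> * complex_of_real b) \<in> closed_segment 0 (\<i> * of_real b)"
        unfolding in_segment using u by (intro exI[of _ u]) simp
      ultimately show "cmod (G w) \<le> M" using bound by simp
    qed (use P' in auto)
    then show ?thesis by (simp add: norm_mult)
  qed
  have main: "R * cmod (c0 - c1) \<le> R * (2 * e) + 2 * (M * \<bar>b\<bar>)" if "R > 0" for R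
  proof -
    have tri: "cmod (u - v - w + x) \<le> cmod u + cmod v + cmod w + cmod x" for u v w x
      using norm_triangle_ineq[of "u - v - w" x] norm_triangle_ineq4[of "u - v" w] norm_triangle_ineq4[of u v]
      by linarith
    define ib where "ib = \<i> * complex_of_real b"
    \<comment> \<open>The four sides of the rectangle: all values of \<open>P\<close> cancel and
      only the linear terms remain.\<close>
    have eq: "of_real R * (c0 - c1) =
        ((P (of_real R + ib) - c1 * (of_real R + ib)) - (P ib - c1 * ib))
        - ((P (of_real R + 0) - c0 * (of_real R + 0)) - (P 0 - c0 * 0))
        - (P (of_real R + ib) - P (of_real R)) + (P (of_real 0 + ib) - P (of_real 0))"
      by (simp add: algebra_simps)
    have "cmod (of_real R * (c0 - c1)) \<le> e * R + e * R + M * \<bar>b\<bar> + M * \<bar>b\<bar>"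
      unfolding eq
    proof (rule order_trans[OF tri], intro add_mono)
      show "cmod ((P (of_real R + ib) - c1 * (of_real R + ib)) - (P ib - c1 * ib)) \<le> e * R"
        by (rule hor[OF that]) (use top in \<open>simp add: ib_def\<close>)
      show "cmod ((P (of_real R + 0) - c0 * (of_real R + 0)) - (P 0 - c0 * 0)) \<le> e * R"
        by (rule hor[OF that]) (use bot in simp)
    qed (unfold ib_def, rule vert, rule vert)
    then show ?thesis using that unfolding norm_mult norm_of_real by (simp add: mult_ac)
  qed
  show ?thesis
  proof (rule tendsto_lowerbound)
    show "((\<lambda>R. 2 * e + 2 * (M * \<bar>b\<bar>) / R) \<longlongrightarrow> 2 * e) at_top"
      by (rule tendsto_eq_intros tendsto_divide_0 filterlim_at_top_imp_at_infinity filterlim_ident refl | simp)+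
    show "\<forall>\<^sub>F R in at_top. cmod (c0 - c1) \<le> 2 * e + 2 * (M * \<bar>b\<bar>) / R"
      using eventually_gt_at_top[of 0]
    proof eventually_elim
      case (elim R)
      then show ?case using main[of R] by (simp add: field_simps)
    qed
  qed simp
qed

lemma entire_eq_if_eq_on_reals:
  fixes f h :: "complex \<Rightarrow> complex"
  assumes "f holomorphic_on UNIV" "h holomorphic_on UNIV" "\<And>t. f (of_real t) = h (of_real t)"
  shows "f z = h z"
proof -
  have "(0 :: complex) islimpt range of_real"
    unfolding islimpt_sequential
    by (intro exI[of _ "\<lambda>n. of_real (inverse (Suc n))"] conjI tendsto_of_real[where 'a = complex, of _ 0, simplified] allI LIMSEQ_inverse_real_of_nat)
       (auto simp del: of_real_inverse of_real_of_nat_eq)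
  then have "f z - h z = 0"
    by (rule analytic_continuation[where f = "\<lambda>z. f z - h z" and S = UNIV, rotated 5])
       (use assms in \<open>auto intro: holomorphic_on_diff\<close>)
  then show ?thesis by simp
qed

context dynamics
begin

lemma conj_phase_scaleC: "conj_phase t (scaleC_op c a) = scaleC_op c (conj_phase t a)"
  by (intro blinfun_eqI ell2_eqI, clarify) (simp add: conj_phase_def coord_phase_op coord_scaleC_op)

end

section \<open>Analytic elements for a KMS state\<close>

locale kms_state = kms_setting act Y N \<sigma> E \<beta>
  for act :: "'g::group_add \<Rightarrow> 'x::{second_countable_topology, t2_space} \<Rightarrow> 'x" and Y N \<sigma> E \<beta> +
  fixes \<phi> :: "('g \<times> 'x) op \<Rightarrow> complex"
  assumes \<phi>: "is_kms_state A \<sigma> \<beta> \<phi>"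
begin

lemma \<phi>_state: "is_state A \<phi>"
  using \<phi> by (simp add: is_kms_state_def)

lemma \<phi>_add: "a \<in> A \<Longrightarrow> b \<in> A \<Longrightarrow> \<phi> (a + b) = \<phi> a + \<phi> b"
  and \<phi>_scaleC: "a \<in> A \<Longrightarrow> \<phi> (scaleC_op c a) = c * \<phi> a"
  and \<phi>_nonneg: "a \<in> A \<Longrightarrow> \<phi> (adj a o\<^sub>L a) \<in> \<real>\<^sub>\<ge>\<^sub>0"
  using \<phi>_state by (simp_all add: is_state_def)

lemma \<phi>_scaleR: "a \<in> A \<Longrightarrow> \<phi> (r *\<^sub>R a) = of_real r * \<phi> a"
  using \<phi>_scaleC[of a "of_real r"] by (simp add: scaleC_op_of_real)

lemma A_diff: "a \<in> A \<Longrightarrow> b \<in> A \<Longrightarrow> a - b \<in> A"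
  and A_add: "a \<in> A \<Longrightarrow> b \<in> A \<Longrightarrow> a + b \<in> A"
  and A_scaleR: "a \<in> A \<Longrightarrow> r *\<^sub>R a \<in> A"
  and A_zero: "0 \<in> A"
  using subspace_corner by (simp_all add: subspace_diff subspace_add subspace_scale subspace_0)

lemma \<phi>_diff: "a \<in> A \<Longrightarrow> b \<in> A \<Longrightarrow> \<phi> (a - b) = \<phi> a - \<phi> b"
  using \<phi>_add[of a "- 1 *\<^sub>R b"] \<phi>_scaleR[of b "- 1"] A_scaleR[of b "- 1"] by simp

lemma \<phi>_zero: "\<phi> 0 = 0"
  using \<phi>_scaleR[OF A_zero, of 0] by simp

lemma \<phi>_bound:
  assumes "a \<in> A" shows "cmod (\<phi> a) \<le> norm a"
proof (cases "a = 0")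
  case False
  have "inverse (norm a) *\<^sub>R a \<in> A" using assms by (rule A_scaleR)
  moreover have "norm (inverse (norm a) *\<^sub>R a) \<le> 1" using False by simp
  ultimately have "cmod (\<phi> (inverse (norm a) *\<^sub>R a)) \<in> {cmod (\<phi> a) | a. a \<in> A \<and> norm a \<le> 1}" by blast
  then have "cmod (\<phi> (inverse (norm a) *\<^sub>R a)) \<le> Sup {cmod (\<phi> a) | a. a \<in> A \<and> norm a \<le> 1}"
    by (rule cSup_upper) (use \<phi>_state in \<open>simp add: is_state_def\<close>)
  also have "\<dots> = 1" using \<phi>_state by (simp add: is_state_def)
  finally have "cmod (\<phi> (inverse (norm a) *\<^sub>R a)) \<le> 1" .
  moreover have "cmod (\<phi> (inverse (norm a) *\<^sub>R a)) = inverse (norm a) * cmod (\<phi> a)"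
    using assms by (simp add: \<phi>_scaleR norm_mult norm_inverse)
  ultimately have "inverse (norm a) * cmod (\<phi> a) \<le> 1" by simp
  then show ?thesis using False by (simp add: field_simps)
qed (simp add: \<phi>_zero)

lemma \<phi>_conj_phase: "a \<in> A \<Longrightarrow> \<phi> (conj_phase t a) = \<phi> a"
  using \<phi> by (simp add: is_kms_state_def dynamics_eq[OF \<sigma>, symmetric])

lemma tendsto_\<phi>:
  assumes "(X \<longlongrightarrow> a) F" "\<And>n. X n \<in> A" "a \<in> A" shows "((\<lambda>n. \<phi> (X n)) \<longlongrightarrow> \<phi> a) F"
proof (rule LIM_zero_cancel, rule Lim_null_comparison)
  show "((\<lambda>n. norm (X n - a)) \<longlongrightarrow> 0) F" using assms(1) by (simp add: LIM_zero_iff tendsto_norm_zero)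
  show "\<forall>\<^sub>F n in F. norm (\<phi> (X n) - \<phi> a) \<le> norm (X n - a)"
    using \<phi>_bound[OF A_diff] assms(2,3) by (simp add: \<phi>_diff[symmetric])
qed

text \<open>Here \<open>b\<close> ranges over the whole algebra, which makes the condition linear in
  the pair \<open>(a, F)\<close>.\<close>

definition kms_analytic :: "('g \<times> 'x) op \<Rightarrow> (complex \<Rightarrow> ('g \<times> 'x) op) \<Rightarrow> bool"
  where "kms_analytic a F \<longleftrightarrow> a \<in> A \<and> entire_extension A \<sigma> a F \<and>
    (\<forall>b\<in>A. \<phi> (a o\<^sub>L b) = \<phi> (b o\<^sub>L F (\<i> * complex_of_real \<beta>)))"

lemma kms_analytic_A: "kms_analytic a F \<Longrightarrow> a \<in> A"
  and kms_analytic_F_A: "kms_analytic a F \<Longrightarrow> F z \<in> A"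
  and kms_analytic_real: "kms_analytic a F \<Longrightarrow> F (of_real t) = conj_phase t a"
  and kms_analytic_kms: "kms_analytic a F \<Longrightarrow> b \<in> A \<Longrightarrow> \<phi> (a o\<^sub>L b) = \<phi> (b o\<^sub>L F (\<i> * complex_of_real \<beta>))"
  by (auto simp: kms_analytic_def entire_extension_def dynamics_eq[OF \<sigma>])

lemma kms_analytic_deriv:
  assumes "kms_analytic a F"
  obtains D where "D \<in> A" "((\<lambda>w. scaleC_op (inverse (w - z)) (F w - F z)) \<longlongrightarrow> D) (at z)"
proof -
  obtain D where D: "((\<lambda>w. scaleC_op (inverse (w - z)) (F w - F z)) \<longlongrightarrow> D) (at z)"
    using assms unfolding kms_analytic_def entire_extension_def by blast
  have "D \<in> A"
    by (rule Lim_in_closed_set[OF closed_corner _ _ D])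
       (auto intro!: always_eventually corner_scaleC A_diff kms_analytic_F_A[OF assms])
  then show ?thesis using D by (rule that)
qed

text \<open>The functional is left general because two kinds occur: coordinates of
  \<open>F z\<close> applied to a vector, and \<open>c \<mapsto> \<phi> (b o c)\<close>. Its laws
  are asked for on \<open>A\<close> only, where \<phi> is linear and continuous.\<close>

lemma kms_analytic_holomorphic:
  assumes "kms_analytic a F" and \<psi>: "\<And>b c. b \<in> A \<Longrightarrow> c \<in> A \<Longrightarrow> \<psi> (b - c) = \<psi> b - \<psi> c"
    "\<And>b c. b \<in> A \<Longrightarrow> \<psi> (scaleC_op c b) = c * \<psi> b"
    "\<And>(X :: complex \<Rightarrow> ('g \<times> 'x) op) b H. (X \<longlongrightarrow> b) H \<Longrightarrow> (\<And>n. X n \<in> A) \<Longrightarrow> b \<in> A \<Longrightarrow>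
      ((\<lambda>n. \<psi> (X n)) \<longlongrightarrow> (\<psi> b :: complex)) H"
  shows "(\<lambda>z. \<psi> (F z)) holomorphic_on UNIV"
  unfolding holomorphic_on_open[OF open_UNIV]
proof (intro ballI)
  fix z
  note FA = kms_analytic_F_A[OF assms(1)]
  obtain D where D: "D \<in> A" "((\<lambda>w. scaleC_op (inverse (w - z)) (F w - F z)) \<longlongrightarrow> D) (at z)"
    using kms_analytic_deriv[OF assms(1)] by blast
  have "((\<lambda>w. \<psi> (scaleC_op (inverse (w - z)) (F w - F z))) \<longlongrightarrow> \<psi> D) (at z)"
    by (rule \<psi>(3)[OF D(2) _ D(1)]) (auto intro: corner_scaleC A_diff FA)
  moreover have "\<psi> (scaleC_op (inverse (w - z)) (F w - F z)) = (\<psi> (F w) - \<psi> (F z)) / (w - z)" for w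
    by (simp add: \<psi>(1,2) A_diff FA divide_inverse mult.commute)
  ultimately show "\<exists>f'. ((\<lambda>z. \<psi> (F z)) has_field_derivative f') (at z)"
    by (auto simp: has_field_derivative_iff)
qed

text \<open>Coordinatewise both sides are entire in \<open>z\<close>, and on the real line they
  agree by the group law of the conjugations.\<close>

lemma kms_analytic_shift:
  assumes "kms_analytic a F" shows "F (z + of_real t) = conj_phase t (F z)"
proof (intro blinfun_eqI ell2_eqI, clarify)
  fix \<xi> h x
  have hol: "(\<lambda>z. coord (F z \<xi>) i) holomorphic_on UNIV" for \<xi> i
    by (rule kms_analytic_holomorphic[OF assms, of "\<lambda>b. coord (b \<xi>) i"])
       (auto simp: blinfun.diff_left coord_scaleC_op intro!: tendsto_coord blinfun.tendsto tendsto_const)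
  show "coord (F (z + of_real t) \<xi>) (h, x) = coord (conj_phase t (F z) \<xi>) (h, x)"
  proof (rule entire_eq_if_eq_on_reals[of "\<lambda>z. coord (F (z + of_real t) \<xi>) (h, x)" "\<lambda>z. coord (conj_phase t (F z) \<xi>) (h, x)" z])
    have "(\<lambda>z. z + complex_of_real t) holomorphic_on UNIV" by (intro holomorphic_intros)
    from holomorphic_on_compose[OF this holomorphic_on_subset[OF hol[of \<xi> "(h, x)"]]]
    show "(\<lambda>z. coord (F (z + complex_of_real t) \<xi>) (h, x)) holomorphic_on UNIV"
      by (simp add: o_def)
    show "(\<lambda>z. coord (conj_phase t (F z) \<xi>) (h, x)) holomorphic_on UNIV"
      by (simp add: conj_phase_def coord_phase_op) (intro holomorphic_intros hol)
    show "coord (F (of_real s + of_real t) \<xi>) (h, x) = coord (conj_phase t (F (of_real s)) \<xi>) (h, x)" for s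
      using kms_analytic_real[OF assms, of "s + t"] kms_analytic_real[OF assms, of s] by (simp add: conj_phase_conj_phase add.commute)
  qed
qed

text \<open>Multiply the convergent difference quotient by \<open>w - z\<close>. Continuity is used
  to bound \<open>F\<close> on the segment from 0 to \<open>\<i> * \<beta>\<close>.\<close>

lemma kms_analytic_continuous:
  assumes "kms_analytic a F" shows "continuous_on UNIV F"
proof (rule continuous_at_imp_continuous_on, rule ballI)
  fix z
  obtain D where D: "D \<in> A" "((\<lambda>w. scaleC_op (inverse (w - z)) (F w - F z)) \<longlongrightarrow> D) (at z)"
    using kms_analytic_deriv[OF assms] by blast
  have "((\<lambda>w. w - z) \<longlongrightarrow> 0) (at z)" by (rule tendsto_eq_intros refl | simp)+
  from tendsto_scaleC_op[OF this D(2)]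
  have lim: "((\<lambda>w. scaleC_op ((w - z) * inverse (w - z)) (F w - F z)) \<longlongrightarrow> 0) (at z)"
    using scaleC_op_of_real[of 0 D] by simp
  have "((\<lambda>w. F w - F z) \<longlongrightarrow> 0) (at z)"
    by (rule Lim_transform_eventually[OF lim]) (auto simp: eventually_at_filter)
  then show "isCont F z" unfolding isCont_def by (rule LIM_zero_cancel)
qed

lemma kms_analytic_add:
  assumes "kms_analytic a F" "kms_analytic a' F'" shows "kms_analytic (a + a') (\<lambda>z. F z + F' z)"
  unfolding kms_analytic_def entire_extension_def
proof (intro conjI allI ballI)
  show "range (\<lambda>z. F z + F' z) \<subseteq> A" using assms by (auto intro: A_add kms_analytic_F_A)
  show "a + a' \<in> A" using assms by (auto intro: A_add kms_analytic_A)
  then show "F (of_real t) + F' (of_real t) = \<sigma> t (a + a')" for t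
    using assms by (simp add: kms_analytic_real dynamics_eq[OF \<sigma>] conj_phase_add)
  fix z
  obtain D where D: "((\<lambda>w. scaleC_op (inverse (w - z)) (F w - F z)) \<longlongrightarrow> D) (at z)"
    by (rule kms_analytic_deriv[OF assms(1)])
  obtain D' where D': "((\<lambda>w. scaleC_op (inverse (w - z)) (F' w - F' z)) \<longlongrightarrow> D') (at z)"
    by (rule kms_analytic_deriv[OF assms(2)])
  have eq: "scaleC_op c (F w + F' w - (F z + F' z)) = scaleC_op c (F w - F z) + scaleC_op c (F' w - F' z)" for c w
    by (simp only: scaleC_op_add[symmetric] add_diff_add)
  show "\<exists>D. ((\<lambda>w. scaleC_op (inverse (w - z)) (F w + F' w - (F z + F' z))) \<longlongrightarrow> D) (at z)"
    unfolding eq by (rule exI, rule tendsto_add[OF D D'])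
next
  fix b assume "b \<in> A"
  then show "\<phi> ((a + a') o\<^sub>L b) = \<phi> (b o\<^sub>L (F (\<i> * complex_of_real \<beta>) + F' (\<i> * complex_of_real \<beta>)))"
    using assms by (simp add: blinfun_compose_add_left blinfun_compose_add_right \<phi>_add corner_mult kms_analytic_A kms_analytic_F_A kms_analytic_kms)
qed

lemma kms_analytic_scaleC:
  assumes "kms_analytic a F" shows "kms_analytic (scaleC_op c a) (\<lambda>z. scaleC_op c (F z))"
  unfolding kms_analytic_def entire_extension_def
proof (intro conjI allI ballI)
  show "range (\<lambda>z. scaleC_op c (F z)) \<subseteq> A" using assms by (auto intro: corner_scaleC kms_analytic_F_A)
  show "scaleC_op c a \<in> A" using assms by (auto intro: corner_scaleC kms_analytic_A)
  then show "scaleC_op c (F (of_real t)) = \<sigma> t (scaleC_op c a)" for t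
    using assms by (simp add: kms_analytic_real dynamics_eq[OF \<sigma>] conj_phase_scaleC)
  fix z
  obtain D where D: "((\<lambda>w. scaleC_op (inverse (w - z)) (F w - F z)) \<longlongrightarrow> D) (at z)"
    by (rule kms_analytic_deriv[OF assms])
  have eq: "scaleC_op d (scaleC_op c (F w) - scaleC_op c (F z)) = scaleC_op c (scaleC_op d (F w - F z))" for d w
    by (simp add: scaleC_op_diff mult.commute)
  show "\<exists>D. ((\<lambda>w. scaleC_op (inverse (w - z)) (scaleC_op c (F w) - scaleC_op c (F z))) \<longlongrightarrow> D) (at z)"
    unfolding eq by (rule exI, rule tendsto_scaleC_op[OF tendsto_const D])
next
  fix b assume "b \<in> A"
  then show "\<phi> (scaleC_op c a o\<^sub>L b) = \<phi> (b o\<^sub>L scaleC_op c (F (\<i> * complex_of_real \<beta>)))"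
    using assms by (simp add: scaleC_op_compose_left compose_scaleC_right corner_complex_linear \<phi>_scaleC
        corner_mult kms_analytic_A kms_analytic_F_A kms_analytic_kms)
qed

lemma kms_analytic_zero: "kms_analytic 0 (\<lambda>_. 0)"
  by (auto simp: kms_analytic_def entire_extension_def A_zero dynamics_eq[OF \<sigma>] conj_phase_null)

text \<open>The KMS condition is only given for pairs from a set with dense span; it extends to all \<open>b\<close>
  and to linear combinations of the \<open>a\<close>.\<close>

lemma kms_analytic_dense:
  assumes "a \<in> A" "\<epsilon> > 0" obtains a' F where "kms_analytic a' F" "norm (a' - a) < \<epsilon>"
proof -
  obtain S where S: "S \<subseteq> A" "A \<subseteq> closure (span {scaleC_op c a | c a. a \<in> S})"
    "\<And>a. a \<in> S \<Longrightarrow> \<exists>F. entire_extension A \<sigma> a F \<and> (\<forall>b\<in>S. \<phi> (a o\<^sub>L b) = \<phi> (b o\<^sub>L F (\<i> * complex_of_real \<beta>)))"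
    using \<phi> unfolding is_kms_state_def by blast
  let ?S = "{scaleC_op c a | c a. a \<in> S}"
  have S_A: "span ?S \<subseteq> A"
    by (rule span_minimal[OF _ subspace_corner]) (use S(1) in \<open>auto intro: corner_scaleC\<close>)
  have kms_analytic_S: "\<exists>F. kms_analytic s F" if s: "s \<in> S" for s
  proof -
    obtain F where F: "entire_extension A \<sigma> s F" "\<And>b. b \<in> S \<Longrightarrow> \<phi> (s o\<^sub>L b) = \<phi> (b o\<^sub>L F (\<i> * complex_of_real \<beta>))"
      using S(3)[OF s] by blast
    define w where "w = F (\<i> * complex_of_real \<beta>)"
    have wA: "w \<in> A" and sA: "s \<in> A" using F(1) s S(1) by (auto simp: w_def entire_extension_def)
    \<comment> \<open>For fixed \<open>s\<close> both sides are complex linear and norm continuous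
      in \<open>b\<close>, so the identity passes from \<open>S\<close> to the closure of its
      complex span.\<close>
    have span: "b \<in> A \<and> \<phi> (s o\<^sub>L b) = \<phi> (b o\<^sub>L w)" if "b \<in> span ?S" for b
      using that
    proof (induction rule: span_induct_alt)
      case base
      then show ?case by (simp add: A_zero)
    next
      case (step r b c)
      then obtain d b' where b': "b = scaleC_op d b'" "b' \<in> S" by blast
      have "b' \<in> A" using b' S(1) by auto
      then have bA: "b \<in> A" unfolding b' by (rule corner_scaleC)
      have "\<phi> (s o\<^sub>L b) = \<phi> (b o\<^sub>L w)"
        unfolding b' using F(2)[OF b'(2)] \<open>b' \<in> A\<close> wA sA
        by (simp add: scaleC_op_compose_left compose_scaleC_right corner_complex_linear \<phi>_scaleC corner_mult w_def)
      then show ?case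
        using step(2) bA wA sA
        by (simp add: blinfun_compose_add_left blinfun_compose_add_right blinfun_compose_scaleR_left
            blinfun_compose_scaleR_right \<phi>_add \<phi>_scaleR corner_mult A_scaleR A_add)
    qed
    have "\<phi> (s o\<^sub>L b) = \<phi> (b o\<^sub>L w)" if b: "b \<in> A" for b
    proof -
      have "b \<in> closure (span ?S)" using b S(2) by blast
      then obtain X where X: "\<And>n. X n \<in> span ?S" "X \<longlonglongrightarrow> b"
        unfolding closure_sequential by blast
      have XA: "X n \<in> A" for n using X(1) S_A by blast
      have "(\<lambda>n. \<phi> (s o\<^sub>L X n)) \<longlonglongrightarrow> \<phi> (s o\<^sub>L b)"
        by (rule tendsto_\<phi>) (auto intro!: tendsto_intros X corner_mult sA XA b)
      moreover have "(\<lambda>n. \<phi> (X n o\<^sub>L w)) \<longlonglongrightarrow> \<phi> (b o\<^sub>L w)"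
        by (rule tendsto_\<phi>) (auto intro!: tendsto_intros X corner_mult wA XA b)
      ultimately show ?thesis using span[OF X(1)] LIMSEQ_unique by auto
    qed
    then have "kms_analytic s F" using F(1) sA by (simp add: kms_analytic_def w_def)
    then show ?thesis by blast
  qed
  have "\<exists>F. kms_analytic b F" if "b \<in> span ?S" for b
    using that
  proof (induction rule: span_induct_alt)
    case base
    then show ?case using kms_analytic_zero by blast
  next
    case (step r b c)
    then obtain d b' F F' where "b = scaleC_op d b'" "kms_analytic b' F" "kms_analytic c F'" using kms_analytic_S by blast
    then have "kms_analytic (scaleC_op (of_real r) b + c) (\<lambda>z. scaleC_op (of_real r) (scaleC_op d (F z)) + F' z)"
      by (intro kms_analytic_add kms_analytic_scaleC) (auto intro: kms_analytic_scaleC)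
    then show ?case by (auto simp: scaleC_op_of_real)
  qed
  moreover have "a \<in> closure (span ?S)" using assms(1) S(2) by blast
  then obtain a' where "a' \<in> span ?S" "norm (a' - a) < \<epsilon>"
    using assms(2) unfolding closure_approachable dist_norm by meson
  ultimately show ?thesis using that by blast
qed

text \<open>An analytic \<open>a\<close> close to \<open>m\<close> makes \<open>G\<close> almost
  constant on each boundary line of the strip, with an error independent of the real part. Comparing
  the two constants gives the identity up to the distance of \<open>a\<close> and
  \<open>m\<close>.\<close>

lemma kms_homogeneous:
  assumes f: "f \<in> slice g" and b: "b \<in> A"
  shows "\<phi> (monomial act f g o\<^sub>L b) = of_real (N g powr - \<beta>) * \<phi> (b o\<^sub>L monomial act f g)"
proof -
  define m where "m = monomial act f g"
  define k where "k = exp (\<beta> * log_N g)"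
  have mA: "m \<in> A" unfolding m_def using f by (rule monomial_corner)
  have conj_m: "conj_phase t m = scaleC_op (cis (t * log_N g)) m" for t
    unfolding m_def using f by (simp add: conj_phase_monomial slice_bounded)
  \<comment> \<open>One bound has to serve both lines; on the shifted line an extra factor
    \<open>k\<close> appears, whence \<open>max 1 k\<close>.\<close>
  have small: "cmod (\<phi> (b o\<^sub>L m) - of_real k * \<phi> (m o\<^sub>L b)) \<le> 2 * (max 1 k * (norm b * \<epsilon>))" if "\<epsilon> > 0" for \<epsilon>
  proof -
    obtain a F where kms_analytic: "kms_analytic a F" and a: "norm (a - m) < \<epsilon>" using kms_analytic_dense[OF mA \<open>\<epsilon> > 0\<close>] .
    note aA = kms_analytic_A[OF kms_analytic] and FA = kms_analytic_F_A[OF kms_analytic]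
    \<comment> \<open>The exponential cancels the eigenvalue of \<open>m\<close>: for
      \<open>a = m\<close> the function would be constant.\<close>
    define G where "G z = \<phi> (b o\<^sub>L F z) * exp (- \<i> * z * of_real (log_N g))" for z
    have "(\<lambda>z. \<phi> (b o\<^sub>L F z)) holomorphic_on UNIV"
    proof (rule kms_analytic_holomorphic[OF kms_analytic, of "\<lambda>c. \<phi> (b o\<^sub>L c)"])
      fix c d e assume cd: "c \<in> A" "d \<in> A"
      have "b o\<^sub>L (c - d) = (b o\<^sub>L c) - (b o\<^sub>L d)" by (rule blinfun_eqI) (simp add: blinfun.bilinear_simps)
      then show "\<phi> (b o\<^sub>L (c - d)) = \<phi> (b o\<^sub>L c) - \<phi> (b o\<^sub>L d)" using b cd by (simp add: \<phi>_diff corner_mult)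
    next
      fix c e assume "c \<in> A"
      then show "\<phi> (b o\<^sub>L scaleC_op e c) = e * \<phi> (b o\<^sub>L c)"
        using b by (simp add: compose_scaleC_right corner_complex_linear \<phi>_scaleC corner_mult)
    next
      fix X c and H :: "complex filter" assume "(X \<longlongrightarrow> c) H" "\<And>n. X n \<in> A" "c \<in> A"
      then show "((\<lambda>n. \<phi> (b o\<^sub>L X n)) \<longlongrightarrow> \<phi> (b o\<^sub>L c)) H"
        using b by (intro tendsto_\<phi>) (auto intro!: tendsto_intros corner_mult)
    qed
    then have hol: "G holomorphic_on UNIV" unfolding G_def by (intro holomorphic_intros)
    have exp_eq: "exp (- \<i> * (of_real t + \<i> * of_real s) * of_real (log_N g)) = cis (- t * log_N g) * of_real (exp (s * log_N g))" for t s
    proof -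
      have "- \<i> * (of_real t + \<i> * of_real s) * of_real (log_N g) = \<i> * of_real (- t * log_N g) + complex_of_real (s * log_N g)"
        by (simp add: algebra_simps)
      then show ?thesis by (simp only: exp_add cis_conv_exp exp_of_real)
    qed
    have exp_real: "exp (- \<i> * of_real t * of_real (log_N g)) = cis (- t * log_N g)" for t
      using exp_eq[of t 0] by simp
    have bot: "cmod (G (of_real t) - \<phi> (b o\<^sub>L m)) \<le> max 1 k * (norm b * \<epsilon>)" for t
    proof -
      have "\<phi> (b o\<^sub>L m) = cis (- t * log_N g) * \<phi> (b o\<^sub>L conj_phase t m)"
        using b mA by (simp add: conj_m compose_scaleC_right corner_complex_linear \<phi>_scaleC corner_mult cis_mult mult.assoc[symmetric])
      then have "G (of_real t) - \<phi> (b o\<^sub>L m) = cis (- t * log_N g) * (\<phi> (b o\<^sub>L conj_phase t a) - \<phi> (b o\<^sub>L conj_phase t m))"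
        unfolding G_def exp_real kms_analytic_real[OF kms_analytic] by (simp add: algebra_simps)
      also have "\<phi> (b o\<^sub>L conj_phase t a) - \<phi> (b o\<^sub>L conj_phase t m) = \<phi> (b o\<^sub>L conj_phase t (a - m))"
      proof -
        have "b o\<^sub>L conj_phase t (a - m) = (b o\<^sub>L conj_phase t a) - (b o\<^sub>L conj_phase t m)"
          by (rule blinfun_eqI) (simp add: conj_phase_def blinfun.bilinear_simps)
        then show ?thesis using b aA mA by (simp add: \<phi>_diff corner_mult conj_phase_corner)
      qed
      finally have "cmod (G (of_real t) - \<phi> (b o\<^sub>L m)) = cmod (\<phi> (b o\<^sub>L conj_phase t (a - m)))"
        by (simp add: norm_mult)
      also have "\<dots> \<le> norm (b o\<^sub>L conj_phase t (a - m))"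
        using b aA mA by (intro \<phi>_bound corner_mult conj_phase_corner A_diff)
      also have "\<dots> \<le> norm b * norm (conj_phase t (a - m))" by (rule norm_blinfun_compose)
      also have "\<dots> \<le> norm b * \<epsilon>"
        using norm_conj_phase_le[of t "a - m"] a by (intro mult_left_mono) auto
      also have "\<dots> \<le> max 1 k * (norm b * \<epsilon>)"
        using \<open>\<epsilon> > 0\<close> mult_right_mono[of 1 "max 1 k" "norm b * \<epsilon>"] by simp
      finally show ?thesis .
    qed
    have top: "cmod (G (of_real t + \<i> * of_real \<beta>) - of_real k * \<phi> (m o\<^sub>L b)) \<le> max 1 k * (norm b * \<epsilon>)" for t
    proof -
      \<comment> \<open>Invariance moves the phase from \<open>F (\<i> * \<beta>)\<close> to
        \<open>b\<close>, the KMS condition exchanges the factors, and invariance moves the phase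
        back onto \<open>a\<close>.\<close>
      have "\<phi> (b o\<^sub>L F (of_real t + \<i> * of_real \<beta>)) = \<phi> (b o\<^sub>L conj_phase t (F (\<i> * of_real \<beta>)))"
        using kms_analytic_shift[OF kms_analytic, of "\<i> * of_real \<beta>" t] by (simp add: add.commute)
      also have "\<dots> = \<phi> (conj_phase (- t) (b o\<^sub>L conj_phase t (F (\<i> * of_real \<beta>))))"
        using b FA by (intro \<phi>_conj_phase[symmetric] corner_mult conj_phase_corner)
      also have "\<dots> = \<phi> (conj_phase (- t) b o\<^sub>L F (\<i> * of_real \<beta>))"
        by (simp add: conj_phase_mult conj_phase_conj_phase conj_phase_zero)
      also have "\<dots> = \<phi> (a o\<^sub>L conj_phase (- t) b)"
        using kms_analytic_kms[OF kms_analytic] b by (simp add: conj_phase_corner)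
      also have "\<dots> = \<phi> (conj_phase t (a o\<^sub>L conj_phase (- t) b))"
        using b aA by (intro \<phi>_conj_phase[symmetric] corner_mult conj_phase_corner)
      also have "\<dots> = \<phi> (conj_phase t a o\<^sub>L b)"
        by (simp add: conj_phase_mult conj_phase_conj_phase conj_phase_zero)
      finally have 1: "G (of_real t + \<i> * of_real \<beta>) = of_real k * (cis (- t * log_N g) * \<phi> (conj_phase t a o\<^sub>L b))"
        unfolding G_def exp_eq k_def by simp
      have "\<phi> (m o\<^sub>L b) = cis (- t * log_N g) * \<phi> (conj_phase t m o\<^sub>L b)"
        using b mA by (simp add: conj_m scaleC_op_compose_left \<phi>_scaleC corner_mult cis_mult mult.assoc[symmetric])
      then have "G (of_real t + \<i> * of_real \<beta>) - of_real k * \<phi> (m o\<^sub>L b) =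
          of_real k * (cis (- t * log_N g) * (\<phi> (conj_phase t a o\<^sub>L b) - \<phi> (conj_phase t m o\<^sub>L b)))"
        unfolding 1 by (simp add: algebra_simps)
      also have "\<phi> (conj_phase t a o\<^sub>L b) - \<phi> (conj_phase t m o\<^sub>L b) = \<phi> (conj_phase t (a - m) o\<^sub>L b)"
      proof -
        have "conj_phase t (a - m) o\<^sub>L b = (conj_phase t a o\<^sub>L b) - (conj_phase t m o\<^sub>L b)"
          by (rule blinfun_eqI) (simp add: conj_phase_def blinfun.bilinear_simps)
        then show ?thesis using b aA mA by (simp add: \<phi>_diff corner_mult conj_phase_corner)
      qed
      finally have "cmod (G (of_real t + \<i> * of_real \<beta>) - of_real k * \<phi> (m o\<^sub>L b)) = k * cmod (\<phi> (conj_phase t (a - m) o\<^sub>L b))"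
        by (simp add: norm_mult k_def)
      also have "cmod (\<phi> (conj_phase t (a - m) o\<^sub>L b)) \<le> norm (conj_phase t (a - m) o\<^sub>L b)"
        using b aA mA by (intro \<phi>_bound corner_mult conj_phase_corner A_diff)
      also have "\<dots> \<le> norm (conj_phase t (a - m)) * norm b" by (rule norm_blinfun_compose)
      also have "\<dots> \<le> \<epsilon> * norm b"
        using norm_conj_phase_le[of t "a - m"] a by (intro mult_right_mono) auto
      also have "k * (\<epsilon> * norm b) \<le> max 1 k * (norm b * \<epsilon>)"
        using \<open>\<epsilon> > 0\<close> mult_right_mono[of k "max 1 k" "norm b * \<epsilon>"] by (simp add: mult.commute)
      finally show ?thesis by (simp add: k_def mult_left_mono)
    qed
    \<comment> \<open>By \<open>kms_analytic_shift\<close> a real translation does not increase the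
      norm of \<open>F\<close>, so a bound on this segment holds on the whole strip.\<close>
    define seg where "seg = closed_segment 0 (\<i> * complex_of_real \<beta>)"
    have "compact (F ` seg)"
      unfolding seg_def by (intro compact_continuous_image continuous_on_subset[OF kms_analytic_continuous[OF kms_analytic]]) auto
    then have "bounded (F ` seg)" by (rule compact_imp_bounded)
    then obtain B where B: "\<And>z. z \<in> seg \<Longrightarrow> norm (F z) \<le> B" by (auto simp: bounded_iff)
    have bound: "cmod (G (of_real t + z)) \<le> (norm b * \<bar>B\<bar>) * exp (\<bar>\<beta>\<bar> * \<bar>log_N g\<bar>)" if z: "z \<in> seg" for t z
    proof -
      obtain u where u: "0 \<le> u" "u \<le> 1" "z = \<i> * of_real (u * \<beta>)"
        using z unfolding seg_def in_segment by (auto simp: scaleR_conv_of_real mult.commute mult.left_commute)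
      have "cmod (\<phi> (b o\<^sub>L F (of_real t + z))) \<le> norm (b o\<^sub>L F (of_real t + z))"
        using b FA by (intro \<phi>_bound corner_mult)
      also have "\<dots> \<le> norm b * norm (F (of_real t + z))" by (rule norm_blinfun_compose)
      also have "norm b * norm (F (of_real t + z)) \<le> norm b * \<bar>B\<bar>"
        using norm_conj_phase_le[of t "F z"] B[OF z] kms_analytic_shift[OF kms_analytic, of z t]
        by (intro mult_left_mono) (auto simp: add.commute)
      finally have 1: "cmod (\<phi> (b o\<^sub>L F (of_real t + z))) \<le> norm b * \<bar>B\<bar>" .
      have "cmod (exp (- \<i> * (of_real t + z) * of_real (log_N g))) = exp (u * \<beta> * log_N g)"
        unfolding u(3) exp_eq by (simp add: norm_mult)
      also have "\<dots> \<le> exp (\<bar>\<beta>\<bar> * \<bar>log_N g\<bar>)"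
      proof -
        have "u * \<beta> * log_N g \<le> \<bar>u * \<beta> * log_N g\<bar>" by simp
        also have "\<dots> = u * (\<bar>\<beta>\<bar> * \<bar>log_N g\<bar>)" using u(1) by (simp add: abs_mult)
        also have "\<dots> \<le> 1 * (\<bar>\<beta>\<bar> * \<bar>log_N g\<bar>)" using u(2) by (intro mult_right_mono) auto
        finally show ?thesis by simp
      qed
      finally show ?thesis unfolding G_def norm_mult using 1 by (intro mult_mono) auto
    qed
    show ?thesis
      by (rule strip_boundary_values[OF hol bot top bound[unfolded seg_def]])
  qed
  have "cmod (\<phi> (b o\<^sub>L m) - of_real k * \<phi> (m o\<^sub>L b)) \<le> 0"
  proof (rule tendsto_lowerbound)
    show "((\<lambda>\<epsilon>. 2 * (max 1 k * (norm b * \<epsilon>))) \<longlongrightarrow> 0) (at_right 0)"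
      by (rule tendsto_eq_intros refl | simp)+
    show "\<forall>\<^sub>F \<epsilon> in at_right 0. cmod (\<phi> (b o\<^sub>L m) - of_real k * \<phi> (m o\<^sub>L b)) \<le> 2 * (max 1 k * (norm b * \<epsilon>))"
      using small eventually_at_right_less[of 0] by (auto elim: eventually_mono)
  qed simp
  then have "\<phi> (b o\<^sub>L m) = of_real k * \<phi> (m o\<^sub>L b)" by simp
  moreover have "of_real (N g powr - \<beta>) * complex_of_real k = 1"
    by (simp add: N_powr k_def exp_minus flip: of_real_mult)
  ultimately show ?thesis unfolding m_def by (simp add: mult.assoc[symmetric])
qed

end

section \<open>From KMS states to measures\<close>

lemma C0_real_sqrt:
  assumes "f \<in> C0_real" "\<And>x. 0 \<le> f x" shows "(\<lambda>x. sqrt (f x)) \<in> C0_real"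
  unfolding C0_real_def C0_def
proof (intro CollectI conjI allI impI)
  show "continuous_on UNIV (\<lambda>x. complex_of_real (sqrt (f x)))"
    by (intro continuous_intros C0_real_cont assms)
  fix \<epsilon> :: real assume "\<epsilon> > 0"
  then have "\<epsilon>\<^sup>2 > 0" by simp
  then obtain K where K: "compact K" "\<And>x. x \<notin> K \<Longrightarrow> \<bar>f x\<bar> < \<epsilon>\<^sup>2"
    using C0_real_small[OF assms(1)] by blast
  have "cmod (of_real (sqrt (f x))) < \<epsilon>" if "x \<notin> K" for x
    using K(2)[OF that] assms(2)[of x] \<open>\<epsilon> > 0\<close> real_sqrt_less_mono[of "f x" "\<epsilon>\<^sup>2"] by simp
  with K(1) show "\<exists>K. compact K \<and> (\<forall>x. x \<notin> K \<longrightarrow> cmod (of_real (sqrt (f x))) < \<epsilon>)" by blast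
qed

lemma C0_real_mult: "f \<in> C0_real \<Longrightarrow> h \<in> C0_real \<Longrightarrow> (\<lambda>x. f x * h x) \<in> C0_real"
  using C0_real_bounded[of f] C0_real_mult_bounded[of h f] C0_real_cont[of f] by blast

lemma C0_real_parts:
  assumes "f \<in> C0"
  shows "(\<lambda>x. Re (f x)) \<in> C0_real" "(\<lambda>x. Im (f x)) \<in> C0_real" "(\<lambda>x. cmod (f x)) \<in> C0_real"
proof -
  have "continuous_on UNIV f" using assms by (simp add: C0_def)
  then show "(\<lambda>x. Re (f x)) \<in> C0_real" "(\<lambda>x. Im (f x)) \<in> C0_real" "(\<lambda>x. cmod (f x)) \<in> C0_real"
    unfolding C0_real_def
    by (auto intro!: C0_dominated[OF assms, where c = 1] continuous_intros simp: abs_Re_le_cmod abs_Im_le_cmod)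
qed

text \<open>The second factor when \<open>f\<close> is split as \<open>sqrt (cmod f)\<close> times a
  function. At 0 the quotient is 0 by convention, and its modulus is \<open>sqrt (cmod z)\<close>,
  which tends to 0.\<close>

lemma continuous_div_sqrt_cmod: "continuous_on UNIV (\<lambda>z :: complex. z / of_real (sqrt (cmod z)))"
proof (rule continuous_at_imp_continuous_on, rule ballI)
  fix z :: complex
  show "isCont (\<lambda>z. z / of_real (sqrt (cmod z))) z"
  proof (cases "z = 0")
    case False
    then show ?thesis by (intro continuous_intros) auto
  next
    case True
    have "((\<lambda>z. z / of_real (sqrt (cmod z))) \<longlongrightarrow> 0) (at (0 :: complex))"
    proof (rule Lim_null_comparison)
      show "\<forall>\<^sub>F z in at 0. norm (z / complex_of_real (sqrt (cmod z))) \<le> sqrt (cmod z)"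
        by (auto simp: norm_divide real_div_sqrt)
      show "((\<lambda>z :: complex. sqrt (cmod z)) \<longlongrightarrow> 0) (at 0)"
        by (rule tendsto_eq_intros refl | simp)+
    qed
    then show ?thesis using True by (simp add: isCont_def)
  qed
qed

text \<open>The quadratic form \<open>c \<mapsto> \<phi> ((a + c b)\<^sup>* (a + c b))\<close> of a positive functional yields the
  Cauchy-Schwarz inequality.\<close>

lemma nonneg_quadratic_form:
  assumes nonneg: "\<And>c. p + c * x + cnj c * y + c * cnj c * q \<in> \<real>\<^sub>\<ge>\<^sub>0"
    and q: "q \<in> \<real>\<^sub>\<ge>\<^sub>0" "Re q \<le> Q" "0 < Q"
  shows "(cmod x)\<^sup>2 \<le> Re p * Q"
proof -
  have p: "p \<in> \<real>\<^sub>\<ge>\<^sub>0" using nonneg[of 0] by simp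
  \<comment> \<open>Testing the form with 1 and \<open>\<i>\<close> shows that it is
    Hermitian.\<close>
  have "Im x + Im y = 0"
    using nonneg[of 1] p q(1) by (auto simp: complex_nonneg_Reals_iff)
  moreover have "Re x - Re y = 0"
    using nonneg[of \<i>] p q(1) by (auto simp: complex_nonneg_Reals_iff)
  ultimately have y: "y = cnj x" by (simp add: complex_eq_iff)
  \<comment> \<open>The minimising factor would be \<open>1 / Re q\<close>; the positive bound
    \<open>Q\<close> avoids division by 0.\<close>
  define s where "s = 1 / Q"
  define c where "c = - of_real s * cnj x"
  have "0 \<le> Re (p + c * x + cnj c * y + c * cnj c * q)"
    using nonneg[of c] by (simp add: complex_nonneg_Reals_iff)
  also have "p + c * x + cnj c * y + c * cnj c * q =
      p - of_real (2 * s * (cmod x)\<^sup>2) + of_real (s\<^sup>2 * (cmod x)\<^sup>2) * q"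
    unfolding c_def y of_real_mult complex_norm_square by (simp add: algebra_simps power2_eq_square)
  also have "Re \<dots> = Re p - 2 * s * (cmod x)\<^sup>2 + s\<^sup>2 * (cmod x)\<^sup>2 * Re q"
    by simp
  finally have "2 * s * (cmod x)\<^sup>2 \<le> Re p + s\<^sup>2 * (cmod x)\<^sup>2 * Re q" by simp
  also have "s\<^sup>2 * (cmod x)\<^sup>2 * Re q \<le> s\<^sup>2 * (cmod x)\<^sup>2 * Q"
    using q(2) by (intro mult_left_mono) auto
  also have "\<dots> = s * (cmod x)\<^sup>2" using q(3) by (simp add: s_def power2_eq_square)
  finally have "s * (cmod x)\<^sup>2 \<le> Re p" by simp
  then show ?thesis using q(3) by (simp add: s_def field_simps)
qed

text \<open>Tonelli for series, one of the two sums being read as an integral over the counting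
  measure.\<close>

lemma suminf_swap_ennreal: "(\<Sum>i. \<Sum>j. f i j) = (\<Sum>j. \<Sum>i. f i j :: ennreal)"
proof -
  have "(\<Sum>i. \<Sum>j. f i j) = (\<integral>\<^sup>+i. (\<Sum>j. f i j) \<partial>count_space UNIV)"
    by (rule nn_integral_count_space_nat[symmetric])
  also have "\<dots> = (\<Sum>j. \<integral>\<^sup>+i. f i j \<partial>count_space UNIV)"
    by (rule nn_integral_suminf) simp
  finally show ?thesis by (simp add: nn_integral_count_space_nat)
qed

context transformation
begin

lemma slice_add: "f \<in> slice g \<Longrightarrow> h \<in> slice g \<Longrightarrow> (\<lambda>x. f x + h x) \<in> slice g"
  using C0_add[of f h] by (auto simp: slice_def) (metis add.right_neutral)+

lemma slice_zero_fun: "(\<lambda>_. 0) \<in> slice g"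
  by (auto simp: slice_def C0_def intro!: exI[of _ "{}"])

lemma slice_sum: "(\<And>i. i \<in> I \<Longrightarrow> F i \<in> slice g) \<Longrightarrow> (\<lambda>x. \<Sum>i\<in>I. F i x) \<in> slice g"
  by (induction I rule: infinite_finite_induct) (auto intro: slice_add slice_zero_fun)

lemma slice_mult_bounded:
  assumes "f \<in> slice g" "continuous_on UNIV u" "\<And>x. \<bar>u x\<bar> \<le> C"
  shows "(\<lambda>x. complex_of_real (u x) * f x) \<in> slice g"
proof -
  have "(\<lambda>x. complex_of_real (u x) * f x) \<in> C0"
    using assms(2,3) by (intro C0_mult_bounded slice_C0[OF assms(1)] continuous_intros) (auto simp: bounded_iff)
  then show ?thesis using assms(1) by (auto simp: slice_def)
qed

lemma C0_real_compose_act: "f \<in> C0_real \<Longrightarrow> (\<lambda>x. f (act g x)) \<in> C0_real"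
  using C0_compose_act unfolding C0_real_def by fastforce

text \<open>A point moved by \<open>g\<close> is separated from its image by a Urysohn function, and
  the set where a function differs from its translate is open. The Lindelof property leaves
  countably many functions, as the partial sums in \<open>\<phi>_vanishes\<close> require.\<close>

lemma C0_real_separate:
  obtains h :: "nat \<Rightarrow> 'x \<Rightarrow> real" where "\<And>i. h i \<in> C0_real"
    "\<And>x. act g x \<noteq> x \<Longrightarrow> \<exists>i. h i x \<noteq> h i (act g x)"
proof -
  define Sep where "Sep h = {x. h x \<noteq> (h (act g x) :: real)}" for h
  define F where "F = Sep ` C0_real"
  have "open S" if "S \<in> F" for S
    using that unfolding F_def Sep_def
    by (auto intro!: open_Collect_neq C0_real_cont C0_real_compose_act)
  then obtain F' where F': "F' \<subseteq> F" "countable F'" "\<Union>F' = \<Union>F" by (rule Lindelof)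
  obtain H' where H': "H' \<subseteq> C0_real" "countable H'" "F' = Sep ` H'"
    using F'(1,2) unfolding F_def by (metis countable_image_eq_inj countable_subset_image)
  define h where "h = from_nat_into (insert (\<lambda>_. 0) H')"
  have range_h: "range h = insert (\<lambda>_. 0) H'"
    unfolding h_def by (rule range_from_nat_into) (use H'(2) in auto)
  show ?thesis
  proof (rule that[of h])
    fix i
    have "h i \<in> insert (\<lambda>_. 0) H'" unfolding range_h[symmetric] by (rule rangeI)
    then show "h i \<in> C0_real" using H'(1) C0_real_zero by (elim insertE) auto
  next
    fix x assume "act g x \<noteq> x"
    then have "open (- {act g x})" "x \<in> - {act g x}" by auto
    then obtain k where "k \<in> C0_real" "k x = 1" "\<And>y. y \<notin> - {act g x} \<Longrightarrow> k y = 0"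
      using C0_real_Urysohn[OF lc] by metis
    then have "k \<in> C0_real" "x \<in> Sep k" by (auto simp: Sep_def)
    then have "x \<in> \<Union>F" unfolding F_def by blast
    then obtain h' where "h' \<in> H'" "x \<in> Sep h'" using F'(3) H'(3) by auto
    moreover then obtain i where "h' = h i" using range_h by (metis insertI2 rangeE)
    ultimately show "\<exists>i. h i x \<noteq> h i (act g x)" by (auto simp: Sep_def)
  qed
qed

end

section \<open>The measure of a KMS state on Y\<close>

context kms_state
begin

text \<open>The indicator makes every function on \<open>X\<close> act through its values on
  \<open>Y\<close>, so the representation theorem can be applied on \<open>X\<close> itself.\<close>

definition mult_op :: "('x \<Rightarrow> real) \<Rightarrow> ('g \<times> 'x) op"
  where "mult_op f = monomial act (\<lambda>x. indicator Y x * complex_of_real (f x)) 0"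

lemma mult_slice: "f \<in> C0_real \<Longrightarrow> (\<lambda>x. indicator Y x * complex_of_real (f x)) \<in> slice 0"
  using continuous_indicator_clopen[OF open_Y closed_Y]
  by (intro slice_0I C0_mult_bounded bounded_range_indicator) (auto simp: C0_real_def)

lemma mult_op_A: "f \<in> C0_real \<Longrightarrow> mult_op f \<in> A"
  unfolding mult_op_def by (intro monomial_corner mult_slice)

lemma mult_op_add: "f \<in> C0_real \<Longrightarrow> h \<in> C0_real \<Longrightarrow> mult_op (\<lambda>x. f x + h x) = mult_op f + mult_op h"
  unfolding mult_op_def by (subst monomial_add[symmetric]) (auto intro: slice_bounded mult_slice simp: distrib_left)

lemma mult_op_scale: "f \<in> C0_real \<Longrightarrow> mult_op (\<lambda>x. c * f x) = c *\<^sub>R mult_op f"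
  unfolding mult_op_def scaleC_op_of_real[symmetric]
  by (subst monomial_scaleC[symmetric]) (auto intro: slice_bounded mult_slice simp: mult_ac)

lemma mult_op_monomial:
  assumes "h \<in> C0_real" "f \<in> slice g"
  shows "mult_op h o\<^sub>L monomial act f g = monomial act (\<lambda>x. complex_of_real (h x) * f x) g"
    "monomial act f g o\<^sub>L mult_op h = monomial act (\<lambda>x. complex_of_real (h (act (- g) x)) * f x) g"
proof -
  have eq: "(\<lambda>x. indicator Y x * complex_of_real (h x) * f x) = (\<lambda>x. complex_of_real (h x) * f x)"
    "(\<lambda>x. f x * (indicator Y (act (- g) x) * complex_of_real (h (act (- g) x)))) =
      (\<lambda>x. complex_of_real (h (act (- g) x)) * f x)"
    using slice_zero[OF assms(2)] slice_zero'[OF assms(2)] by (auto simp: fun_eq_iff indicator_def)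
  show "mult_op h o\<^sub>L monomial act f g = monomial act (\<lambda>x. complex_of_real (h x) * f x) g"
    "monomial act f g o\<^sub>L mult_op h = monomial act (\<lambda>x. complex_of_real (h (act (- g) x)) * f x) g"
    unfolding mult_op_def
    using slice_bounded[OF mult_slice[OF assms(1)]] slice_bounded[OF assms(2)] eq
    by (simp_all add: monomial_mult act_0)
qed

lemma mult_op_mult:
  assumes "f \<in> C0_real" "h \<in> C0_real"
  shows "mult_op f o\<^sub>L mult_op h = mult_op (\<lambda>x. f x * h x)"
  unfolding mult_op_def[of h] mult_op_monomial(1)[OF assms(1) mult_slice[OF assms(2)]]
  by (simp add: mult_op_def mult_ac)

lemma is_adj_mult_op:
  assumes "f \<in> C0_real" shows "is_adj (mult_op f) (mult_op f)"
proof -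
  have "(\<lambda>x. cnj (indicator Y (act 0 x) * complex_of_real (f (act 0 x)))) = (\<lambda>x. indicator Y x * complex_of_real (f x))"
    by (auto simp: act_0 indicator_def)
  then show ?thesis
    using is_adj_monomial[OF slice_bounded[OF mult_slice[OF assms]], of 0] by (simp add: mult_op_def)
qed

lemma \<phi>_mult_op_nonneg:
  assumes "f \<in> C0_real" "\<And>x. 0 \<le> f x" shows "\<phi> (mult_op f) \<in> \<real>\<^sub>\<ge>\<^sub>0"
proof -
  define s where "s = (\<lambda>x. sqrt (f x))"
  have s: "s \<in> C0_real" unfolding s_def using assms by (rule C0_real_sqrt)
  have "adj (mult_op s) o\<^sub>L mult_op s = mult_op f"
    using assms(2) by (simp add: adj_eqI[OF is_adj_mult_op[OF s]] mult_op_mult[OF s s]) (simp add: s_def)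
  then show ?thesis using \<phi>_nonneg[OF mult_op_A[OF s]] by simp
qed

lemma norm_mult_op_le:
  assumes "\<And>x. \<bar>f x\<bar> \<le> C" "0 \<le> C" shows "norm (mult_op f) \<le> C"
  unfolding mult_op_def by (rule norm_monomial_le) (use assms in \<open>auto simp: indicator_def norm_mult\<close>)

sublocale riesz: bounded_positive_functional "\<lambda>f. Re (\<phi> (mult_op f))" 1
proof
  fix f :: "'x \<Rightarrow> real" assume f: "f \<in> C0_real" "\<And>x. 0 \<le> f x" "\<And>x. f x \<le> 1"
  have "Re (\<phi> (mult_op f)) \<le> cmod (\<phi> (mult_op f))" by (rule complex_Re_le_cmod)
  also have "\<dots> \<le> norm (mult_op f)" by (rule \<phi>_bound[OF mult_op_A[OF f(1)]])
  also have "\<dots> \<le> 1" by (rule norm_mult_op_le) (use f in auto)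
  finally show "Re (\<phi> (mult_op f)) \<le> 1" .
next
  fix f :: "'x \<Rightarrow> real" assume f: "f \<in> C0_real" "\<And>x. 0 \<le> f x"
  show "0 \<le> Re (\<phi> (mult_op f))"
    using \<phi>_mult_op_nonneg[OF f] by (simp add: complex_nonneg_Reals_iff)
qed (simp_all add: lc mult_op_add mult_op_scale mult_op_A \<phi>_add \<phi>_scaleR)

abbreviation "\<mu>\<^sub>0 \<equiv> riesz.riesz_measure"

sublocale \<mu>0: finite_measure \<mu>\<^sub>0
  by (rule riesz.finite_riesz_measure)

lemmas sets_\<mu>0 = riesz.sets_riesz_measure

lemma \<mu>0_measurable: "f \<in> borel_measurable borel \<Longrightarrow> f \<in> borel_measurable \<mu>\<^sub>0"
  by (simp add: measurable_cong_sets[OF sets_\<mu>0 refl])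

lemma \<mu>0_integrable: "f \<in> C0_real \<Longrightarrow> integrable \<mu>\<^sub>0 f"
  by (rule C0_real_integrable[OF riesz.finite_riesz_measure sets_\<mu>0])

text \<open>The representation theorem was applied to the real part. The imaginary part vanishes
  because \<phi> is nonnegative on the positive and on the negative part of
  \<open>f\<close>.\<close>

lemma \<phi>_mult_op:
  assumes f: "f \<in> C0_real" shows "\<phi> (mult_op f) = of_real (integral\<^sup>L \<mu>\<^sub>0 f)"
proof -
  define f1 f2 where "f1 = (\<lambda>x. max 0 (f x))" and "f2 = (\<lambda>x. max 0 (- 1 * f x))"
  have f12: "f1 \<in> C0_real" "f2 \<in> C0_real"
    unfolding f1_def f2_def by (intro C0_real_max C0_real_zero C0_real_scale f)+
  have "f = (\<lambda>x. f1 x + - 1 * f2 x)" by (auto simp: f1_def f2_def max_def)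
  then have "mult_op f = mult_op f1 + - 1 *\<^sub>R mult_op f2"
    using mult_op_add[OF f12(1) C0_real_scale[OF f12(2), of "- 1"]] mult_op_scale[OF f12(2), of "- 1"] by simp
  then have "\<phi> (mult_op f) = \<phi> (mult_op f1) - \<phi> (mult_op f2)"
    using \<phi>_diff[OF mult_op_A[OF f12(1)] mult_op_A[OF f12(2)]] by simp
  moreover have "Im (\<phi> (mult_op f1)) = 0" "Im (\<phi> (mult_op f2)) = 0"
    using \<phi>_mult_op_nonneg[OF f12(1)] \<phi>_mult_op_nonneg[OF f12(2)]
    by (auto simp: f1_def f2_def complex_nonneg_Reals_iff)
  ultimately have "Im (\<phi> (mult_op f)) = 0" by simp
  then show ?thesis by (intro complex_eqI) (simp_all add: riesz.integral_riesz_measure[OF f])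
qed

lemma \<phi>_slice_0:
  assumes f: "f \<in> slice 0" shows "\<phi> (monomial act f 0) = integral\<^sup>L \<mu>\<^sub>0 f"
proof -
  note parts = C0_real_parts[OF slice_C0[OF f]]
  have "monomial act f 0 = mult_op (\<lambda>x. Re (f x)) + scaleC_op \<i> (mult_op (\<lambda>x. Im (f x)))"
  proof -
    have "f = (\<lambda>x. indicator Y x * complex_of_real (Re (f x)) + \<i> * (indicator Y x * complex_of_real (Im (f x))))"
      using slice_zero[OF f] complex_eq[of "f _"] by (auto simp: fun_eq_iff indicator_def)
    then show ?thesis
      unfolding mult_op_def
      using monomial_add[of "\<lambda>x. indicator Y x * complex_of_real (Re (f x))" "\<lambda>x. \<i> * (indicator Y x * complex_of_real (Im (f x)))" act 0]
        monomial_scaleC[of "\<lambda>x. indicator Y x * complex_of_real (Im (f x))" act \<i> 0]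
        slice_bounded[OF mult_slice[OF parts(1)]] slice_bounded[OF mult_slice[OF parts(2)]]
        slice_bounded[OF slice_scale[OF mult_slice[OF parts(2)], of \<i>]]
      by simp
  qed
  then have "\<phi> (monomial act f 0) = of_real (\<integral>x. Re (f x) \<partial>\<mu>\<^sub>0) + \<i> * of_real (\<integral>x. Im (f x) \<partial>\<mu>\<^sub>0)"
    using parts by (simp add: \<phi>_add \<phi>_scaleC mult_op_A corner_scaleC \<phi>_mult_op)
  also have "\<dots> = (\<integral>x. of_real (Re (f x)) + \<i> * of_real (Im (f x)) \<partial>\<mu>\<^sub>0)"
    using \<mu>0_integrable[OF parts(1)] \<mu>0_integrable[OF parts(2)] by simp
  also have "\<dots> = integral\<^sup>L \<mu>\<^sub>0 f" by (simp add: complex_eq[symmetric])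
  finally show ?thesis .
qed

text \<open>The second factor is a strictly positive bound for \<phi> on the product of
  \<open>b\<close> with its adjoint. Any constant depending on \<open>b\<close> alone will do, as
  the integral is later sent to 0.\<close>

lemma \<phi>_Cauchy_Schwarz:
  assumes h: "h \<in> C0_real" and b: "b \<in> A"
  shows "(cmod (\<phi> (mult_op h o\<^sub>L b)))\<^sup>2 \<le> (\<integral>x. (h x)\<^sup>2 \<partial>\<mu>\<^sub>0) * ((norm b)\<^sup>2 + 1)"
proof -
  define a where "a = mult_op h"
  have a: "a \<in> A" "is_adj a a" unfolding a_def using h by (auto intro: mult_op_A is_adj_mult_op)
  obtain b' where b': "b' \<in> A" "is_adj b b'" using corner_adj[OF b] .
  note clin = corner_complex_linear
  have "\<phi> (a o\<^sub>L a) + c * \<phi> (a o\<^sub>L b) + cnj c * \<phi> (b' o\<^sub>L a) + c * cnj c * \<phi> (b' o\<^sub>L b) \<in> \<real>\<^sub>\<ge>\<^sub>0" for c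
  proof -
    have "is_adj (a + scaleC_op c b) (a + scaleC_op (cnj c) b')"
      using a b' clin by (intro is_adj_add complex_linear_adj_scaleC) auto
    from adj_eqI[OF this]
    have "adj (a + scaleC_op c b) o\<^sub>L (a + scaleC_op c b) =
        (a o\<^sub>L a) + scaleC_op c (a o\<^sub>L b) + scaleC_op (cnj c) (b' o\<^sub>L a) + scaleC_op (c * cnj c) (b' o\<^sub>L b)"
      using a(1) b b'(1) by (simp add: blinfun_compose_add_left blinfun_compose_add_right scaleC_op_compose_left
          compose_scaleC_right clin scaleC_op_add mult.commute add_ac)
    moreover have "a + scaleC_op c b \<in> A" using a(1) b by (intro A_add corner_scaleC)
    ultimately show ?thesis
      using \<phi>_nonneg[of "a + scaleC_op c b"] a(1) b b'(1)
      by (simp add: \<phi>_add \<phi>_scaleC A_add corner_mult corner_scaleC)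
  qed
  moreover have "\<phi> (b' o\<^sub>L b) \<in> \<real>\<^sub>\<ge>\<^sub>0" using \<phi>_nonneg[OF b] adj_eqI[OF b'(2)] by simp
  moreover have "Re (\<phi> (b' o\<^sub>L b)) \<le> (norm b)\<^sup>2 + 1"
  proof -
    have "Re (\<phi> (b' o\<^sub>L b)) \<le> norm (b' o\<^sub>L b)"
      using complex_Re_le_cmod \<phi>_bound[OF corner_mult[OF b'(1) b]] by (rule order_trans)
    also have "\<dots> \<le> norm b' * norm b" by (rule norm_blinfun_compose)
    also have "\<dots> \<le> norm b * norm b" by (intro mult_right_mono norm_adj_le b') simp
    finally show ?thesis by (simp add: power2_eq_square)
  qed
  ultimately have "(cmod (\<phi> (a o\<^sub>L b)))\<^sup>2 \<le> Re (\<phi> (a o\<^sub>L a)) * ((norm b)\<^sup>2 + 1)"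
    by (rule nonneg_quadratic_form) (simp add: add_nonneg_pos)
  moreover have "\<phi> (a o\<^sub>L a) = of_real (\<integral>x. (h x)\<^sup>2 \<partial>\<mu>\<^sub>0)"
    unfolding a_def mult_op_mult[OF h h] power2_eq_square by (rule \<phi>_mult_op) (rule C0_real_mult[OF h h])
  ultimately show ?thesis by (simp add: a_def)
qed

section \<open>Vanishing on monomials of nonzero degree\<close>

lemma N_zero_powr: "N 0 powr b = 1"
  by (simp add: N_powr)

text \<open>Functions have degree 0, so \<open>kms_homogeneous\<close> lets them commute with
  everything under \<phi>; moving \<open>h\<close> past \<open>u_g\<close> replaces it by its
  translate.\<close>

lemma \<phi>_commutator:
  assumes f: "f \<in> slice g" and h: "h \<in> C0_real"
  shows "\<phi> (monomial act (\<lambda>x. complex_of_real (h x - h (act (- g) x)) * f x) g) = 0"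
proof -
  obtain C where C: "\<And>x. \<bar>h x\<bar> \<le> C" using C0_real_bounded[OF h] by blast
  have s: "(\<lambda>x. complex_of_real (h x) * f x) \<in> slice g"
    "(\<lambda>x. complex_of_real (h (act (- g) x)) * f x) \<in> slice g"
    using C by (auto intro!: slice_mult_bounded[OF f] C0_real_cont h C0_real_compose_act)
  have "\<phi> (mult_op h o\<^sub>L monomial act f g) = \<phi> (monomial act f g o\<^sub>L mult_op h)"
    using kms_homogeneous[OF mult_slice[OF h] monomial_corner[OF f]] by (simp add: mult_op_def N_zero_powr)
  then have eq: "\<phi> (monomial act (\<lambda>x. complex_of_real (h x) * f x) g) =
      \<phi> (monomial act (\<lambda>x. complex_of_real (h (act (- g) x)) * f x) g)"
    by (simp add: mult_op_monomial[OF h f])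
  have "monomial act (\<lambda>x. complex_of_real (h x) * f x + - 1 * (complex_of_real (h (act (- g) x)) * f x)) g =
      monomial act (\<lambda>x. complex_of_real (h x) * f x) g + scaleC_op (- 1) (monomial act (\<lambda>x. complex_of_real (h (act (- g) x)) * f x) g)"
    using s slice_scale[OF s(2), of "- 1"] by (subst monomial_add) (auto simp: slice_bounded monomial_scaleC[symmetric])
  moreover have "(\<lambda>x. complex_of_real (h x) * f x + - 1 * (complex_of_real (h (act (- g) x)) * f x)) =
      (\<lambda>x. complex_of_real (h x - h (act (- g) x)) * f x)"
    by (auto simp: algebra_simps)
  ultimately show ?thesis
    using s eq by (simp add: \<phi>_add \<phi>_scaleC monomial_corner corner_scaleC)
qed

lemma \<phi>_monomial_add:
  "f \<in> slice g \<Longrightarrow> h \<in> slice g \<Longrightarrow> \<phi> (monomial act (\<lambda>x. f x + h x) g) = \<phi> (monomial act f g) + \<phi> (monomial act h g)"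
  by (simp add: monomial_add slice_bounded \<phi>_add monomial_corner)

lemma \<phi>_monomial_sum:
  "(\<And>i. i \<in> I \<Longrightarrow> F i \<in> slice g) \<Longrightarrow> \<phi> (monomial act (\<lambda>x. \<Sum>i\<in>I. F i x) g) = (\<Sum>i\<in>I. \<phi> (monomial act (F i) g))"
  by (induction I rule: infinite_finite_induct) (auto simp: monomial_zero \<phi>_zero \<phi>_monomial_add slice_sum)

text \<open>With \<open>k = (\<Sum>i<n. (h\<^sub>i - h\<^sub>i \<circ> g\<^sup>-\<^sup>1)\<^sup>2)\<close>, commutators account for the part \<open>f k / (k + \<delta>)\<close> of \<open>f\<close>,
  and the remainder \<open>f \<delta> / (k + \<delta>)\<close> concentrates on the fixed points of \<open>g\<close>.\<close>

lemma \<phi>_vanishes: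
  assumes f: "f \<in> slice g" and "g \<noteq> 0"
    and null: "N0 \<in> sets borel" "emeasure \<mu>\<^sub>0 N0 = 0" "{x \<in> Y. \<exists>g. g \<noteq> 0 \<and> act g x = x} \<subseteq> N0"
  shows "\<phi> (monomial act f g) = 0"
proof -
  obtain h :: "nat \<Rightarrow> 'x \<Rightarrow> real" where h: "\<And>i. h i \<in> C0_real"
    and sep: "\<And>x. act (- g) x \<noteq> x \<Longrightarrow> \<exists>i. h i x \<noteq> h i (act (- g) x)"
    using C0_real_separate[of "- g"] by blast
  define d where "d i x = h i x - h i (act (- g) x)" for i x
  have d: "d i \<in> C0_real" for i unfolding d_def by (intro C0_real_diff h C0_real_compose_act)
  define k where "k n x = (\<Sum>i<n. (d i x)\<^sup>2)" for n x
  have k_nonneg: "0 \<le> k n x" for n x unfolding k_def by (intro sum_nonneg) auto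
  have k_cont: "continuous_on UNIV (k n)" for n
    unfolding k_def by (intro continuous_intros C0_real_cont d)
  define \<delta> where "\<delta> n = 1 / real (Suc n)" for n
  have \<delta>: "\<delta> n > 0" for n by (simp add: \<delta>_def)
  have k\<delta>: "k n x + \<delta> n > 0" for n x using k_nonneg[of n x] \<delta>[of n] by simp
  define q where "q n x = \<delta> n / (k n x + \<delta> n)" for n x
  have q_cont: "continuous_on UNIV (q n)" for n
    unfolding q_def using k\<delta>[of n] by (intro continuous_intros k_cont) (metis less_irrefl)
  have q_bound: "0 \<le> q n x" "q n x \<le> 1" for n x
    using k_nonneg[of n x] \<delta>[of n] k\<delta>[of n x] by (auto simp: q_def)
  have e_slice: "(\<lambda>x. complex_of_real (d i x / (k n x + \<delta> n)) * f x) \<in> slice g" for i n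
  proof -
    obtain C where C: "\<And>x. \<bar>d i x\<bar> \<le> C" using C0_real_bounded[OF d] by blast
    show ?thesis
    proof (rule slice_mult_bounded[OF f])
      show "continuous_on UNIV (\<lambda>x. d i x / (k n x + \<delta> n))"
        using k\<delta>[of n] by (intro continuous_intros k_cont C0_real_cont d) (metis less_irrefl)
      show "\<bar>d i x / (k n x + \<delta> n)\<bar> \<le> C / \<delta> n" for x
        unfolding abs_divide using C[of x] k_nonneg[of n x] \<delta>[of n] k\<delta>[of n x]
        by (intro frac_le) auto
    qed
  qed
  have q_slice: "(\<lambda>x. complex_of_real (q n x) * f x) \<in> slice g" for n
    by (rule slice_mult_bounded[OF f q_cont, where C = 1]) (use q_bound in auto)
  have reduce: "\<phi> (monomial act f g) = \<phi> (monomial act (\<lambda>x. complex_of_real (q n x) * f x) g)" for n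
  proof -
    \<comment> \<open>The coefficient of the commutator of \<open>h i\<close> with the monomial of
      coefficient \<open>d i / (k + \<delta>) * f\<close>. One factor \<open>d i\<close> comes from
      the commutator and the other is put in by hand, so that the squares add up to
      \<open>k\<close>.\<close>
    define c where "c i x = complex_of_real (d i x) * (complex_of_real (d i x / (k n x + \<delta> n)) * f x)" for i x
    have c_slice: "c i \<in> slice g" for i
      unfolding c_def
      using C0_real_bounded[OF d] slice_mult_bounded[OF e_slice C0_real_cont[OF d]] by metis
    have c_zero: "\<phi> (monomial act (c i) g) = 0" for i
      unfolding c_def d_def[of i] by (rule \<phi>_commutator[OF e_slice h, unfolded d_def])
    have "f x = (\<Sum>i<n. c i x) + complex_of_real (q n x) * f x" for x
    proof -
      have "(\<Sum>i<n. c i x) = (\<Sum>i<n. complex_of_real ((d i x)\<^sup>2)) * (f x / complex_of_real (k n x + \<delta> n))"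
        unfolding c_def sum_distrib_right by (rule sum.cong) (simp_all add: power2_eq_square)
      also have "\<dots> = complex_of_real (k n x / (k n x + \<delta> n)) * f x" by (simp add: k_def)
      finally have "(\<Sum>i<n. c i x) + complex_of_real (q n x) * f x = complex_of_real (k n x / (k n x + \<delta> n) + q n x) * f x"
        by (simp add: distrib_right)
      also have "k n x / (k n x + \<delta> n) + q n x = 1"
        using k\<delta>[of n x] by (simp add: q_def add_divide_distrib[symmetric])
      finally show ?thesis by simp
    qed
    then have "monomial act f g = monomial act (\<lambda>x. (\<Sum>i<n. c i x) + complex_of_real (q n x) * f x) g"
      by (metis (no_types, lifting) ext)
    then show ?thesis
      by (simp add: \<phi>_monomial_add slice_sum c_slice q_slice \<phi>_monomial_sum c_zero)
  qed
  \<comment> \<open>Splitting \<open>f\<close> into \<open>sqrt (cmod f)\<close> and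
    \<open>v\<close> puts the shrinking factor into the function \<open>w n\<close>, while the
    operator \<open>b\<close> with coefficient \<open>v\<close> does not depend on \<open>n\<close>.
    This is the form that \<open>\<phi>_Cauchy_Schwarz\<close> expects.\<close>
  define v where "v = (\<lambda>x. f x / complex_of_real (sqrt (cmod (f x))))"
  define w where "w n x = q n x * sqrt (cmod (f x))" for n x
  have f_C0: "f \<in> C0" by (rule slice_C0[OF f])
  have sqrt_C0: "(\<lambda>x. sqrt (cmod (f x))) \<in> C0_real"
    by (rule C0_real_sqrt[OF C0_real_parts(3)[OF f_C0]]) simp
  have w: "w n \<in> C0_real" for n
    unfolding w_def by (rule C0_real_mult_bounded[OF sqrt_C0 q_cont, where c = 1]) (use q_bound in auto)
  have v: "v \<in> slice g"
  proof -
    have "continuous_on UNIV v"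
      unfolding v_def using f_C0
      by (intro continuous_on_compose2[OF continuous_div_sqrt_cmod]) (auto simp: C0_def)
    moreover have "cmod (v x) \<le> 1 * cmod (complex_of_real (sqrt (cmod (f x))))" for x
      by (simp add: v_def norm_divide real_div_sqrt)
    ultimately have "v \<in> C0"
      using C0_dominated[of "\<lambda>x. complex_of_real (sqrt (cmod (f x)))" v 1] sqrt_C0 by (simp add: C0_real_def)
    then show ?thesis using f by (auto simp: slice_def v_def)
  qed
  have wv: "(\<lambda>x. complex_of_real (w n x) * v x) = (\<lambda>x. complex_of_real (q n x) * f x)" for n
    by (rule ext) (auto simp: w_def v_def)
  define b where "b = monomial act v g"
  have bA: "b \<in> A" unfolding b_def by (rule monomial_corner[OF v])
  have bound: "(cmod (\<phi> (monomial act f g)))\<^sup>2 \<le> (\<integral>x. (w n x)\<^sup>2 \<partial>\<mu>\<^sub>0) * ((norm b)\<^sup>2 + 1)" for n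
  proof -
    have "mult_op (w n) o\<^sub>L b = monomial act (\<lambda>x. complex_of_real (q n x) * f x) g"
      unfolding b_def mult_op_monomial(1)[OF w v] wv ..
    then show ?thesis using \<phi>_Cauchy_Schwarz[OF w bA, of n] reduce[of n] by simp
  qed
  have q_lim: "(\<lambda>n. q n x) \<longlonglongrightarrow> 0" if x: "act (- g) x \<noteq> x" for x
  proof -
    obtain i where i: "d i x \<noteq> 0" using sep[OF x] by (auto simp: d_def)
    define c where "c = (d i x)\<^sup>2"
    have "c > 0" using i by (simp add: c_def)
    have k_ge: "c \<le> k n x" if "n \<ge> Suc i" for n
    proof -
      have "(\<Sum>j\<in>{i}. (d j x)\<^sup>2) \<le> k n x" unfolding k_def using that by (intro sum_mono2) auto
      then show ?thesis by (simp add: c_def)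
    qed
    show ?thesis
    proof (rule tendsto_sandwich)
      show "\<forall>\<^sub>F n in sequentially. 0 \<le> q n x" using q_bound by simp
      show "\<forall>\<^sub>F n in sequentially. q n x \<le> \<delta> n / c"
      proof (rule eventually_sequentiallyI)
        fix n assume "Suc i \<le> n"
        then show "q n x \<le> \<delta> n / c"
          unfolding q_def using k_ge[of n] \<open>c > 0\<close> \<delta>[of n] by (intro frac_le) auto
      qed
      have "\<delta> \<longlonglongrightarrow> 0" unfolding \<delta>_def using LIMSEQ_inverse_real_of_nat by (simp add: inverse_eq_divide)
      from tendsto_divide[OF this tendsto_const, of c]
      show "(\<lambda>n. \<delta> n / c) \<longlonglongrightarrow> 0" using \<open>c > 0\<close> by simp
    qed simp
  qed
  have lim: "(\<lambda>n. \<integral>x. (w n x)\<^sup>2 \<partial>\<mu>\<^sub>0) \<longlonglongrightarrow> (\<integral>x. 0 \<partial>\<mu>\<^sub>0)"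
  proof (rule integral_dominated_convergence[where w = "\<lambda>x. cmod (f x)"])
    show "integrable \<mu>\<^sub>0 (\<lambda>x. cmod (f x))" by (rule \<mu>0_integrable[OF C0_real_parts(3)[OF f_C0]])
    show "(\<lambda>x. (w n x)\<^sup>2) \<in> borel_measurable \<mu>\<^sub>0" for n
      using borel_measurable_integrable[OF \<mu>0_integrable[OF w]] by simp
    have w2: "(w n x)\<^sup>2 = (q n x)\<^sup>2 * cmod (f x)" for n x
      by (simp add: w_def power_mult_distrib)
    show "AE x in \<mu>\<^sub>0. norm ((w n x)\<^sup>2) \<le> cmod (f x)" for n
    proof (rule AE_I2)
      fix x
      have "(q n x)\<^sup>2 \<le> 1" using q_bound[of n x] by (simp add: power_le_one)
      then show "norm ((w n x)\<^sup>2) \<le> cmod (f x)"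
        unfolding w2 using mult_right_mono[of "(q n x)\<^sup>2" 1 "cmod (f x)"] by (simp add: abs_mult)
    qed
    have "N0 \<in> null_sets \<mu>\<^sub>0" using null by (simp add: null_sets_def sets_\<mu>0)
    then have "AE x in \<mu>\<^sub>0. x \<notin> N0" by (rule AE_not_in)
    then show "AE x in \<mu>\<^sub>0. (\<lambda>n. (w n x)\<^sup>2) \<longlonglongrightarrow> 0"
    proof eventually_elim
      case (elim x)
      show ?case
      proof (cases "f x = 0")
        case True
        then show ?thesis by (simp add: w_def)
      next
        case False
        then have "x \<in> Y" using slice_zero[OF f] by blast
        moreover have "- g \<noteq> 0" using \<open>g \<noteq> 0\<close> by simp
        ultimately have "act (- g) x \<noteq> x" using elim null(3) by blast
        from tendsto_mult[OF tendsto_power[OF q_lim[OF this], of 2] tendsto_const]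
        show ?thesis unfolding w2 by simp
      qed
    qed
  qed simp
  have "(cmod (\<phi> (monomial act f g)))\<^sup>2 \<le> 0"
  proof (rule tendsto_lowerbound)
    show "(\<lambda>n. (\<integral>x. (w n x)\<^sup>2 \<partial>\<mu>\<^sub>0) * ((norm b)\<^sup>2 + 1)) \<longlonglongrightarrow> 0"
      using tendsto_mult[OF lim tendsto_const, of "(norm b)\<^sup>2 + 1"] by simp
  qed (use bound in auto)
  then show ?thesis by simp
qed

section \<open>Scaling of the measure inside Y\<close>

lemma emeasure_density_indicator:
  assumes "W \<in> sets borel" "B \<in> sets borel" "0 \<le> c"
  shows "emeasure (density \<mu>\<^sub>0 (\<lambda>x. ennreal (c * indicator W x))) B = ennreal c * emeasure \<mu>\<^sub>0 (W \<inter> B)"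
proof -
  have "emeasure (density \<mu>\<^sub>0 (\<lambda>x. ennreal (c * indicator W x))) B =
      (\<integral>\<^sup>+x. ennreal c * indicator (W \<inter> B) x \<partial>\<mu>\<^sub>0)"
    using assms by (subst emeasure_density)
      (auto simp: sets_\<mu>0 intro!: \<mu>0_measurable nn_integral_cong simp: indicator_def)
  also have "\<dots> = ennreal c * emeasure \<mu>\<^sub>0 (W \<inter> B)"
    using assms by (intro nn_integral_cmult_indicator) (simp add: sets_\<mu>0)
  finally show ?thesis .
qed

lemma finite_density_indicator:
  assumes "W \<in> sets borel" "0 \<le> c"
  shows "finite_measure (density \<mu>\<^sub>0 (\<lambda>x. ennreal (c * indicator W x)))"
proof (rule finite_measureI)
  show "emeasure (density \<mu>\<^sub>0 (\<lambda>x. ennreal (c * indicator W x))) (space (density \<mu>\<^sub>0 (\<lambda>x. ennreal (c * indicator W x)))) \<noteq> \<infinity>"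
    using emeasure_density_indicator[OF assms(1) _ assms(2), of UNIV] \<mu>0.emeasure_finite[of W]
    by (simp add: riesz.space_riesz_measure ennreal_mult_eq_top_iff)
qed

lemma integral_density_indicator:
  fixes f :: "'x \<Rightarrow> 'b::{banach, second_countable_topology}"
  assumes "W \<in> sets borel" "0 \<le> c" "f \<in> borel_measurable borel"
  shows "integral\<^sup>L (density \<mu>\<^sub>0 (\<lambda>x. ennreal (c * indicator W x))) f = (\<integral>x. (c * indicator W x) *\<^sub>R f x \<partial>\<mu>\<^sub>0)"
  using assms by (intro integral_density) (auto intro!: \<mu>0_measurable AE_I2)

text \<open>The KMS identity for two monomials of opposite degree built from the square root of
  \<open>f\<close>: their product is a function in either order, supported on \<open>Y\<close> cut
  with one translate or the other.\<close>

lemma \<mu>0_change_of_variables: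
  assumes f: "f \<in> C0_real" "\<And>x. 0 \<le> f x"
  shows "(\<integral>x. indicator (Y \<inter> act g ` Y) x * f (act (- g) x) \<partial>\<mu>\<^sub>0) =
    N g powr - \<beta> * (\<integral>x. indicator (Y \<inter> act (- g) ` Y) x * f x \<partial>\<mu>\<^sub>0)"
proof -
  define s where "s x = complex_of_real (sqrt (f x))" for x
  have s: "s \<in> C0" using C0_real_sqrt[OF f] by (simp add: C0_real_def s_def[abs_def])
  have ss: "s x * s x = complex_of_real (f x)" for x
    unfolding s_def of_real_mult[symmetric] using f(2)[of x] by simp
  define f1 where "f1 x = indicator Y x * s (act (- g) x) * indicator Y (act (- g) x)" for x
  define f2 where "f2 x = indicator Y x * s x * indicator Y (act (- (- g)) x)" for x
  have f1: "f1 \<in> slice g" unfolding f1_def by (rule cutdown_slice) (rule C0_compose_act[OF s])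
  have f2: "f2 \<in> slice (- g)" unfolding f2_def by (rule cutdown_slice[OF s])
  have 1: "monomial act f1 g o\<^sub>L monomial act f2 (- g) = monomial act (\<lambda>x. f1 x * f2 (act (- g) x)) 0"
    and 2: "monomial act f2 (- g) o\<^sub>L monomial act f1 g = monomial act (\<lambda>x. f2 x * f1 (act g x)) 0"
    using f1 f2 by (simp_all add: monomial_mult slice_bounded)
  have s1: "(\<lambda>x. f1 x * f2 (act (- g) x)) \<in> slice 0" using slice_mult[OF f1 f2] by simp
  have s2: "(\<lambda>x. f2 x * f1 (act g x)) \<in> slice 0" using slice_mult[OF f2 f1] by simp
  have e1: "(\<lambda>x. f1 x * f2 (act (- g) x)) = (\<lambda>x. complex_of_real (indicator (Y \<inter> act g ` Y) x * f (act (- g) x)))"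
    unfolding f1_def f2_def using ss by (auto simp: fun_eq_iff indicator_def act_image_mem)
  have e2: "(\<lambda>x. f2 x * f1 (act g x)) = (\<lambda>x. complex_of_real (indicator (Y \<inter> act (- g) ` Y) x * f x))"
    unfolding f1_def f2_def using ss by (auto simp: fun_eq_iff indicator_def act_image_mem)
  have "\<phi> (monomial act f1 g o\<^sub>L monomial act f2 (- g)) =
      complex_of_real (\<integral>x. indicator (Y \<inter> act g ` Y) x * f (act (- g) x) \<partial>\<mu>\<^sub>0)"
    using \<phi>_slice_0[OF s1] unfolding 1 e1 integral_complex_of_real .
  moreover have "\<phi> (monomial act f2 (- g) o\<^sub>L monomial act f1 g) =
      complex_of_real (\<integral>x. indicator (Y \<inter> act (- g) ` Y) x * f x \<partial>\<mu>\<^sub>0)"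
    using \<phi>_slice_0[OF s2] unfolding 2 e2 integral_complex_of_real .
  ultimately show ?thesis
    using kms_homogeneous[OF f1 monomial_corner[OF f2]] by (simp only: of_real_mult[symmetric] of_real_eq_iff)
qed

text \<open>By the change of variables the image of \<open>\<mu>\<^sub>0\<close> on
  \<open>W1\<close> under \<open>act (- g)\<close> and the scaled restriction of
  \<open>\<mu>\<^sub>0\<close> to \<open>W2\<close> have the same integrals, so they are equal as
  finite measures and can be evaluated at \<open>B\<close>.\<close>

lemma \<mu>0_scaling:
  assumes B: "B \<in> sets borel" "B \<subseteq> Y" "act g ` B \<subseteq> Y"
  shows "emeasure \<mu>\<^sub>0 (act g ` B) = ennreal (N g powr - \<beta>) * emeasure \<mu>\<^sub>0 B"
proof -
  define W1 W2 where "W1 = Y \<inter> act g ` Y" and "W2 = Y \<inter> act (- g) ` Y"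
  have W: "W1 \<in> sets borel" "W2 \<in> sets borel"
    unfolding W1_def W2_def using borel_Y by (auto intro: borel_act_image)
  define D1 where "D1 = density \<mu>\<^sub>0 (\<lambda>x. ennreal (1 * indicator W1 x))"
  define D2 where "D2 = density \<mu>\<^sub>0 (\<lambda>x. ennreal (N g powr - \<beta> * indicator W2 x))"
  have sets: "sets D1 = sets borel" "sets D2 = sets borel" by (simp_all add: D1_def D2_def sets_\<mu>0)
  have meas: "act (- g) \<in> D1 \<rightarrow>\<^sub>M borel"
    using borel_act by (simp add: measurable_cong_sets[OF sets(1) refl])
  have "distr D1 borel (act (- g)) = D2"
  proof (rule finite_borel_measure_eqI[OF lc])
    show "finite_measure (distr D1 borel (act (- g)))"
      using finite_density_indicator[OF W(1), of 1] meas by (intro finite_measure.finite_measure_distr) (simp_all add: D1_def)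
    show "finite_measure D2" unfolding D2_def by (rule finite_density_indicator[OF W(2)]) simp
    fix f :: "'x \<Rightarrow> real" assume f: "f \<in> C0_real" "\<And>x. 0 \<le> f x"
    have fm: "f \<in> borel_measurable borel" by (rule borel_measurable_continuous_onI[OF C0_real_cont[OF f(1)]])
    then have fm': "(\<lambda>x. f (act (- g) x)) \<in> borel_measurable borel"
      using borel_act by (rule measurable_compose[rotated])
    have "integral\<^sup>L (distr D1 borel (act (- g))) f = (\<integral>x. f (act (- g) x) \<partial>D1)"
      by (rule integral_distr[OF meas fm])
    also have "\<dots> = (\<integral>x. indicator W1 x * f (act (- g) x) \<partial>\<mu>\<^sub>0)"
      unfolding D1_def by (subst integral_density_indicator[OF W(1) _ fm']) simp_all
    also have "\<dots> = N g powr - \<beta> * (\<integral>x. indicator W2 x * f x \<partial>\<mu>\<^sub>0)"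
      unfolding W1_def W2_def by (rule \<mu>0_change_of_variables[OF f])
    also have "\<dots> = integral\<^sup>L D2 f"
      unfolding D2_def by (subst integral_density_indicator[OF W(2) _ fm]) (simp_all add: mult.assoc)
    finally show "integral\<^sup>L (distr D1 borel (act (- g))) f = integral\<^sup>L D2 f" .
  qed (use sets in simp_all)
  then have "emeasure (distr D1 borel (act (- g))) B = emeasure D2 B" by simp
  moreover have "emeasure (distr D1 borel (act (- g))) B = emeasure \<mu>\<^sub>0 (W1 \<inter> act g ` B)"
    using meas B(1) borel_act_image[OF B(1), of g] emeasure_density_indicator[OF W(1), of "act g ` B" 1]
      sets_eq_imp_space_eq[OF sets(1)]
    by (simp add: emeasure_distr act_image_eq_vimage D1_def riesz.space_riesz_measure)
  moreover have "emeasure D2 B = ennreal (N g powr - \<beta>) * emeasure \<mu>\<^sub>0 (W2 \<inter> B)"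
    unfolding D2_def using emeasure_density_indicator[OF W(2) B(1)] by simp
  moreover have "W1 \<inter> act g ` B = act g ` B" using B by (auto simp: W1_def)
  moreover have "W2 \<inter> B = B" using B by (auto simp: W2_def act_image_mem)
  ultimately show ?thesis by simp
qed

lemma \<mu>0_invariant_null:
  assumes "\<beta> \<noteq> 0" "N g \<noteq> 1" and B: "B \<in> sets borel" "B \<subseteq> Y" "act g ` B = B"
  shows "emeasure \<mu>\<^sub>0 B = 0"
proof -
  have "log_N g \<noteq> 0" using assms(2) N_pos[of g] by (simp add: log_N_def)
  \<comment> \<open>Both nontriviality assumptions enter here; since \<open>\<mu>\<^sub>0\<close> is
    finite, only mass 0 is left.\<close>
  then have "N g powr - \<beta> \<noteq> 1" using assms(1) by (simp add: N_powr)
  obtain r where r: "emeasure \<mu>\<^sub>0 B = ennreal r" "0 \<le> r"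
    using \<mu>0.emeasure_finite[of B] by (cases "emeasure \<mu>\<^sub>0 B") auto
  have "ennreal r = ennreal (N g powr - \<beta>) * ennreal r" using \<mu>0_scaling[of B g] B r by simp
  also have "\<dots> = ennreal (N g powr - \<beta> * r)" using r by (simp add: ennreal_mult)
  finally have "r = N g powr - \<beta> * r" using r by (subst (asm) ennreal_inj) auto
  then have "r = 0" using \<open>N g powr - \<beta> \<noteq> 1\<close> by (simp add: mult_cancel_right1)
  then show ?thesis using r by simp
qed

text \<open>Both sides are linear and norm continuous. On monomials of degree 0 the equality is
  \<open>\<phi>_slice_0\<close>, in other degrees both sides vanish.\<close>

lemma \<phi>_eq_integral:
  assumes null: "N0 \<in> sets borel" "emeasure \<mu>\<^sub>0 N0 = 0" "{x \<in> Y. \<exists>g. g \<noteq> 0 \<and> act g x = x} \<subseteq> N0"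
    and a: "a \<in> A"
  shows "\<phi> a = integral\<^sup>L \<mu>\<^sub>0 (E a)"
proof -
  have int: "integrable \<mu>\<^sub>0 (E a)" if a: "a \<in> A" for a
  proof (rule \<mu>0.integrable_const_bound[where B = "norm a"])
    show "E a \<in> borel_measurable \<mu>\<^sub>0" by (intro \<mu>0_measurable borel_measurable_C0 corner_E_C0 a)
  qed (use corner_E_bound[OF a] in auto)
  have span: "b \<in> A \<and> \<phi> b = integral\<^sup>L \<mu>\<^sub>0 (E b)" if "b \<in> span corner_monomials" for b
    using that
  proof (induction rule: span_induct_alt)
    case base
    have "E 0 = (\<lambda>_. 0)" using corner_E_bound[OF A_zero] by auto
    then show ?case by (simp add: A_zero \<phi>_zero)
  next
    case (step r b c)
    obtain f g where f: "b = monomial act f g" "f \<in> slice g" using step(1) by (auto simp: corner_monomials_def)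
    have bA: "b \<in> A" unfolding f(1) by (rule monomial_corner[OF f(2)])
    have "\<phi> b = integral\<^sup>L \<mu>\<^sub>0 (E b)"
      using \<phi>_slice_0[of f] \<phi>_vanishes[OF f(2) _ null] f(2)
      by (cases "g = 0") (simp_all add: f(1) E_monomial slice_C0)
    moreover have "E (r *\<^sub>R b + c) = (\<lambda>x. of_real r * E b x + E c x)"
      using corner_E_add[OF A_scaleR[OF bA]] corner_E_scaleC[OF bA, of "of_real r"] step(2)
      by (auto simp: fun_eq_iff scaleC_op_of_real)
    ultimately show ?case
      using step(2) bA int by (simp add: A_add A_scaleR \<phi>_add \<phi>_scaleR)
  qed
  obtain s where s: "\<And>n. s n \<in> span corner_monomials" "s \<longlonglongrightarrow> a"
    using a unfolding corner_eq closure_sequential by blast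
  have sA: "s n \<in> A" for n using span[OF s(1)] by blast
  have "(\<lambda>n. integral\<^sup>L \<mu>\<^sub>0 (E (s n))) \<longlonglongrightarrow> integral\<^sup>L \<mu>\<^sub>0 (E a)"
  proof (rule LIM_zero_cancel, rule Lim_null_comparison)
    have "(\<lambda>n. norm (s n - a) * measure \<mu>\<^sub>0 (space \<mu>\<^sub>0)) \<longlonglongrightarrow> 0 * measure \<mu>\<^sub>0 (space \<mu>\<^sub>0)"
      using s(2) by (intro tendsto_mult tendsto_const) (simp add: LIM_zero_iff tendsto_norm_zero)
    then show "(\<lambda>n. norm (s n - a) * measure \<mu>\<^sub>0 (space \<mu>\<^sub>0)) \<longlonglongrightarrow> 0" by simp
    have "norm (integral\<^sup>L \<mu>\<^sub>0 (E (s n)) - integral\<^sup>L \<mu>\<^sub>0 (E a)) \<le> norm (s n - a) * measure \<mu>\<^sub>0 (space \<mu>\<^sub>0)" for n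
    proof -
      have diff: "E (s n) x - E a x = E (s n - a) x" for x
        using sA[of n] a by (simp add: corner_E_eq A_diff blinfun.diff_left)
      have "norm (integral\<^sup>L \<mu>\<^sub>0 (E (s n)) - integral\<^sup>L \<mu>\<^sub>0 (E a)) = norm (\<integral>x. E (s n - a) x \<partial>\<mu>\<^sub>0)"
        using int[OF sA[of n]] int[OF a] diff by (simp flip: Bochner_Integration.integral_diff)
      also have "\<dots> \<le> (\<integral>x. norm (E (s n - a) x) \<partial>\<mu>\<^sub>0)" by (rule integral_norm_bound)
      also have "\<dots> \<le> (\<integral>x. norm (s n - a) \<partial>\<mu>\<^sub>0)"
        using int[OF A_diff[OF sA[of n] a]] corner_E_bound[OF A_diff[OF sA[of n] a]]
        by (intro integral_mono) auto
      finally show ?thesis by (simp add: mult.commute)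
    qed
    then show "\<forall>\<^sub>F n in sequentially. norm (integral\<^sup>L \<mu>\<^sub>0 (E (s n)) - integral\<^sup>L \<mu>\<^sub>0 (E a)) \<le> norm (s n - a) * measure \<mu>\<^sub>0 (space \<mu>\<^sub>0)"
      by simp
  qed
  moreover have "(\<lambda>n. integral\<^sup>L \<mu>\<^sub>0 (E (s n))) \<longlonglongrightarrow> \<phi> a"
    using tendsto_\<phi>[OF s(2) sA a] span[OF s(1)] by simp
  ultimately show ?thesis using LIMSEQ_unique by blast
qed

text \<open>The bound from above is that of the functional, applied to an approximate unit. From
  below, \<phi> has norm 1, while the integral of \<open>E a\<close> for a contraction
  \<open>a\<close> is at most the mass of \<open>Y\<close>.\<close>

lemma \<mu>0_Y:
  assumes eq: "\<And>a. a \<in> A \<Longrightarrow> \<phi> a = integral\<^sup>L \<mu>\<^sub>0 (E a)"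
  shows "emeasure \<mu>\<^sub>0 Y = 1"
proof -
  have ind: "integrable \<mu>\<^sub>0 (\<lambda>x. c * indicator Y x :: real)" for c
    using borel_Y \<mu>0.emeasure_finite[of Y] by (simp add: sets_\<mu>0 less_top[symmetric])
  have Y_int: "integral\<^sup>L \<mu>\<^sub>0 (indicator Y :: 'x \<Rightarrow> real) = measure \<mu>\<^sub>0 Y"
    by (simp add: riesz.space_riesz_measure)
  have "measure \<mu>\<^sub>0 Y \<le> 1"
  proof -
    obtain f :: "nat \<Rightarrow> 'x \<Rightarrow> real" where f: "\<And>n. f n \<in> C0_real" "\<And>n x. 0 \<le> f n x" "\<And>n x. f n x \<le> 1"
      "\<And>n x. x \<notin> Y \<Longrightarrow> f n x = 0" "\<And>x. (\<lambda>n. f n x) \<longlonglongrightarrow> indicator Y x"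
      using ex_approx_unit by blast
    have "(\<lambda>n. integral\<^sup>L \<mu>\<^sub>0 (f n)) \<longlonglongrightarrow> integral\<^sup>L \<mu>\<^sub>0 (indicator Y)"
    proof (rule integral_dominated_convergence[where w = "indicator Y"])
      show "f n \<in> borel_measurable \<mu>\<^sub>0" for n by (rule borel_measurable_integrable[OF \<mu>0_integrable[OF f(1)]])
      show "AE x in \<mu>\<^sub>0. norm (f n x) \<le> indicator Y x" for n
        using f(2,3,4) by (auto simp: indicator_def)
    qed (use ind[of 1] f(5) borel_Y in \<open>auto simp: sets_\<mu>0\<close>)
    moreover have "integral\<^sup>L \<mu>\<^sub>0 (f n) \<le> 1" for n
      unfolding riesz.integral_riesz_measure[OF f(1)] by (rule riesz.L_bound[OF f(1-3)])
    ultimately show ?thesis unfolding Y_int by (intro LIMSEQ_le_const2) auto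
  qed
  moreover have "1 \<le> measure \<mu>\<^sub>0 Y"
  proof -
    have "cmod (\<phi> a) \<le> measure \<mu>\<^sub>0 Y" if a: "a \<in> A" "norm a \<le> 1" for a
    proof -
      have bound: "cmod (E a x) \<le> 1 * indicator Y x" for x
        using corner_E_bound[OF a(1), of x] corner_E_zero[OF a(1), of x] a(2) by (cases "x \<in> Y") auto
      have "cmod (\<phi> a) \<le> (\<integral>x. cmod (E a x) \<partial>\<mu>\<^sub>0)" unfolding eq[OF a(1)] by (rule integral_norm_bound)
      also have "\<dots> \<le> (\<integral>x. 1 * indicator Y x \<partial>\<mu>\<^sub>0)"
      proof (rule integral_mono[OF _ ind bound])
        show "integrable \<mu>\<^sub>0 (\<lambda>x. cmod (E a x))"
          by (rule \<mu>0_integrable[OF C0_real_parts(3)[OF corner_E_C0[OF a(1)]]])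
      qed
      finally show ?thesis using Y_int by simp
    qed
    moreover have "Sup {cmod (\<phi> a) | a. a \<in> A \<and> norm a \<le> 1} = 1"
      using \<phi>_state by (simp add: is_state_def)
    moreover have "{cmod (\<phi> a) | a. a \<in> A \<and> norm a \<le> 1} \<noteq> {}" using A_zero by force
    ultimately show ?thesis using cSup_least[of "{cmod (\<phi> a) | a. a \<in> A \<and> norm a \<le> 1}" "measure \<mu>\<^sub>0 Y"] by force
  qed
  ultimately show ?thesis by (simp add: \<mu>0.emeasure_eq_measure)
qed

text \<open>The formula forced by the scaling condition: the part of \<open>B\<close> in piece
  \<open>n\<close> is pulled back into \<open>Y\<close> by \<open>g_enum n\<close>, measured there
  and weighted.\<close>

definition extension :: "'x measure"
  where "extension = measure_of UNIV (sets borel)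
    (\<lambda>B. \<Sum>n. ennreal (N (g_enum n) powr - \<beta>) * emeasure \<mu>\<^sub>0 (act (- g_enum n) ` (B \<inter> piece n)))"

lemma sets_extension: "sets extension = sets borel"
  unfolding extension_def
  using sets.sigma_sets_eq[of "borel :: 'x measure"] by (auto simp: space_measure_of_conv)

lemma emeasure_\<mu>0_UN:
  assumes "\<And>i :: nat. F i \<in> sets borel" "disjoint_family F"
  shows "emeasure \<mu>\<^sub>0 (act g ` (\<Union>i. F i)) = (\<Sum>i. emeasure \<mu>\<^sub>0 (act g ` F i))"
proof -
  have "disjoint_family (\<lambda>i. act g ` F i)"
    using assms(2) unfolding disjoint_family_on_def by (simp add: image_Int[OF inj_act, symmetric])
  then show ?thesis
    unfolding image_UN using borel_act_image[OF assms(1)]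
    by (intro suminf_emeasure[symmetric]) (auto simp: sets_\<mu>0)
qed

lemma emeasure_extension:
  assumes "B \<in> sets borel"
  shows "emeasure extension B =
    (\<Sum>n. ennreal (N (g_enum n) powr - \<beta>) * emeasure \<mu>\<^sub>0 (act (- g_enum n) ` (B \<inter> piece n)))"
  unfolding extension_def
proof (rule emeasure_measure_of_sigma[OF _ _ _ assms])
  let ?m = "\<lambda>B. \<Sum>n. ennreal (N (g_enum n) powr - \<beta>) * emeasure \<mu>\<^sub>0 (act (- g_enum n) ` (B \<inter> piece n))"
  show "sigma_algebra UNIV (sets borel :: 'x set set)"
    using sets.sigma_algebra_axioms[of "borel :: 'x measure"] by simp
  show "countably_additive (sets borel) ?m"
  proof (rule countably_additiveI)
    fix F :: "nat \<Rightarrow> 'x set" assume F: "range F \<subseteq> sets borel" "disjoint_family F"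
    have "emeasure \<mu>\<^sub>0 (act (- g_enum n) ` (\<Union> (range F) \<inter> piece n)) = (\<Sum>i. emeasure \<mu>\<^sub>0 (act (- g_enum n) ` (F i \<inter> piece n)))" for n
    proof -
      have "F i \<inter> piece n \<in> sets borel" for i using F(1) piece_borel by auto
      moreover have "disjoint_family (\<lambda>i. F i \<inter> piece n)"
        using F(2) by (auto simp: disjoint_family_on_def)
      ultimately show ?thesis using emeasure_\<mu>0_UN[of "\<lambda>i. F i \<inter> piece n"] by (simp add: Int_UN_distrib2)
    qed
    then show "(\<Sum>i. ?m (F i)) = ?m (\<Union> (range F))"
      by (subst suminf_swap_ennreal) simp
  qed
qed (simp add: positive_def)

text \<open>For parts of \<open>B\<close> inside \<open>Y\<close> the pull-back stays within
  \<open>Y\<close>, so \<open>\<mu>0_scaling\<close> undoes the weight.\<close>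

lemma extension_Y:
  assumes B: "B \<in> sets borel" "B \<subseteq> Y"
  shows "emeasure extension B = emeasure \<mu>\<^sub>0 B"
proof -
  have "ennreal (N (g_enum n) powr - \<beta>) * emeasure \<mu>\<^sub>0 (act (- g_enum n) ` (B \<inter> piece n)) = emeasure \<mu>\<^sub>0 (act 0 ` (B \<inter> piece n))" for n
  proof -
    have BZ: "B \<inter> piece n \<in> sets borel" using B(1) piece_borel by auto
    have img: "act (g_enum n) ` act (- g_enum n) ` (B \<inter> piece n) = B \<inter> piece n" by (simp add: image_image)
    have "emeasure \<mu>\<^sub>0 (B \<inter> piece n) = ennreal (N (g_enum n) powr - \<beta>) * emeasure \<mu>\<^sub>0 (act (- g_enum n) ` (B \<inter> piece n))"
      using \<mu>0_scaling[OF borel_act_image[OF BZ, of "- g_enum n"] piece_pull, of "g_enum n"] B(2)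
      unfolding img by auto
    then show ?thesis by (simp add: act_0)
  qed
  moreover have "emeasure \<mu>\<^sub>0 (act 0 ` (\<Union>n. B \<inter> piece n)) = (\<Sum>n. emeasure \<mu>\<^sub>0 (act 0 ` (B \<inter> piece n)))"
    using B(1) piece_borel piece_disjoint by (intro emeasure_\<mu>0_UN) (auto simp: disjoint_family_on_def)
  moreover have "act 0 ` (\<Union>n. B \<inter> piece n) = B" using piece_UN by (auto simp: act_0)
  ultimately show ?thesis by (simp add: emeasure_extension[OF B(1)])
qed

text \<open>Both sides are refined by the pieces that contain a point and its image under
  \<open>g\<close>. On each part the two pull-backs into \<open>Y\<close> differ by a group element,
  for which \<open>\<mu>0_scaling\<close> holds, and the weights match because \<open>N\<close> is a
  homomorphism.\<close>

lemma extension_scaling: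
  assumes B: "B \<in> sets borel"
  shows "emeasure extension (act g ` B) = ennreal (N g powr - \<beta>) * emeasure extension B"
proof -
  define c where "c n = ennreal (N (g_enum n) powr - \<beta>)" for n
  \<comment> \<open>The points of \<open>B\<close> in piece \<open>m\<close> that \<open>g\<close>
    moves into piece \<open>n\<close>.\<close>
  define D where "D n m = B \<inter> piece m \<inter> act (- g) ` piece n" for n m
  have D: "D n m \<in> sets borel" for n m
    unfolding D_def using B piece_borel borel_act_image[OF piece_borel] by auto
  have 1: "emeasure \<mu>\<^sub>0 (act (- g_enum n) ` (act g ` B \<inter> piece n)) = (\<Sum>m. emeasure \<mu>\<^sub>0 (act (- g_enum n + g) ` D n m))" for n
  proof -
    have "act (- g_enum n) ` (act g ` B \<inter> piece n) = act (- g_enum n + g) ` (\<Union>m. D n m)"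
    proof -
      have "act g ` B \<inter> piece n = act g ` (\<Union>m. D n m)"
        using piece_UN by (auto simp: D_def act_image_mem)
      then show ?thesis by (simp add: image_image act_add)
    qed
    moreover have "disjoint_family (D n)"
      using piece_disjoint by (auto simp: D_def disjoint_family_on_def)
    ultimately show ?thesis by (simp only: emeasure_\<mu>0_UN[OF D])
  qed
  have 2: "c n * emeasure \<mu>\<^sub>0 (act (- g_enum n + g) ` D n m) =
      ennreal (N g powr - \<beta>) * (c m * emeasure \<mu>\<^sub>0 (act (- g_enum m) ` D n m))" for n m
  proof -
    define V where "V = act (- g_enum m) ` D n m"
    \<comment> \<open>Takes the pull-back of \<open>D n m\<close> along piece \<open>m\<close> to
      the pull-back of its image under \<open>g\<close> along piece \<open>n\<close>.\<close>
    define k where "k = - g_enum n + g + g_enum m"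
    have V: "V \<in> sets borel" "V \<subseteq> Y"
      unfolding V_def using D borel_act_image piece_pull[of m B] by (auto simp: D_def)
    have kV: "act k ` V = act (- g_enum n + g) ` D n m"
      unfolding k_def V_def by (simp add: image_image act_add)
    have "act k ` V \<subseteq> act (- g_enum n) ` (UNIV \<inter> piece n)"
      unfolding kV by (auto simp: D_def act_add act_image_mem)
    then have "act k ` V \<subseteq> Y" using piece_pull[of n UNIV] by blast
    then have "emeasure \<mu>\<^sub>0 (act k ` V) = ennreal (N k powr - \<beta>) * emeasure \<mu>\<^sub>0 V" by (rule \<mu>0_scaling[OF V])
    moreover have "c n * ennreal (N k powr - \<beta>) = ennreal (N g powr - \<beta>) * c m"
      unfolding c_def k_def N_powr
      by (simp add: log_N_add log_N_uminus algebra_simps flip: ennreal_mult exp_add)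
    ultimately have "c n * emeasure \<mu>\<^sub>0 (act k ` V) = (ennreal (N g powr - \<beta>) * c m) * emeasure \<mu>\<^sub>0 V"
      by (simp flip: mult.assoc)
    then show ?thesis unfolding kV unfolding V_def by (simp only: mult.assoc)
  qed
  have 3: "(\<Sum>n. emeasure \<mu>\<^sub>0 (act (- g_enum m) ` D n m)) = emeasure \<mu>\<^sub>0 (act (- g_enum m) ` (B \<inter> piece m))" for m
  proof -
    have "(\<Union>n. D n m) = B \<inter> piece m \<inter> act (- g) ` (\<Union>n. piece n)" by (auto simp: D_def)
    also have "\<dots> = B \<inter> piece m" unfolding piece_UN by (auto simp: act_image_mem)
    finally have "(\<Union>n. D n m) = B \<inter> piece m" .
    moreover have "disjoint_family (\<lambda>n. D n m)"
      using piece_disjoint by (auto simp: D_def disjoint_family_on_def dest!: injD[OF inj_act])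
    ultimately show ?thesis using emeasure_\<mu>0_UN[of "\<lambda>n. D n m" "- g_enum m"] D by simp
  qed
  have "emeasure extension (act g ` B) = (\<Sum>n. \<Sum>m. c n * emeasure \<mu>\<^sub>0 (act (- g_enum n + g) ` D n m))"
    by (simp add: emeasure_extension[OF borel_act_image[OF B]] 1 c_def)
  also have "\<dots> = ennreal (N g powr - \<beta>) * (\<Sum>n. \<Sum>m. c m * emeasure \<mu>\<^sub>0 (act (- g_enum m) ` D n m))"
    by (simp add: 2)
  also have "\<dots> = ennreal (N g powr - \<beta>) * (\<Sum>m. c m * (\<Sum>n. emeasure \<mu>\<^sub>0 (act (- g_enum m) ` D n m)))"
    by (subst suminf_swap_ennreal) simp
  also have "\<dots> = ennreal (N g powr - \<beta>) * emeasure extension B"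
    by (simp add: 3 c_def emeasure_extension[OF B])
  finally show ?thesis .
qed

text \<open>A compact set is covered by finitely many open translates of \<open>Y\<close>, each of
  finite mass by scaling, so \<open>radon_measureI\<close> applies.\<close>

lemma extension_M:
  assumes "emeasure \<mu>\<^sub>0 Y = 1" shows "extension \<in> M"
proof -
  have Y: "emeasure extension Y = 1" using extension_Y[OF borel_Y] assms by simp
  have "emeasure extension K < \<infinity>" if K: "compact K" for K
  proof -
    have "K \<subseteq> (\<Union>g\<in>UNIV. act g ` Y)" using cover by simp
    then obtain G where G: "finite G" "K \<subseteq> (\<Union>g\<in>G. act g ` Y)"
      using compactE_image[OF K, of UNIV "\<lambda>g. act g ` Y"] open_act_image[OF open_Y] by metis
    have "emeasure extension K \<le> emeasure extension (\<Union>g\<in>G. act g ` Y)"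
      using G borel_Y by (intro emeasure_mono) (auto simp: sets_extension intro: borel_act_image)
    also have "\<dots> \<le> (\<Sum>g\<in>G. emeasure extension (act g ` Y))"
      using G(1) borel_Y by (intro emeasure_subadditive_finite) (auto simp: sets_extension intro: borel_act_image)
    also have "\<dots> < \<infinity>"
      using G(1) by (simp add: extension_scaling[OF borel_Y] Y)
    finally show ?thesis .
  qed
  then have "radon_measure extension" by (intro radon_measureI lc sets_extension)
  then show ?thesis unfolding kms_measures_def using Y extension_scaling by blast
qed

text \<open>Since \<open>E a\<close> vanishes off \<open>Y\<close>, the integral depends only on the
  restriction of the measure to \<open>Y\<close>, where the extension agrees with
  \<open>\<mu>\<^sub>0\<close>.\<close>

lemma \<phi>_eq_state_of_extension:
  assumes eq: "\<And>a. a \<in> A \<Longrightarrow> \<phi> a = integral\<^sup>L \<mu>\<^sub>0 (E a)"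
  shows "state_of_measure act Y E extension = \<phi>"
proof
  fix a
  show "state_of_measure act Y E extension a = \<phi> a"
  proof (cases "a \<in> A")
    case False
    then show ?thesis using \<phi>_state by (simp add: state_of_measure_def is_state_def extensional_def)
  next
    case True
    have dens: "density extension (indicator Y) = density \<mu>\<^sub>0 (indicator Y)"
    proof (rule measure_eqI)
      fix B assume "B \<in> sets (density extension (indicator Y))"
      then have B: "B \<in> sets borel" by (simp add: sets_extension)
      then have "Y \<inter> B \<in> sets borel" using borel_Y by auto
      then show "emeasure (density extension (indicator Y)) B = emeasure (density \<mu>\<^sub>0 (indicator Y)) B"
        using B borel_Y extension_Y[of "Y \<inter> B"]
        by (simp add: emeasure_restricted sets_extension sets_\<mu>0)
    qed (simp add: sets_extension sets_\<mu>0)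
    have int: "integral\<^sup>L \<kappa> (E a) = integral\<^sup>L (density \<kappa> (indicator Y)) (E a)"
      if \<kappa>: "sets \<kappa> = sets borel" for \<kappa>
    proof -
      have "integral\<^sup>L (density \<kappa> (\<lambda>x. ennreal (indicator Y x))) (E a) = (\<integral>x. indicator Y x *\<^sub>R E a x \<partial>\<kappa>)"
        using borel_Y borel_measurable_C0[OF corner_E_C0[OF True]]
        by (intro integral_density) (simp_all add: measurable_cong_sets[OF \<kappa> refl])
      moreover have "(\<lambda>x. ennreal (indicator Y x)) = indicator Y" by (auto simp: indicator_def)
      moreover have "(\<lambda>x. indicator Y x *\<^sub>R E a x) = E a"
        using corner_E_zero[OF True] by (auto simp: fun_eq_iff indicator_def)
      ultimately show ?thesis by simp
    qed
    show ?thesis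
      unfolding state_of_measure_eq[OF True] eq[OF True] int[OF sets_extension] int[OF sets_\<mu>0] dens ..
  qed
qed

end

theorem proposition1p1:
  fixes act :: "'g::group_add \<Rightarrow> 'x::{second_countable_topology, t2_space} \<Rightarrow> 'x"
    and Y :: "'x set"
    and N :: "'g \<Rightarrow> real"
    and \<sigma> :: "real \<Rightarrow> ('g \<times> 'x) op \<Rightarrow> ('g \<times> 'x) op"
    and E :: "('g \<times> 'x) op \<Rightarrow> 'x \<Rightarrow> complex"
    and Ys :: "nat \<Rightarrow> 'x set"
    and gs :: "nat \<Rightarrow> 'g"
    and \<beta> :: real
  assumes "countable (UNIV :: 'g set)"
    and "locally_compact_space (euclidean :: 'x topology)"
    and "\<And>x. act 0 x = x"
    and "\<And>g h x. act (g + h) x = act g (act h x)"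
    and "\<And>g. continuous_on UNIV (act g)"
    and "open Y" and "closed Y"
    and "(\<Union>g. act g ` Y) = UNIV"
    and "\<And>g. N g > 0"
    and "\<And>g h. N (g + h) = N g * N h"
    and "associated_dynamics act Y N \<sigma>"
    and "canonical_expectation act E"
    and "\<And>n. n \<ge> 1 \<Longrightarrow> Ys n \<in> sets borel \<and> Ys n \<subseteq> Y"
    and "{x \<in> Y. \<exists>g. g \<noteq> 0 \<and> act g x = x} \<subseteq> (\<Union>n\<in>{1..}. Ys n)"
    and "\<And>n. n \<ge> 1 \<Longrightarrow> N (gs n) \<noteq> 1"
    and "\<And>n. n \<ge> 1 \<Longrightarrow> act (gs n) ` Ys n = Ys n"
    and "\<beta> \<noteq> 0"
  shows "bij_betw (state_of_measure act Y E) (kms_measures act Y N \<beta>)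
      {\<phi>. is_kms_state (corner act Y) \<sigma> \<beta> \<phi>} \<and>
    (\<forall>\<mu>\<in>kms_measures act Y N \<beta>. \<forall>\<nu>\<in>kms_measures act Y N \<beta>. \<forall>s\<in>{0..1}.
      convex_comb s \<mu> \<nu> \<in> kms_measures act Y N \<beta> \<and>
      (\<forall>a\<in>corner act Y. state_of_measure act Y E (convex_comb s \<mu> \<nu>) a =
        complex_of_real s * state_of_measure act Y E \<mu> a
          + complex_of_real (1 - s) * state_of_measure act Y E \<nu> a))"
proof -
  interpret kms_setting act Y N \<sigma> E \<beta>
    by unfold_locales fact+
  have "\<phi> \<in> state_of_measure act Y E ` M" if \<phi>: "is_kms_state A \<sigma> \<beta> \<phi>" for \<phi>
  proof -
    interpret kms_state act Y N \<sigma> E \<beta> \<phi>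
      by unfold_locales (fact \<phi>)
    \<comment> \<open>A Borel set containing the points of \<open>Y\<close> with nontrivial
      isotropy. It is null, as each \<open>Ys n\<close> is invariant under an element at which
      \<open>N\<close> is not 1.\<close>
    define N0 where "N0 = (\<Union>n\<in>{1..}. Ys n)"
    have "emeasure \<mu>\<^sub>0 (Ys n) = 0" if "n \<ge> 1" for n
      using assms(13,15,16)[OF that] by (intro \<mu>0_invariant_null[OF \<open>\<beta> \<noteq> 0\<close>]) auto
    then have "N0 \<in> null_sets \<mu>\<^sub>0"
      unfolding N0_def using assms(13) by (intro null_sets_UN') (auto simp: null_sets_def sets_\<mu>0)
    then have "\<phi> a = integral\<^sup>L \<mu>\<^sub>0 (E a)" if "a \<in> A" for a
      using assms(14) by (intro \<phi>_eq_integral[of N0] that) (auto simp: null_sets_def sets_\<mu>0 N0_def)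
    then have "extension \<in> M" "state_of_measure act Y E extension = \<phi>"
      by (auto intro: extension_M \<mu>0_Y \<phi>_eq_state_of_extension)
    then show ?thesis by (metis image_eqI)
  qed
  then have "state_of_measure act Y E ` M = {\<phi>. is_kms_state A \<sigma> \<beta> \<phi>}"
    using state_of_measure_kms by blast
  then show ?thesis
    using state_of_measure_inj convex_comb_M state_of_convex_comb by (simp add: bij_betw_def)
qed

end
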